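(* Let $m>1$ and suppose that $U^0,U^1,\dots,U^{m-1}$ in $S_h$ (solving the fully discrete scheme up to step $m-1$) are given. Then there exists a unique $U^m\in S_h$ satisfying the $m$-th step of the fully discrete scheme $$(\delta_tU^m,\chi)+(\Delta\delta_tU^m,\Delta\chi)+\alpha(\nabla U^m,\nabla\chi)=-(g(U^m),\nabla\chi)\quad\text{for all }\chi\in S_h,$$ where $U^0=\Pi_hu(0)$.
   Context: $\Omega\subset\mathbb{R}^n$, $n\le2$, is a bounded polyhedral Lipschitz domain; $T>0$, $\alpha>0$. $(\cdot,\cdot)$, $\|\cdot\|$ are the $L^2(\Omega)$ inner product and norm. $g:\mathbb{R}\to\mathbb{R}^n$ has components $g_i(u)=-(u+\tfrac12u^2)$. $\|u\|_2^2=\|u\|^2+\|\nabla u\|^2+\|\Delta u\|^2$; $\|\cdot\|_r$ is the norm of $H^r(\Omega)$; $H_0^2(\Omega)=\{u\in H^2(\Omega):u|_{\partial\Omega}=0,\ \partial u/\partial n|_{\partial\Omega}=0\}$. For mesh parameters $0<h<1$ of conformal, quasi-uniform simplicial triangulations of $\Omega$, $S_h$ is a finite-dimensional subspace of $H_0^2(\Omega)$ such that for some $r>3$ and a constant $K$ independent of $h$, $\inf_{\phi\in S_h}\|v-\phi\|_2\le Kh^{r-2}\|v\|_r$ for all $v\in H_0^2(\Omega)\cap H^r(\Omega)$. $\Pi_h$ is the projection onto $S_h$ defined for $v\in H_0^2(\Omega)\cap H^r(\Omega)$ by $(\Delta(v-\Pi_hv),\Delta\chi)=0$ for all $\chi\in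 S_h$. $u(0)=u_0$ is the initial datum of the continuous problem. Time discretization: $N\in\mathbb{N}$, $k=T/N$, $t^m=mk$, and $\delta_tU^m=(U^m-U^{m-1})/k$ for $m=1,\dots,N$.
   Formalization: Existence of U^m is shown for every step size k, but uniqueness (almost everywhere in Ω) only for k below some k_0>0 independent of h, N, m and the iterates, since uniqueness without a smallness condition on k is false. *)

theory Defs
  imports "HOL-Analysis.Analysis"
begin

section \<open>Polyhedral Lipschitz domains and their triangulations\<close>

text \<open>
  Near each boundary point the domain is a strict epigraph in a unit direction \<open>e\<close>; the graph
  function \<open>\<gamma>\<close> only sees the component of its argument orthogonal to \<open>e\<close>.
\<close>

definition lipschitz_boundary :: "'a::euclidean_space set \<Rightarrow> bool" where
  "lipschitz_boundary \<Omega> \<longleftrightarrow>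
     (\<forall>x\<in>frontier \<Omega>. \<exists>e \<gamma> L. \<exists>\<delta>>0. norm e = 1 \<and> L-lipschitz_on UNIV (\<gamma> :: 'a \<Rightarrow> real) \<and>
        (\<forall>y\<in>ball x \<delta>. y \<in> \<Omega> \<longleftrightarrow> \<gamma> (y - (y \<bullet> e) *\<^sub>R e) < y \<bullet> e))"

definition polyhedral_lipschitz_domain :: "'a::euclidean_space set \<Rightarrow> bool" where
  "polyhedral_lipschitz_domain \<Omega> \<longleftrightarrow>
     open \<Omega> \<and> connected \<Omega> \<and> \<Omega> \<noteq> {} \<and> bounded \<Omega> \<and> lipschitz_boundary \<Omega> \<and>
     (\<exists>\<P>. finite \<P> \<and> (\<forall>P\<in>\<P>. polytope P) \<and> closure \<Omega> = \<Union>\<P>)"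

definition triangulation_of :: "'a::euclidean_space set \<Rightarrow> 'a set set \<Rightarrow> bool" where
  "triangulation_of \<Omega> \<T> \<longleftrightarrow>
     triangulation \<T> \<and> (\<forall>K\<in>\<T>. int DIM('a) simplex K) \<and> \<Union>\<T> = closure \<Omega>"

text \<open>
  A family indexed by its mesh sizes. An inscribed ball of radius \<open>c * h\<close> in every simplex
  bounds both the aspect ratios and the quotients of diameters uniformly in \<open>h\<close>.
\<close>

definition quasi_uniform_triangulations ::
    "'a::euclidean_space set \<Rightarrow> real set \<Rightarrow> (real \<Rightarrow> 'a set set) \<Rightarrow> bool" where
  "quasi_uniform_triangulations \<Omega> H \<T> \<longleftrightarrow>
     (\<forall>h\<in>H. triangulation_of \<Omega> (\<T> h) \<and> h = Max (diameter ` \<T> h)) \<and>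
     (\<exists>c>0. \<forall>h\<in>H. \<forall>K\<in>\<T> h. \<exists>z. ball z (c * h) \<subseteq> K)"


section \<open>Weak derivatives and Sobolev spaces\<close>

text \<open>
  Elements of \<open>L\<^sup>2(\<Omega>)\<close> are represented by functions on the whole space, of which only the
  restriction to \<open>\<Omega>\<close>, up to null sets, matters.
\<close>

definition L2 :: "'a measure \<Rightarrow> ('a \<Rightarrow> real) \<Rightarrow> bool" where
  "L2 M f \<longleftrightarrow> f \<in> borel_measurable M \<and> integrable M (\<lambda>x. (f x)\<^sup>2)"

definition ip :: "'a::euclidean_space set \<Rightarrow> ('a \<Rightarrow> 'b::real_inner) \<Rightarrow> ('a \<Rightarrow> 'b) \<Rightarrow> real" where
  "ip \<Omega> f g = integral\<^sup>L (lebesgue_on \<Omega>) (\<lambda>x. f x \<bullet> g x)"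

fun partials :: "'n list \<Rightarrow> (real^'n \<Rightarrow> real) \<Rightarrow> real^'n \<Rightarrow> real" where
  "partials [] f = f"
| "partials (i # is) f = (\<lambda>x. frechet_derivative (partials is f) (at x) (axis i 1))"

definition smooth :: "(real^'n \<Rightarrow> real) \<Rightarrow> bool" where
  "smooth f \<longleftrightarrow> (\<forall>is x. partials is f differentiable (at x))"

definition test_function :: "(real^'n) set \<Rightarrow> (real^'n \<Rightarrow> real) \<Rightarrow> bool" where
  "test_function \<Omega> \<phi> \<longleftrightarrow>
     smooth \<phi> \<and> compact (closure {x. \<phi> x \<noteq> 0}) \<and> closure {x. \<phi> x \<noteq> 0} \<subseteq> \<Omega>"

text \<open>
  Multi-indices are multisets of coordinate directions, with \<open>size\<close> as their order. Any
  enumeration \<open>is\<close> of the multi-index may be used for the test function.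
\<close>

definition weak_derivative ::
    "(real^'n) set \<Rightarrow> 'n multiset \<Rightarrow> (real^'n \<Rightarrow> real) \<Rightarrow> (real^'n \<Rightarrow> real) \<Rightarrow> bool" where
  "weak_derivative \<Omega> \<beta> u w \<longleftrightarrow>
     (\<forall>\<phi> is. test_function \<Omega> \<phi> \<and> mset is = \<beta> \<longrightarrow>
        ip \<Omega> u (partials is \<phi>) = (-1) ^ size \<beta> * ip \<Omega> w \<phi>)"

text \<open>Determined up to a null set whenever a square-integrable weak derivative exists.\<close>

definition wderiv :: "(real^'n) set \<Rightarrow> 'n multiset \<Rightarrow> (real^'n \<Rightarrow> real) \<Rightarrow> real^'n \<Rightarrow> real" where
  "wderiv \<Omega> \<beta> u = (SOME w. L2 (lebesgue_on \<Omega>) w \<and> weak_derivative \<Omega> \<beta> u w)"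

definition wgrad :: "(real^'n) set \<Rightarrow> (real^'n \<Rightarrow> real) \<Rightarrow> real^'n \<Rightarrow> real^'n" where
  "wgrad \<Omega> u x = (\<chi> i. wderiv \<Omega> {#i#} u x)"

definition wlap :: "(real^'n) set \<Rightarrow> (real^'n \<Rightarrow> real) \<Rightarrow> real^'n \<Rightarrow> real" where
  "wlap \<Omega> u x = (\<Sum>i\<in>UNIV. wderiv \<Omega> {#i, i#} u x)"

text \<open>
  For non-integer \<open>r\<close> the space \<open>H\<^sup>r(\<Omega>)\<close> is the Sobolev-Slobodeckij space; \<open>slobodeckij \<Omega> s\<close> is
  the square of the Gagliardo seminorm of order \<open>s \<in> (0, 1)\<close>.
\<close>

definition slobodeckij :: "(real^'n) set \<Rightarrow> real \<Rightarrow> (real^'n \<Rightarrow> real) \<Rightarrow> ennreal" where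
  "slobodeckij \<Omega> s f =
     (\<integral>\<^sup>+ x. (\<integral>\<^sup>+ y. ennreal ((f x - f y)\<^sup>2 / norm (x - y) powr (real CARD('n) + 2 * s))
        \<partial>lebesgue_on \<Omega>) \<partial>lebesgue_on \<Omega>)"

definition sobolev :: "(real^'n) set \<Rightarrow> real \<Rightarrow> (real^'n \<Rightarrow> real) \<Rightarrow> bool" where
  "sobolev \<Omega> r u \<longleftrightarrow>
     L2 (lebesgue_on \<Omega>) u \<and>
     (\<forall>\<beta>. int (size \<beta>) \<le> \<lfloor>r\<rfloor> \<longrightarrow> (\<exists>w. L2 (lebesgue_on \<Omega>) w \<and> weak_derivative \<Omega> \<beta> u w)) \<and>
     (0 < frac r \<longrightarrow> (\<forall>\<beta>. int (size \<beta>) = \<lfloor>r\<rfloor> \<longrightarrow> slobodeckij \<Omega> (frac r) (wderiv \<Omega> \<beta> u) < \<infinity>))"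

definition sobolev_norm :: "(real^'n) set \<Rightarrow> real \<Rightarrow> (real^'n \<Rightarrow> real) \<Rightarrow> real" where
  "sobolev_norm \<Omega> r u = sqrt
     ((\<Sum>\<beta> | int (size \<beta>) \<le> \<lfloor>r\<rfloor>. ip \<Omega> (wderiv \<Omega> \<beta> u) (wderiv \<Omega> \<beta> u)) +
      (if 0 < frac r
       then \<Sum>\<beta> | int (size \<beta>) = \<lfloor>r\<rfloor>. enn2real (slobodeckij \<Omega> (frac r) (wderiv \<Omega> \<beta> u)) else 0))"

text \<open>The norm \<open>\<parallel>u\<parallel>\<^sub>2\<close>, which only involves the Laplacian among the second derivatives.\<close>

definition norm2 :: "(real^'n) set \<Rightarrow> (real^'n \<Rightarrow> real) \<Rightarrow> real" where
  "norm2 \<Omega> u = sqrt (ip \<Omega> u u + ip \<Omega> (wgrad \<Omega> u) (wgrad \<Omega> u) + ip \<Omega> (wlap \<Omega> u) (wlap \<Omega> u))"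


section \<open>Traces\<close>

text \<open>
  Hausdorff measure of dimension \<open>d\<close> without normalisation; the usual factor, the volume of the
  \<open>d\<close>-dimensional unit ball over \<open>2 ^ d\<close>, equals 1 in the relevant dimensions \<open>d \<le> 1\<close>.
  For \<open>d = 0\<close> this is counting measure, since \<open>0 ^ 0 = 1\<close>; empty covering sets do not count.
\<close>

definition hausdorff_pre :: "nat \<Rightarrow> real \<Rightarrow> 'a::metric_space set \<Rightarrow> ennreal" where
  "hausdorff_pre d \<delta> A =
     (INF C \<in> {C :: nat \<Rightarrow> 'a set. A \<subseteq> (\<Union>i. C i) \<and> (\<forall>i. bounded (C i) \<and> diameter (C i) \<le> \<delta>)}.
        \<Sum>i. if C i = {} then 0 else ennreal (diameter (C i) ^ d))"

abbreviation hausdorff :: "nat \<Rightarrow> 'a::metric_space set \<Rightarrow> ennreal" where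
  "hausdorff d A \<equiv> (SUP \<delta>\<in>{0<..}. hausdorff_pre d \<delta> A)"

definition hausdorff_measure :: "nat \<Rightarrow> 'a::metric_space measure" where
  "hausdorff_measure d = measure_of UNIV (sets borel) (hausdorff d)"

text \<open>
  \<open>measure_of\<close> yields the null measure if the set function is not countably additive. The lemmas
  up to \<open>emeasure_hausdorff_measure\<close> exclude this, by Caratheodory's criterion.
\<close>

lemma hausdorff_pre_le:
  assumes "A \<subseteq> (\<Union>i. C i)" "\<And>i. bounded (C i)" "\<And>i. diameter (C i) \<le> \<delta>"
  shows "hausdorff_pre d \<delta> A \<le> (\<Sum>i. if C i = {} then 0 else ennreal (diameter (C i) ^ d))"
  unfolding hausdorff_pre_def using assms by (intro INF_lower) auto

lemma hausdorff_pre_mono: "A \<subseteq> B \<Longrightarrow> hausdorff_pre d \<delta> A \<le> hausdorff_pre d \<delta> B"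
  unfolding hausdorff_pre_def by (intro INF_superset_mono) auto

lemma hausdorff_pre_empty: "0 < \<delta> \<Longrightarrow> hausdorff_pre d \<delta> {} = 0"
  using hausdorff_pre_le[of "{}" "\<lambda>_. {}" \<delta> d] by (simp add: diameter_def)

lemma hausdorff_pre_antimono:
  assumes "\<delta> \<le> \<epsilon>" shows "hausdorff_pre d \<epsilon> A \<le> hausdorff_pre d \<delta> A"
  unfolding hausdorff_pre_def using assms by (intro INF_superset_mono) (auto intro: order_trans)

lemma hausdorff_pre_UN:
  fixes A :: "nat \<Rightarrow> 'a::metric_space set"
  shows "hausdorff_pre d \<delta> (\<Union>i. A i) \<le> (\<Sum>i. hausdorff_pre d \<delta> (A i))"
proof (rule ennreal_le_epsilon)
  fix e :: real assume e: "0 < e" and fin: "(\<Sum>i. hausdorff_pre d \<delta> (A i)) < top"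
  let ?v = "\<lambda>C :: nat \<Rightarrow> 'a set. \<lambda>i. if C i = {} then 0 else ennreal (diameter (C i) ^ d)"
  have "\<exists>C. A i \<subseteq> (\<Union>j. C j) \<and> (\<forall>j. bounded (C j) \<and> diameter (C j) \<le> \<delta>) \<and>
      (\<Sum>j. ?v C j) \<le> hausdorff_pre d \<delta> (A i) + ennreal (e * (1/2) ^ Suc i)" for i
  proof -
    have "hausdorff_pre d \<delta> (A i) < top"
      using fin by (metis ennreal_suminf_lessD)
    then have "hausdorff_pre d \<delta> (A i) < hausdorff_pre d \<delta> (A i) + ennreal (e * (1/2) ^ Suc i)"
      using e by (simp add: ennreal_add_left_cancel_less less_top[symmetric] pos2 ennreal_zero_less_mult_iff)
    then show ?thesis
      unfolding hausdorff_pre_def[of d \<delta> "A i"] INF_less_iff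
      by (force intro: less_imp_le)
  qed
  then obtain C where C': "\<forall>i. A i \<subseteq> (\<Union>j. C i j) \<and> (\<forall>j. bounded (C i j) \<and> diameter (C i j) \<le> \<delta>) \<and>
      (\<Sum>j. ?v (C i) j) \<le> hausdorff_pre d \<delta> (A i) + ennreal (e * (1/2) ^ Suc i)"
    using choice[where Q = "\<lambda>i C. A i \<subseteq> (\<Union>j. C j) \<and> (\<forall>j. bounded (C j) \<and> diameter (C j) \<le> \<delta>) \<and>
      (\<Sum>j. ?v C j) \<le> hausdorff_pre d \<delta> (A i) + ennreal (e * (1/2) ^ Suc i)"] by blast
  have C: "A i \<subseteq> (\<Union>j. C i j)" "bounded (C i j)" "diameter (C i j) \<le> \<delta>"
     "(\<Sum>j. ?v (C i) j) \<le> hausdorff_pre d \<delta> (A i) + ennreal (e * (1/2) ^ Suc i)" for i j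
    using C' by simp_all
  let ?D = "\<lambda>n. case prod_decode n of (i, j) \<Rightarrow> C i j"
  have "(\<Union>i. A i) \<subseteq> (\<Union>n. ?D n)"
  proof
    fix x assume "x \<in> (\<Union>i. A i)"
    then obtain i j where "x \<in> C i j" using C(1) by blast
    then show "x \<in> (\<Union>n. ?D n)"
      by (intro UN_I[of "prod_encode (i, j)"]) auto
  qed
  then have "hausdorff_pre d \<delta> (\<Union>i. A i) \<le> (\<Sum>n. ?v ?D n)"
    using C by (intro hausdorff_pre_le) (auto split: prod.split)
  also have "\<dots> = (\<Sum>n. (\<lambda>(i, j). ?v (C i) j) (prod_decode n))"
    by (intro arg_cong[where f=suminf] ext) (auto split: prod.split)
  also have "\<dots> = (\<Sum>i. \<Sum>j. ?v (C i) j)"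
    by (intro suminf_ennreal_2dimen[where f = "\<lambda>(i, j). ?v (C i) j", unfolded comp_def]) simp
  also have "\<dots> \<le> (\<Sum>i. hausdorff_pre d \<delta> (A i) + ennreal (e * (1/2) ^ Suc i))"
    using C(4) by (intro suminf_le) auto
  also have "\<dots> = (\<Sum>i. hausdorff_pre d \<delta> (A i)) + (\<Sum>i. ennreal (e * (1/2) ^ Suc i))"
    by (rule suminf_add[symmetric]) auto
  also have "(\<Sum>i. ennreal (e * (1/2) ^ Suc i)) = ennreal e"
    using e sums_mult[OF power_half_series, of e]
    by (intro suminf_ennreal_eq) auto
  finally show "hausdorff_pre d \<delta> (\<Union>i. A i) \<le> (\<Sum>i. hausdorff_pre d \<delta> (A i)) + ennreal e" .
qed

lemma hausdorff_pre_separated: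
  fixes A B :: "'a::metric_space set"
  assumes sep: "\<And>x y. x \<in> A \<Longrightarrow> y \<in> B \<Longrightarrow> \<delta> < dist x y" and "0 < \<delta>"
  shows "hausdorff_pre d \<delta> A + hausdorff_pre d \<delta> B \<le> hausdorff_pre d \<delta> (A \<union> B)"
  unfolding hausdorff_pre_def[of d \<delta> "A \<union> B"]
proof (rule INF_greatest, clarify)
  fix C :: "nat \<Rightarrow> 'a set"
  assume cov: "A \<union> B \<subseteq> (\<Union>i. C i)" and C: "\<forall>i. bounded (C i) \<and> diameter (C i) \<le> \<delta>"
  let ?v = "\<lambda>C :: nat \<Rightarrow> 'a set. \<lambda>i. if C i = {} then 0 else ennreal (diameter (C i) ^ d)"
  let ?CA = "\<lambda>i. if C i \<inter> A = {} then {} else C i" and ?CB = "\<lambda>i. if C i \<inter> B = {} then {} else C i"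
  have disj: "C i \<inter> A = {} \<or> C i \<inter> B = {}" for i
  proof (rule ccontr)
    assume "\<not> ?thesis"
    then obtain x y where "x \<in> C i" "x \<in> A" "y \<in> C i" "y \<in> B" by blast
    then show False
      using sep[of x y] C diameter_bounded_bound[of "C i" x y] by (meson not_less order_trans)
  qed
  have "hausdorff_pre d \<delta> A \<le> (\<Sum>i. ?v ?CA i)"
  proof (rule hausdorff_pre_le)
    show "A \<subseteq> (\<Union>i. ?CA i)"
    proof
      fix x assume "x \<in> A"
      moreover from this obtain i where "x \<in> C i" using cov by blast
      ultimately have "x \<in> ?CA i" by auto
      then show "x \<in> (\<Union>i. ?CA i)" by (rule UN_I[OF UNIV_I])
    qed
  qed (use C \<open>0 < \<delta>\<close> in auto)
  moreover have "hausdorff_pre d \<delta> B \<le> (\<Sum>i. ?v ?CB i)"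
  proof (rule hausdorff_pre_le)
    show "B \<subseteq> (\<Union>i. ?CB i)"
    proof
      fix x assume "x \<in> B"
      moreover from this obtain i where "x \<in> C i" using cov by blast
      ultimately have "x \<in> ?CB i" by auto
      then show "x \<in> (\<Union>i. ?CB i)" by (rule UN_I[OF UNIV_I])
    qed
  qed (use C \<open>0 < \<delta>\<close> in auto)
  ultimately have "hausdorff_pre d \<delta> A + hausdorff_pre d \<delta> B \<le> (\<Sum>i. ?v ?CA i) + (\<Sum>i. ?v ?CB i)"
    by (rule add_mono)
  also have "\<dots> = (\<Sum>i. ?v ?CA i + ?v ?CB i)"
    by (rule suminf_add) auto
  also have "\<dots> \<le> (\<Sum>i. ?v C i)"
    using disj by (intro suminf_le) auto
  finally show "hausdorff_pre d \<delta> A + hausdorff_pre d \<delta> B \<le> (\<Sum>i. ?v C i)" .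
qed

lemma hausdorff_mono: "A \<subseteq> B \<Longrightarrow> hausdorff d A \<le> hausdorff d B"
  by (intro SUP_mono) (auto intro: hausdorff_pre_mono)

lemma hausdorff_UN: "hausdorff d (\<Union>i::nat. A i) \<le> (\<Sum>i. hausdorff d (A i))"
proof (rule SUP_least)
  fix \<delta> :: real assume "\<delta> \<in> {0<..}"
  then have "(\<Sum>i. hausdorff_pre d \<delta> (A i)) \<le> (\<Sum>i. hausdorff d (A i))"
    by (intro suminf_le) (auto intro: SUP_upper)
  then show "hausdorff_pre d \<delta> (\<Union>i. A i) \<le> (\<Sum>i. hausdorff d (A i))"
    using hausdorff_pre_UN order_trans by blast
qed

lemma hausdorff_empty: "hausdorff d {} = 0"
proof -
  have "hausdorff d {} = (SUP \<delta>\<in>{0::real<..}. 0)"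
    by (intro SUP_cong) (auto simp: hausdorff_pre_empty)
  then show ?thesis by simp
qed

lemma hausdorff_outer: "outer_measure_space (Pow UNIV) (hausdorff d)"
  unfolding outer_measure_space_def positive_def increasing_def countably_subadditive_def
  by (intro conjI allI ballI impI hausdorff_empty hausdorff_mono hausdorff_UN) assumption

lemma hausdorff_separated:
  fixes A B :: "'a::metric_space set"
  assumes sep: "\<And>x y. x \<in> A \<Longrightarrow> y \<in> B \<Longrightarrow> \<rho> \<le> dist x y" and "0 < \<rho>"
  shows "hausdorff d A + hausdorff d B \<le> hausdorff d (A \<union> B)"
proof -
  have dir: "hausdorff d C = (SUP \<delta>\<in>{0<..<\<rho>}. hausdorff_pre d \<delta> C)" for C :: "'a set"
  proof (rule antisym[OF SUP_mono SUP_subset_mono])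
    fix \<delta> :: real assume "\<delta> \<in> {0<..}"
    then have "min \<delta> (\<rho>/2) \<in> {0<..<\<rho>}" "hausdorff_pre d \<delta> C \<le> hausdorff_pre d (min \<delta> (\<rho>/2)) C"
      using \<open>0 < \<rho>\<close> by (auto intro!: hausdorff_pre_antimono)
    then show "\<exists>\<epsilon>\<in>{0<..<\<rho>}. hausdorff_pre d \<delta> C \<le> hausdorff_pre d \<epsilon> C" by blast
  qed auto
  have "hausdorff d A + hausdorff d B = (SUP \<delta>\<in>{0<..<\<rho>}. hausdorff_pre d \<delta> A + hausdorff_pre d \<delta> B)"
    unfolding dir
  proof (rule SUP_add_directed_ennreal[symmetric])
    fix i j assume "i \<in> {0<..<\<rho>}" "j \<in> {0<..<\<rho>}"
    then show "\<exists>k\<in>{0<..<\<rho>}. hausdorff_pre d i A + hausdorff_pre d j B \<le> hausdorff_pre d k A + hausdorff_pre d k B"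
      by (intro bexI[of _ "min i j"] add_mono hausdorff_pre_antimono) auto
  qed
  also have "\<dots> \<le> (SUP \<delta>\<in>{0<..<\<rho>}. hausdorff_pre d \<delta> (A \<union> B))"
    using sep by (intro SUP_mono) (fastforce intro!: hausdorff_pre_separated)
  finally show ?thesis by (simp only: dir)
qed

lemma ennreal_suminf_tail:
  fixes f :: "nat \<Rightarrow> ennreal"
  assumes fin: "(\<Sum>j. f j) \<noteq> top"
  shows "(\<lambda>n. \<Sum>j. f (j + n)) \<longlonglongrightarrow> 0"
proof -
  define g where "g j = enn2real (f j)" for j
  have g0: "0 \<le> g j" for j by (simp add: g_def)
  have "f j \<noteq> top" for j
    using ennreal_suminf_lessD[of f top j] fin by (auto simp: less_top)
  then have f: "f j = ennreal (g j)" for j by (simp add: g_def less_top)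
  have sm: "summable g"
    using fin g0 unfolding f by (intro summable_suminf_not_top) auto
  have tail: "(\<Sum>j. f (j + n)) = ennreal ((\<Sum>j. g j) - (\<Sum>j<n. g j))" for n
    unfolding f using suminf_minus_initial_segment[OF sm, of n] g0 sm
    by (subst suminf_ennreal2) (auto simp: summable_iff_shift)
  have "(\<lambda>n. (\<Sum>j. g j) - (\<Sum>j<n. g j)) \<longlonglongrightarrow> (\<Sum>j. g j) - (\<Sum>j. g j)"
    by (intro tendsto_diff tendsto_const summable_LIMSEQ sm)
  then have "(\<lambda>n. ennreal ((\<Sum>j. g j) - (\<Sum>j<n. g j))) \<longlonglongrightarrow> ennreal 0"
    by (intro tendsto_ennrealI) simp
  then show ?thesis by (simp add: tail)
qed

lemma closed_in_lambda:
  fixes F :: "'a::metric_space set"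
  assumes "closed F"
  shows "F \<in> lambda_system UNIV (Pow UNIV) (hausdorff d)"
proof -
  let ?h = "hausdorff d :: 'a set \<Rightarrow> ennreal"
  interpret P: sigma_algebra "UNIV :: 'a set" "Pow UNIV" by (rule sigma_algebra_Pow)
  have Un: "?h (A \<union> B) \<le> ?h A + ?h B" for A B
  proof -
    have "subadditive (Pow UNIV) ?h"
      using hausdorff_outer[of d, where ?'a = 'a]
      unfolding outer_measure_space_def by (intro P.countably_subadditive_subadditive) auto
    then have "?h (A \<union> (B - A)) \<le> ?h A + ?h (B - A)"
      by (rule subadditiveD) auto
    also have "\<dots> \<le> ?h A + ?h B"
      by (intro add_left_mono hausdorff_mono) auto
    finally show ?thesis by simp
  qed
  have main: "?h (E \<inter> F) + ?h (E - F) \<le> ?h E" if "F \<noteq> {}" "?h E < top" for E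
  proof -
    define D where "D n = {x \<in> E. 1 / Suc n \<le> infdist x F}" for n :: nat
    have DE: "D n \<subseteq> E" for n by (auto simp: D_def)
    have dle: "infdist x F \<le> dist x y + infdist y F" for x y
      by (simp add: infdist_triangle add.commute)
    define R where "R n = D (Suc n) - D n" for n
    have gap: "(0::real) < 1 / Suc n - 1 / Suc (Suc n)" for n
      by (intro diff_gt_0_iff_gt[THEN iffD2] divide_strict_left_mono) auto
    have step: "?h (D n) + ?h (R (Suc n)) \<le> ?h (D (Suc (Suc n)))" for n
    proof -
      have "?h (D n) + ?h (R (Suc n)) \<le> ?h (D n \<union> R (Suc n))"
      proof (rule hausdorff_separated[OF _ gap[of n]])
        fix x y assume "x \<in> D n" "y \<in> R (Suc n)"
        then have "1 / Suc n \<le> infdist x F" "infdist y F < 1 / Suc (Suc n)"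
          by (auto simp: D_def R_def)
        then show "1 / Suc n - 1 / Suc (Suc n) \<le> dist x y" using dle[of x y] by linarith
      qed
      also have "D n \<subseteq> D (Suc (Suc n))"
      proof -
        have "1 / real (Suc (Suc (Suc n))) \<le> 1 / real (Suc n)" by (intro divide_left_mono) auto
        then show ?thesis by (auto simp: D_def)
      qed
      then have "?h (D n \<union> R (Suc n)) \<le> ?h (D (Suc (Suc n)))"
        by (intro hausdorff_mono) (auto simp: R_def)
      finally show ?thesis .
    qed
    have s: "(\<Sum>j<n. ?h (R (Suc j))) \<le> ?h (D n) + ?h (D (Suc n))" for n
    proof (induction n)
      case (Suc n)
      have "(\<Sum>j<Suc n. ?h (R (Suc j))) \<le> (?h (D n) + ?h (D (Suc n))) + ?h (R (Suc n))"
        using Suc by (simp add: add_right_mono)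
      also have "\<dots> = ?h (D (Suc n)) + (?h (D n) + ?h (R (Suc n)))" by (simp add: ac_simps)
      also have "\<dots> \<le> ?h (D (Suc n)) + ?h (D (Suc (Suc n)))" by (intro add_left_mono step)
      finally show ?case .
    qed simp
    have "(\<Sum>j<n. ?h (R (Suc j))) \<le> ?h E + ?h E" for n
      using s[of n] add_mono[OF hausdorff_mono[OF DE] hausdorff_mono[OF DE]] by (rule order_trans)
    then have "(\<Sum>j. ?h (R (Suc j))) \<le> ?h E + ?h E"
      by (intro suminf_le_const) auto
    then have fin: "(\<Sum>j. ?h (R (Suc j))) \<noteq> top"
      using \<open>?h E < top\<close> by (metis ennreal_add_eq_top order_less_irrefl top_unique)
    have cov: "E - F \<subseteq> D (Suc n) \<union> (\<Union>j. R (Suc (j + n)))" for n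
    proof
      fix x assume x: "x \<in> E - F"
      then have "0 < infdist x F"
        using \<open>closed F\<close> \<open>F \<noteq> {}\<close> by (metis DiffD2 in_closed_iff_infdist_zero infdist_nonneg order_less_le)
      then obtain l where "1 / Suc l < infdist x F"
        using nat_approx_posE by blast
      then have ex: "\<exists>l. x \<in> D l" using x by (auto simp: D_def intro: less_imp_le)
      define l where "l = (LEAST l. x \<in> D l)"
      have l: "x \<in> D l" unfolding l_def using ex by (rule LeastI_ex)
      show "x \<in> D (Suc n) \<union> (\<Union>j. R (Suc (j + n)))"
      proof (cases "l \<le> Suc n")
        case True
        then have "1 / real (Suc (Suc n)) \<le> 1 / real (Suc l)" by (simp add: field_simps)
        then show ?thesis using l by (auto simp: D_def)
      next
        case False
        then obtain j where j: "l = Suc (Suc (j + n))"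
          by (metis add.commute less_iff_Suc_add not_le add_Suc)
        have "x \<notin> D (Suc (j + n))" using not_less_Least[of "Suc (j+n)" "\<lambda>l. x \<in> D l"] j
          by (auto simp: l_def)
        then have "x \<in> R (Suc (j + n))" using l j by (auto simp: R_def)
        then show ?thesis by blast
      qed
    qed
    have est: "?h (E \<inter> F) + ?h (E - F) \<le> ?h E + (\<Sum>j. ?h (R (Suc (j + n))))" for n
    proof -
      have "?h (E - F) \<le> ?h (D (Suc n)) + (\<Sum>j. ?h (R (Suc (j + n))))"
        by (rule order_trans[OF hausdorff_mono[OF cov] order_trans[OF Un add_left_mono[OF hausdorff_UN]]])
      then have "?h (E \<inter> F) + ?h (E - F) \<le> (?h (E \<inter> F) + ?h (D (Suc n))) + (\<Sum>j. ?h (R (Suc (j + n))))"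
        by (simp only: add.assoc add_left_mono)
      also have "?h (E \<inter> F) + ?h (D (Suc n)) \<le> ?h (E \<inter> F \<union> D (Suc n))"
      proof (rule hausdorff_separated)
        fix x y assume "x \<in> E \<inter> F" "y \<in> D (Suc n)"
        then show "1 / real (Suc (Suc n)) \<le> dist x y"
          using infdist_le[of x F y] by (auto simp: D_def dist_commute)
      qed simp
      also have "\<dots> \<le> ?h E" using DE by (intro hausdorff_mono) auto
      finally show ?thesis by (simp add: add_right_mono)
    qed
    have "(\<lambda>n. \<Sum>j. ?h (R (Suc (j + n)))) \<longlonglongrightarrow> 0"
      using fin by (rule ennreal_suminf_tail)
    then have "(\<lambda>n. ?h E + (\<Sum>j. ?h (R (Suc (j + n))))) \<longlonglongrightarrow> ?h E + 0"
      by (intro tendsto_add) auto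
    then show ?thesis
      using est by (intro LIMSEQ_le_const[where X = "\<lambda>n. ?h E + (\<Sum>j. ?h (R (Suc (j + n))))"]) auto
  qed
  have "?h (F \<inter> E) + ?h ((UNIV - F) \<inter> E) = ?h E" for E
  proof (rule antisym)
    show "?h E \<le> ?h (F \<inter> E) + ?h ((UNIV - F) \<inter> E)"
      using Un[of "F \<inter> E" "(UNIV - F) \<inter> E"] by (simp add: Int_Un_distrib2[symmetric])
    have eq: "F \<inter> E = E \<inter> F" "(UNIV - F) \<inter> E = E - F" by auto
    show "?h (F \<inter> E) + ?h ((UNIV - F) \<inter> E) \<le> ?h E"
    proof (cases "F = {}")
      case False
      then show ?thesis
        unfolding eq using main[of E] by (cases "?h E = top") (simp_all only: less_top top_greatest simp_thms)
    qed (simp add: hausdorff_empty)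
  qed
  then show ?thesis by (simp add: lambda_system_def)
qed

lemma emeasure_hausdorff_measure:
  fixes A :: "'a::metric_space set"
  assumes "A \<in> sets borel"
  shows "emeasure (hausdorff_measure d) A = hausdorff d A"
proof -
  let ?L = "lambda_system UNIV (Pow UNIV) (hausdorff d :: 'a set \<Rightarrow> ennreal)"
  interpret P: sigma_algebra "UNIV :: 'a set" "Pow UNIV" by (rule sigma_algebra_Pow)
  have ms: "measure_space UNIV ?L (hausdorff d)"
    by (rule P.caratheodory_lemma[OF hausdorff_outer])
  then interpret L: sigma_algebra "UNIV :: 'a set" ?L by (simp add: measure_space_def)
  have "sets borel = sigma_sets (UNIV :: 'a set) {F. closed F}"
    by (simp add: borel_eq_closed)
  also have "\<dots> \<subseteq> ?L"
    by (rule L.sigma_sets_subset) (use closed_in_lambda in blast)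
  finally have sub: "sets borel \<subseteq> ?L" .
  have "countably_additive (sets borel) (hausdorff d :: 'a set \<Rightarrow> ennreal)"
    using ms sub by (auto simp: measure_space_def countably_additive_def)
  moreover have "positive (sets borel) (hausdorff d :: 'a set \<Rightarrow> ennreal)"
    by (simp add: positive_def hausdorff_empty)
  moreover have "sigma_sets UNIV (sets borel) = sets (borel :: 'a measure)"
    using sets.sigma_sets_eq[of "borel :: 'a measure"] by simp
  ultimately show ?thesis
    using assms by (intro emeasure_measure_of[OF hausdorff_measure_def])
      (auto simp: hausdorff_measure_def sets_measure_of)
qed

definition surface_measure :: "'a::euclidean_space set \<Rightarrow> 'a measure" where
  "surface_measure \<Omega> = restrict_space (hausdorff_measure (DIM('a) - 1)) (frontier \<Omega>)"

text \<open>
  The trace operator is the continuous extension to \<open>H\<^sup>1(\<Omega>)\<close> of the restriction to the boundary,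
  defined on the functions that are smooth up to the boundary.
\<close>

definition has_trace ::
    "(real^'n) set \<Rightarrow> (real^'n \<Rightarrow> real) \<Rightarrow> (real^'n \<Rightarrow> real) \<Rightarrow> bool" where
  "has_trace \<Omega> u w \<longleftrightarrow>
     sobolev \<Omega> 1 u \<and> L2 (surface_measure \<Omega>) w \<and>
     (\<exists>\<phi>. (\<forall>j. smooth (\<phi> j)) \<and>
        (\<lambda>j::nat. sobolev_norm \<Omega> 1 (\<lambda>x. \<phi> j x - u x)) \<longlonglongrightarrow> 0 \<and>
        (\<lambda>j. \<integral>\<^sup>+ x. ennreal ((\<phi> j x - w x)\<^sup>2) \<partial>surface_measure \<Omega>) \<longlonglongrightarrow> 0)"

text \<open>Exists at all points in the relative interior of a face of a polyhedral domain.\<close>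

definition outward_normal :: "'a::euclidean_space set \<Rightarrow> 'a \<Rightarrow> 'a \<Rightarrow> bool" where
  "outward_normal \<Omega> x \<nu> \<longleftrightarrow>
     norm \<nu> = 1 \<and> (\<exists>\<delta>>0. \<forall>y\<in>ball x \<delta>. y \<in> \<Omega> \<longleftrightarrow> (y - x) \<bullet> \<nu> < 0)"

definition H02 :: "(real^'n) set \<Rightarrow> (real^'n \<Rightarrow> real) \<Rightarrow> bool" where
  "H02 \<Omega> u \<longleftrightarrow>
     sobolev \<Omega> 2 u \<and> has_trace \<Omega> u (\<lambda>_. 0) \<and>
     (\<exists>w :: real^'n \<Rightarrow> real^'n.
        (\<forall>i. has_trace \<Omega> (wderiv \<Omega> {#i#} u) (\<lambda>x. w x $ i)) \<and>
        (AE x in surface_measure \<Omega>. \<forall>\<nu>. outward_normal \<Omega> x \<nu> \<longrightarrow> w x \<bullet> \<nu> = 0))"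


section \<open>Finite element spaces and the fully discrete scheme\<close>

text \<open>
  The linear span of finitely many functions. The elements represent classes modulo almost
  everywhere equality on \<open>\<Omega>\<close>.
\<close>

definition finite_dimensional_space :: "('a \<Rightarrow> real) set \<Rightarrow> bool" where
  "finite_dimensional_space V \<longleftrightarrow>
     (\<exists>B. finite B \<and> V = {v. \<exists>c. v = (\<lambda>x. \<Sum>b\<in>B. c b * b x)})"

definition fe_spaces ::
    "(real^'n) set \<Rightarrow> real set \<Rightarrow> (real \<Rightarrow> (real^'n \<Rightarrow> real) set) \<Rightarrow> real \<Rightarrow> real \<Rightarrow> bool" where
  "fe_spaces \<Omega> H S r K \<longleftrightarrow>
     (\<forall>h\<in>H. finite_dimensional_space (S h) \<and> (\<forall>v\<in>S h. H02 \<Omega> v) \<and>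
        (\<forall>v. H02 \<Omega> v \<and> sobolev \<Omega> r v \<longrightarrow>
           (INF \<phi>\<in>S h. norm2 \<Omega> (\<lambda>x. v x - \<phi> x)) \<le> K * h powr (r - 2) * sobolev_norm \<Omega> r v))"

text \<open>\<open>P = \<Pi>\<^sub>h v\<close> for the space \<open>V = S\<^sub>h\<close>.\<close>

definition is_projection ::
    "(real^'n) set \<Rightarrow> (real^'n \<Rightarrow> real) set \<Rightarrow> (real^'n \<Rightarrow> real) \<Rightarrow> (real^'n \<Rightarrow> real) \<Rightarrow> bool" where
  "is_projection \<Omega> V v P \<longleftrightarrow>
     P \<in> V \<and> (\<forall>\<psi>\<in>V. ip \<Omega> (wlap \<Omega> (\<lambda>x. v x - P x)) (wlap \<Omega> \<psi>) = 0)"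

definition flux :: "real \<Rightarrow> real^'n" where
  "flux s = (\<chi> i. - (s + s\<^sup>2 / 2))"

definition diff_quot :: "real \<Rightarrow> ('a \<Rightarrow> real) \<Rightarrow> ('a \<Rightarrow> real) \<Rightarrow> 'a \<Rightarrow> real" where
  "diff_quot k U0 U1 x = (U1 x - U0 x) / k"

text \<open>One step of length \<open>k\<close> of the scheme in the space \<open>V\<close>, leading from \<open>U0\<close> to \<open>U1\<close>.\<close>

definition scheme_step ::
    "(real^'n) set \<Rightarrow> (real^'n \<Rightarrow> real) set \<Rightarrow> real \<Rightarrow> real \<Rightarrow>
     (real^'n \<Rightarrow> real) \<Rightarrow> (real^'n \<Rightarrow> real) \<Rightarrow> bool" where
  "scheme_step \<Omega> V \<alpha> k U0 U1 \<longleftrightarrow>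
     (\<forall>\<psi>\<in>V. ip \<Omega> (diff_quot k U0 U1) \<psi> + ip \<Omega> (wlap \<Omega> (diff_quot k U0 U1)) (wlap \<Omega> \<psi>)
        + \<alpha> * ip \<Omega> (wgrad \<Omega> U1) (wgrad \<Omega> \<psi>) = - ip \<Omega> (\<lambda>x. flux (U1 x)) (wgrad \<Omega> \<psi>))"

end

theory Submission
  imports Defs "HOL-Homology.Brouwer_Degree"
begin

text \<open>
  Write \<open>A(u, v) = (u, v) + (\<Delta>u, \<Delta>v)\<close> and let \<open>k\<close> be the time step. Tested with \<open>U\<^sup>m\<close> itself, the
  scheme reads \<open>A(U\<^sup>m, U\<^sup>m) + k \<alpha> \<parallel>\<nabla>U\<^sup>m\<parallel>\<^sup>2 = A(U\<^sup>m\<^sup>-\<^sup>1, U\<^sup>m)\<close>, because \<open>(g(v), \<nabla>v) = 0\<close> for functions \<open>v\<close> with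
  vanishing trace. This yields solvability and an a priori bound.

  Existence (\<open>step_exists\<close>): in coordinates with respect to an \<open>A\<close>-orthonormal system the residual is
  a polynomial vector field which points outwards on a large sphere, so it vanishes somewhere inside
  (\<open>outward_field_has_zero\<close>); the latter follows because a sphere is not contractible. No smallness of
  \<open>k\<close> is needed.

  A priori bound (\<open>energy_decreasing\<close>, \<open>projection_bound\<close>): \<open>A(U\<^sup>m, U\<^sup>m)\<close> does not increase with \<open>m\<close>, and
  \<open>A(U\<^sup>0, U\<^sup>0) \<le> C \<parallel>\<Delta>u\<^sub>0\<parallel>\<^sup>2\<close> since \<open>\<parallel>\<Delta>U\<^sup>0\<parallel> \<le> \<parallel>\<Delta>u\<^sub>0\<parallel>\<close> for the projection. The bound depends neither on the mesh
  nor on \<open>k\<close>.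

  Uniqueness for small \<open>k\<close> (\<open>step_unique\<close>): the difference \<open>e\<close> of two solutions \<open>V\<close>, \<open>V'\<close> satisfies
  \<open>A(e, e) + k \<alpha> \<parallel>\<nabla>e\<parallel>\<^sup>2 = k/2 \<Sum>\<^sub>i \<integral> e (V + V') \<partial>\<^sub>ie\<close>. By Hoelder's inequality, Ladyzhenskaya's inequality
  \<open>\<parallel>v\<parallel>\<^sub>4\<^sup>4 \<le> C \<parallel>v\<parallel>\<^sup>2 \<parallel>\<nabla>v\<parallel>\<^sup>2\<close>, which needs \<open>n \<le> 2\<close>, and Green's identity \<open>\<parallel>\<nabla>v\<parallel>\<^sup>2 = -(v, \<Delta>v) \<le> A(v, v)\<close>, the
  right-hand side is at most \<open>k C' A(e, e)\<close>, where \<open>C'\<close> depends only on \<open>\<Omega>\<close> and \<open>u\<^sub>0\<close>.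

  All facts about functions with vanishing trace (Poincare's and Ladyzhenskaya's inequalities, Green's
  identity, \<open>(g(v), \<nabla>v) = 0\<close>) rest on one estimate, \<open>gauss_green_bound\<close>: the integral of \<open>\<partial>\<^sub>if\<close> over a
  bounded open set \<open>\<Omega>\<close> is at most the integral of \<open>\<bar>f\<bar>\<close> over the boundary with respect to the
  \<open>(n-1)\<close>-dimensional Hausdorff measure, whatever the boundary looks like. It is applied to products
  of the smooth functions which approximate \<open>v\<close> in \<open>H\<^sup>1(\<Omega>)\<close> and whose boundary values tend to those of
  \<open>v\<close>; as the boundary values of \<open>v\<close> vanish, the boundary integrals disappear in the limit. That the
  weak derivatives chosen by \<open>wderiv\<close> are linear up to null sets is the fundamental lemma of the
  calculus of variations, \<open>AE_zero_if_test_zero\<close>.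
\<close>

\<comment> \<open>the \<open>top\<close> of lattices and of \<open>ennreal\<close> is meant throughout, not that of the order structures of algebra\<close>
hide_const (open) Order.top

\<comment> \<open>likewise, an unbounded sum sign denotes an infinite series\<close>
no_syntax
  "_Sum_any" :: "pttrn \<Rightarrow> 'a \<Rightarrow> 'a::comm_monoid_add"
    (\<open>(\<open>indent=2 notation=\<open>binder \<Sum>\<close>\<close>\<Sum>_. _)\<close> [0, 10] 10)

section \<open>An integral bound by boundary values\<close>

text \<open>
  Sweeping \<open>A\<close> over a distance \<open>t\<close> in a coordinate direction produces a set of volume at most
  \<open>t\<close> times the \<open>(n-1)\<close>-dimensional Hausdorff measure of \<open>A\<close>: each set of diameter \<open>d\<close> in a fine cover
  of \<open>A\<close> sweeps out a set that fits into a box of volume \<open>d\<^sup>n\<^sup>-\<^sup>1 (t + d)\<close>.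
\<close>

lemma tube_measure:
  fixes A :: "'a::euclidean_space set"
  assumes A: "compact A" and e: "e \<in> Basis" and t: "0 < t"
  shows "emeasure lborel ((\<lambda>(a, s). a + s *\<^sub>R e) ` (A \<times> {0..t})) \<le> ennreal t * hausdorff (DIM('a) - 1) A"
proof -
  let ?T = "(\<lambda>(a, s). a + s *\<^sub>R e) ` (A \<times> {0..t})"
  let ?d = "DIM('a) - 1"
  have cover: "emeasure lborel ?T * ennreal (1 / (t + \<delta>)) \<le> hausdorff_pre ?d \<delta> A" if \<delta>: "0 < \<delta>" for \<delta>
    unfolding hausdorff_pre_def
  proof (rule INF_greatest, clarify)
    fix C :: "nat \<Rightarrow> 'a set"
    assume cov: "A \<subseteq> (\<Union>i. C i)" and C: "\<forall>i. bounded (C i) \<and> diameter (C i) \<le> \<delta>"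
    \<comment> \<open>the bounding box of \<open>C i\<close>, lengthened by \<open>t\<close> in direction \<open>e\<close>\<close>
    let ?l = "\<lambda>i. \<Sum>b\<in>Basis. Inf ((\<lambda>x. x \<bullet> b) ` C i) *\<^sub>R b"
    let ?u = "\<lambda>i. \<Sum>b\<in>Basis. (Sup ((\<lambda>x. x \<bullet> b) ` C i) + (if b = e then t else 0)) *\<^sub>R b"
    let ?B = "\<lambda>i. if C i = {} then {} else cbox (?l i) (?u i)"
    have bdd: "bounded ((\<lambda>x. x \<bullet> b) ` C i)" for i b
      using C by (auto intro!: bounded_linear_image bounded_linear_inner_left)
    have width: "Sup ((\<lambda>x. x \<bullet> b) ` C i) - Inf ((\<lambda>x. x \<bullet> b) ` C i) \<le> diameter (C i)"
      if "C i \<noteq> {}" "b \<in> Basis" for i b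
    proof -
      have "x \<bullet> b - y \<bullet> b \<le> diameter (C i)" if "x \<in> C i" "y \<in> C i" for x y
      proof -
        have "x \<bullet> b - y \<bullet> b \<le> norm (x - y)"
          using Basis_le_norm[OF \<open>b \<in> Basis\<close>, of "x - y"] by (simp add: inner_diff_left)
        also have "\<dots> \<le> diameter (C i)"
          using C that diameter_bounded_bound[of "C i" x y] by (simp add: dist_norm)
        finally show ?thesis .
      qed
      then have "Sup ((\<lambda>x. x \<bullet> b) ` C i) \<le> y \<bullet> b + diameter (C i)" if "y \<in> C i" for y
        using that by (intro cSup_least) (auto simp: algebra_simps)
      then have "Sup ((\<lambda>x. x \<bullet> b) ` C i) - diameter (C i) \<le> Inf ((\<lambda>x. x \<bullet> b) ` C i)"
        using \<open>C i \<noteq> {}\<close> by (intro cInf_greatest) (auto simp: algebra_simps)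
      then show ?thesis by simp
    qed
    have "?T \<subseteq> (\<Union>i. ?B i)"
    proof
      fix x assume "x \<in> ?T"
      then obtain a s where x: "x = a + s *\<^sub>R e" and "a \<in> A" "0 \<le> s" "s \<le> t" by auto
      then obtain i where i: "a \<in> C i" using cov by blast
      have "Inf ((\<lambda>x. x \<bullet> b) ` C i) \<le> a \<bullet> b" "a \<bullet> b \<le> Sup ((\<lambda>x. x \<bullet> b) ` C i)" for b
        using bdd[of b i] i by (auto intro!: cInf_lower cSup_upper bounded_imp_bdd_below bounded_imp_bdd_above)
      then have "a + s *\<^sub>R e \<in> ?B i"
        using i e \<open>0 \<le> s\<close> \<open>s \<le> t\<close>
        by (auto simp: mem_box inner_add_left inner_Basis intro!: add_increasing2 add_mono)
      then show "x \<in> (\<Union>i. ?B i)" using x by blast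
    qed
    then have "emeasure lborel ?T \<le> emeasure lborel (\<Union>i. ?B i)"
      by (intro emeasure_mono) auto
    also have "\<dots> \<le> (\<Sum>i. emeasure lborel (?B i))"
      by (intro emeasure_subadditive_countably) auto
    also have "\<dots> \<le> (\<Sum>i. ennreal (t + \<delta>) * (if C i = {} then 0 else ennreal (diameter (C i) ^ ?d)))"
    proof (intro suminf_le)
      fix i
      show "emeasure lborel (?B i) \<le> ennreal (t + \<delta>) * (if C i = {} then 0 else ennreal (diameter (C i) ^ ?d))"
      proof (cases "C i = {}")
        case False
        let ?w = "\<lambda>b. Sup ((\<lambda>x. x \<bullet> b) ` C i) - Inf ((\<lambda>x. x \<bullet> b) ` C i)"
        have w0: "0 \<le> ?w b" for b
          using bdd[of b i] False
          by (auto intro!: cInf_le_cSup bounded_imp_bdd_below bounded_imp_bdd_above)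
        have "emeasure lborel (?B i) = ennreal (\<Prod>b\<in>Basis. ?w b + (if b = e then t else 0))"
        proof -
          have "?l i \<bullet> b \<le> ?u i \<bullet> b" if "b \<in> Basis" for b
          proof -
            have "?l i \<bullet> b = Inf ((\<lambda>x. x \<bullet> b) ` C i)"
              "?u i \<bullet> b = Sup ((\<lambda>x. x \<bullet> b) ` C i) + (if b = e then t else 0)"
              using that by simp_all
            then show ?thesis using w0[of b] t by auto
          qed
          then have "emeasure lborel (cbox (?l i) (?u i)) = ennreal (\<Prod>b\<in>Basis. (?u i - ?l i) \<bullet> b)"
            by (rule emeasure_lborel_cbox)
          also have "(\<Prod>b\<in>Basis. (?u i - ?l i) \<bullet> b) = (\<Prod>b\<in>Basis. ?w b + (if b = e then t else 0))"
            by (intro prod.cong refl) (simp add: inner_diff_left)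
          finally show ?thesis using False by simp
        qed
        also have "(\<Prod>b\<in>Basis. ?w b + (if b = e then t else 0)) = (?w e + t) * (\<Prod>b\<in>Basis - {e}. ?w b)"
          using e by (subst prod.remove[of _ e]) (auto intro!: prod.cong)
        also have "ennreal \<dots> \<le> ennreal ((t + \<delta>) * (\<Prod>b\<in>Basis - {e}. diameter (C i)))"
        proof (intro ennreal_leI mult_mono)
          show "?w e + t \<le> t + \<delta>" using width[OF False e] C by (smt (verit))
          show "(\<Prod>b\<in>Basis - {e}. ?w b) \<le> (\<Prod>b\<in>Basis - {e}. diameter (C i))"
            using width[OF False] w0 by (intro prod_mono) auto
        qed (use t \<delta> w0 in \<open>auto intro!: prod_nonneg\<close>)
        also have "(t + \<delta>) * (\<Prod>b\<in>Basis - {e}. diameter (C i)) = (t + \<delta>) * diameter (C i) ^ ?d"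
          using e by (simp add: card_Diff_singleton)
        finally have "emeasure lborel (?B i) \<le> ennreal ((t + \<delta>) * diameter (C i) ^ ?d)"
          .
        also have "\<dots> = ennreal (t + \<delta>) * ennreal (diameter (C i) ^ ?d)"
          using t \<delta> C diameter_ge_0[of "C i"] by (intro ennreal_mult) auto
        finally show ?thesis using False by simp
      qed simp
    qed auto
    also have "\<dots> = ennreal (t + \<delta>) * (\<Sum>i. if C i = {} then 0 else ennreal (diameter (C i) ^ ?d))"
      by (rule ennreal_suminf_cmult)
    finally have "emeasure lborel ?T * ennreal (1 / (t + \<delta>)) \<le>
       (ennreal (t + \<delta>) * (\<Sum>i. if C i = {} then 0 else ennreal (diameter (C i) ^ ?d))) * ennreal (1 / (t + \<delta>))"
      by (rule mult_right_mono) simp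
    also have "\<dots> = (ennreal (t + \<delta>) * ennreal (1 / (t + \<delta>))) * (\<Sum>i. if C i = {} then 0 else ennreal (diameter (C i) ^ ?d))"
      by (simp only: ac_simps)
    also have "ennreal (t + \<delta>) * ennreal (1 / (t + \<delta>)) = 1"
      using t \<delta> by (subst ennreal_mult[symmetric]) auto
    finally show "emeasure lborel ?T * ennreal (1 / (t + \<delta>)) \<le> (\<Sum>i. if C i = {} then 0 else ennreal (diameter (C i) ^ ?d))"
      by simp
  qed
  show ?thesis
  proof (cases "hausdorff ?d A = top")
    case True
    have "ennreal t * top = top" using t by (simp add: ennreal_mult_eq_top_iff)
    then show ?thesis by (simp only: True top_greatest)
  next
    case False
    define c where "c = enn2real (hausdorff ?d A)"
    have c: "hausdorff ?d A = ennreal c" "0 \<le> c"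
      unfolding c_def using False by (simp_all only: ennreal_enn2real less_top enn2real_nonneg)
    have "emeasure lborel ?T \<le> ennreal ((t + 1 / Suc k) * c)" for k
    proof -
      let ?\<delta> = "1 / real (Suc k)"
      have "0 < t + ?\<delta>" using t by (intro add_pos_pos) auto
      then have "ennreal (1 / (t + ?\<delta>)) * ennreal (t + ?\<delta>) = 1"
        by (subst ennreal_mult[symmetric]) auto
      then have "emeasure lborel ?T = emeasure lborel ?T * ennreal (1 / (t + ?\<delta>)) * ennreal (t + ?\<delta>)"
        by (simp only: mult.assoc mult_1_right)
      also have "\<dots> \<le> hausdorff ?d A * ennreal (t + ?\<delta>)"
      proof (intro mult_right_mono)
        have "0 < ?\<delta>" by simp
        then show "emeasure lborel ?T * ennreal (1 / (t + ?\<delta>)) \<le> hausdorff ?d A"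
          by (intro order_trans[OF cover[of ?\<delta>]] SUP_upper) simp_all
      qed simp
      also have "\<dots> = ennreal ((t + ?\<delta>) * c)"
        using \<open>0 < t + ?\<delta>\<close> c by (simp only: ennreal_mult less_imp_le mult.commute)
      finally show ?thesis .
    qed
    moreover have "(\<lambda>k. ennreal ((t + 1 / Suc k) * c)) \<longlonglongrightarrow> ennreal ((t + 0) * c)"
      by (intro tendsto_intros LIMSEQ_Suc lim_inverse_n')
    ultimately have "emeasure lborel ?T \<le> ennreal ((t + 0) * c)"
      by (intro LIMSEQ_le_const) auto
    then show ?thesis using c t by (simp add: ennreal_mult)
  qed
qed

lemma has_derivative_along:
  fixes f g :: "'a::euclidean_space \<Rightarrow> real"
  assumes "\<And>x. ((\<lambda>s. f (x + s *\<^sub>R e)) has_real_derivative g x) (at 0)"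
  shows "((\<lambda>s. f (x + s *\<^sub>R e)) has_real_derivative g (x + s *\<^sub>R e)) (at s)"
  using assms[of "x + s *\<^sub>R e"] DERIV_shift[of "\<lambda>s. f (x + s *\<^sub>R e)" _ 0 s]
  by (simp add: algebra_simps scaleR_add_left)

text \<open>
  Zeros with non-vanishing derivative in direction \<open>e\<close> are isolated on each line in that direction,
  uniformly so on the compact pieces \<open>E n\<close>. Infinitely many translates of such a piece are therefore
  disjoint, and they stay in a bounded set.
\<close>

lemma null_transversal_zeros:
  fixes f g :: "'a::euclidean_space \<Rightarrow> real"
  assumes e: "norm e = 1"
    and d: "\<And>x. ((\<lambda>s. f (x + s *\<^sub>R e)) has_real_derivative g x) (at 0)"
    and f: "continuous_on UNIV f" and g: "continuous_on UNIV g"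
  shows "{x. f x = 0 \<and> g x \<noteq> 0} \<in> null_sets lborel"
proof -
  note d' = has_derivative_along[OF d]
  define E where "E = (\<lambda>n::nat. {x \<in> cball 0 (real n). f x = 0 \<and> 1 / Suc n \<le> \<bar>g x\<bar>})"
  have clos: "closed (E n)" for n
  proof -
    have "closed {x. f x = 0}" "closed {x. 1 / Suc n \<le> \<bar>g x\<bar>}"
      using f g by (auto intro!: closed_Collect_eq closed_Collect_le continuous_intros)
    then have "closed (cball 0 (real n) \<inter> ({x. f x = 0} \<inter> {x. 1 / Suc n \<le> \<bar>g x\<bar>}))" by auto
    moreover have "cball 0 (real n) \<inter> ({x. f x = 0} \<inter> {x. 1 / Suc n \<le> \<bar>g x\<bar>}) = E n"
      unfolding E_def by auto
    ultimately show ?thesis by simp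
  qed
  have null: "E n \<in> null_sets lborel" for n
  proof -
    have "uniformly_continuous_on (cball 0 (real n + 1)) g"
      using g by (intro compact_uniformly_continuous) (auto intro: continuous_on_subset)
    then obtain \<delta> where \<delta>: "0 < \<delta>" and uc: "\<And>x y. x \<in> cball 0 (real n + 1) \<Longrightarrow> y \<in> cball 0 (real n + 1) \<Longrightarrow>
       dist y x < \<delta> \<Longrightarrow> dist (g y) (g x) < 1 / Suc n"
      unfolding uniformly_continuous_on_def by (metis of_nat_0_less_iff zero_less_Suc zero_less_divide_1_iff)
    define r where "r = min \<delta> 1"
    have r: "0 < r" "r \<le> 1" "r \<le> \<delta>" using \<delta> by (auto simp: r_def)
    \<comment> \<open>by the mean value theorem, as \<open>g\<close> keeps away from \<open>0\<close> on the segment from \<open>x\<close> to \<open>x + s e\<close>\<close>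
    have iso: "f (x + s *\<^sub>R e) \<noteq> 0" if x: "x \<in> E n" and s: "0 < s" "s < r" for x s
    proof
      assume "f (x + s *\<^sub>R e) = 0"
      moreover obtain z where z: "0 < z" "z < s"
          "f (x + s *\<^sub>R e) - f (x + 0 *\<^sub>R e) = (s - 0) * g (x + z *\<^sub>R e)"
        using MVT2[of 0 s "\<lambda>s. f (x + s *\<^sub>R e)" "\<lambda>s. g (x + s *\<^sub>R e)"] d' s by blast
      ultimately have "g (x + z *\<^sub>R e) = 0" using x s by (simp add: E_def)
      moreover have "norm (x + z *\<^sub>R e) \<le> norm x + norm (z *\<^sub>R e)" by (rule norm_triangle_ineq)
      then have "x + z *\<^sub>R e \<in> cball 0 (real n + 1)" using x z s r e by (simp add: E_def)
      moreover have "x \<in> cball 0 (real n + 1)" using x by (auto simp: E_def)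
      ultimately show False
        using uc[of "x + z *\<^sub>R e" x] x z s r e by (auto simp: E_def dist_norm)
    qed
    define s where "s = (\<lambda>k::nat. r / (k + 2))"
    have s: "0 < s k" "s k < r" for k using r by (auto simp: s_def field_simps add_pos_nonneg)
    have "inj s" using r by (auto simp: s_def inj_def field_simps)
    let ?F = "\<lambda>k. (\<lambda>x. s k *\<^sub>R e + x) ` E n"
    have "disjoint_family ?F"
    proof -
      have "False" if xy: "x \<in> E n" "y \<in> E n" "s j *\<^sub>R e + x = s k *\<^sub>R e + y" "s j < s k" for x y j k
      proof -
        have "x = y + (s k - s j) *\<^sub>R e" using xy(3) by (simp add: algebra_simps)
        then show False using iso[of y "s k - s j"] xy s[of j] s[of k] by (auto simp: E_def)
      qed
      moreover have "s j < s k \<or> s k < s j" if "j \<noteq> k" for j k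
        using \<open>inj s\<close> that by (metis injD linorder_less_linear)
      ultimately have no: "s j *\<^sub>R e + x \<noteq> s k *\<^sub>R e + y" if "j \<noteq> k" "x \<in> E n" "y \<in> E n" for j k x y
        using that by metis
      show ?thesis unfolding disjoint_family_on_def
      proof (intro ballI impI)
        fix j k :: nat assume "j \<noteq> k"
        then show "?F j \<inter> ?F k = {}" using no[of j k] by blast
      qed
    qed
    moreover have sets: "range ?F \<subseteq> sets lborel"
      using closed_translation[OF clos[of n]] by auto
    ultimately have "(\<Sum>k. emeasure lborel (?F k)) = emeasure lborel (\<Union>k. ?F k)"
      by (intro suminf_emeasure)
    also have "\<dots> \<le> emeasure lborel (cball (0::'a) (real n + 1))"
    proof (intro emeasure_mono)
      show "(\<Union>k. ?F k) \<subseteq> cball 0 (real n + 1)"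
      proof clarsimp
        fix k x assume "x \<in> E n"
        then show "norm (s k *\<^sub>R e + x) \<le> real n + 1"
          using norm_triangle_ineq[of "s k *\<^sub>R e" x] s[of k] r e by (auto simp: E_def)
      qed
    qed simp
    also have "\<dots> < top" using emeasure_bounded_finite[of "cball (0::'a) (real n + 1)"] by (simp add: less_top)
    finally have fin: "(\<Sum>k. emeasure lborel (?F k)) < top" .
    have "emeasure lborel (?F k) = emeasure lborel (E n)" for k
    proof -
      have "emeasure lborel (E n) = emeasure (distr lborel borel ((+) (- (s k *\<^sub>R e)))) (E n)"
        by (simp add: lborel_distr_plus)
      also have "\<dots> = emeasure lborel ((+) (- (s k *\<^sub>R e)) -` E n)"
        using clos[of n] by (subst emeasure_distr) auto
      also have "(+) (- (s k *\<^sub>R e)) -` E n = ?F k" 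
        by (auto simp: image_iff) (metis add.commute add_diff_cancel_left' diff_add_cancel uminus_add_conv_diff)
      finally show ?thesis by simp
    qed
    then have "(\<Sum>k::nat. emeasure lborel (E n)) < top" using fin by simp
    then have "emeasure lborel (E n) = 0"
      by (auto simp: suminf_eq_SUP SUP_mult_right_ennreal[symmetric] ennreal_SUP_of_nat_eq_top ennreal_top_mult split: if_splits)
    then show ?thesis using clos[of n] by auto
  qed
  have "{x. f x = 0 \<and> g x \<noteq> 0} = (\<Union>n. E n)"
  proof (intro equalityI subsetI)
    fix x assume x: "x \<in> {x. f x = 0 \<and> g x \<noteq> 0}"
    then obtain m where m: "1 / Suc m < \<bar>g x\<bar>" using nat_approx_posE[of "\<bar>g x\<bar>"] by auto
    obtain l :: nat where l: "norm x \<le> l" using real_arch_simple by blast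
    have "1 / Suc (max m l) \<le> 1 / Suc m" by (simp add: frac_le)
    then have "x \<in> E (max m l)" using x m l by (auto simp: E_def le_max_iff_disj)
    then show "x \<in> (\<Union>n. E n)" by blast
  qed (auto simp: E_def field_simps)
  then show ?thesis using null by auto
qed

lemma space_hausdorff_measure [simp]: "space (hausdorff_measure d) = UNIV"
  and sets_hausdorff_measure [simp, measurable_cong]:
    "sets (hausdorff_measure d :: 'a::metric_space measure) = sets borel"
  unfolding hausdorff_measure_def by (simp_all add: sets.sigma_sets_eq[of borel, simplified])

text \<open>
  The integral version of \<open>tube_measure\<close>, by decomposing the boundary into the superlevel sets \<open>A k\<close>
  of \<open>\<bar>f\<bar>\<close> with spacing \<open>\<epsilon>\<close>. Truncating \<open>\<bar>f\<bar>\<close> below \<open>2 \<epsilon>\<close> absorbs the oscillation of \<open>f\<close> along the tube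
  and the rounding of \<open>\<bar>f\<bar>\<close> to multiples of \<open>\<epsilon>\<close>; so the boundary may have infinite measure.
\<close>

lemma tube_integral:
  fixes f :: "'a::euclidean_space \<Rightarrow> real"
  assumes Om: "bounded \<Omega>" and e: "e \<in> Basis" and t: "0 < t" and \<epsilon>: "0 < \<epsilon>"
    and f: "continuous_on UNIV f"
    and osc: "\<And>a s. a \<in> frontier \<Omega> \<Longrightarrow> 0 \<le> s \<Longrightarrow> s \<le> t \<Longrightarrow> \<bar>f (a + s *\<^sub>R e)\<bar> \<le> \<bar>f a\<bar> + \<epsilon>"
  shows "(\<integral>\<^sup>+x\<in>(\<lambda>(a, s). a + s *\<^sub>R e) ` (frontier \<Omega> \<times> {0..t}). ennreal (\<bar>f x\<bar> - 2 * \<epsilon>) \<partial>lborel)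
           \<le> ennreal t * (\<integral>\<^sup>+x. ennreal \<bar>f x\<bar> \<partial>surface_measure \<Omega>)"
proof -
  let ?K = "frontier \<Omega>"
  let ?tube = "\<lambda>A. (\<lambda>(a, s). a + s *\<^sub>R e) ` (A \<times> {0..t})"
  let ?H = "hausdorff_measure (DIM('a) - 1) :: 'a measure"
  have K: "compact ?K" using Om by (rule compact_frontier_bounded)

  obtain M where M: "\<And>a. a \<in> ?K \<Longrightarrow> \<bar>f a\<bar> \<le> M"
    using compact_imp_bounded[OF compact_continuous_image[OF continuous_on_subset[OF f] K]]
    unfolding bounded_iff by auto
  define N where "N = nat \<lceil>M / \<epsilon>\<rceil>"
  have N: "\<bar>f a\<bar> \<le> real N * \<epsilon>" if "a \<in> ?K" for a
  proof -
    have "M / \<epsilon> \<le> real N" unfolding N_def by (meson le_of_int_ceiling of_nat_ceiling order_trans)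
    then show ?thesis using M[OF that] \<epsilon> by (simp add: field_simps)
  qed
  define A where "A = (\<lambda>k::nat. {a \<in> ?K. real k * \<epsilon> \<le> \<bar>f a\<bar>})"
  have A: "compact (A k)" for k
  proof -
    have "closed {a. real k * \<epsilon> \<le> \<bar>f a\<bar>}" by (intro closed_Collect_le continuous_intros f)
    then have "compact (?K \<inter> {a. real k * \<epsilon> \<le> \<bar>f a\<bar>})" using K by (rule compact_Int_closed[rotated])
    also have "?K \<inter> {a. real k * \<epsilon> \<le> \<bar>f a\<bar>} = A k" by (auto simp: A_def)
    finally show ?thesis .
  qed
  have tube_compact: "compact (?tube B)" if "compact B" for B
    unfolding case_prod_beta
    by (intro compact_continuous_image compact_Times that compact_Icc continuous_intros)
  \<comment> \<open>the superlevel sets reproduce \<open>\<bar>f\<bar>\<close> up to rounding down to a multiple of \<open>\<epsilon>\<close>\<close>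
  have count: "(\<Sum>k\<in>{1..N}. \<epsilon> * indicator (A k) a) = \<epsilon> * real (nat \<lfloor>\<bar>f a\<bar> / \<epsilon>\<rfloor>)" if a: "a \<in> ?K" for a
  proof -
    have "(\<Sum>k\<in>{1..N}. \<epsilon> * indicator (A k) a) = \<epsilon> * real (card ({1..N} \<inter> {k. real k * \<epsilon> \<le> \<bar>f a\<bar>}))"
      using a by (simp add: A_def indicator_def sum.If_cases sum_distrib_left[symmetric])
    also have "{1..N} \<inter> {k. real k * \<epsilon> \<le> \<bar>f a\<bar>} = {1..nat \<lfloor>\<bar>f a\<bar> / \<epsilon>\<rfloor>}"
    proof -
      have "real k * \<epsilon> \<le> \<bar>f a\<bar> \<longleftrightarrow> k \<le> nat \<lfloor>\<bar>f a\<bar> / \<epsilon>\<rfloor>" for k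
        using \<epsilon> by (simp add: le_nat_floor le_nat_iff le_floor_iff field_simps)
      moreover have "k \<le> N" if "real k * \<epsilon> \<le> \<bar>f a\<bar>" for k
        using N[OF a] that \<epsilon> by (meson mult_le_cancel_right_pos of_nat_le_iff order_trans)
      ultimately show ?thesis by auto
    qed
    finally show ?thesis by (simp only: card_atLeastAtMost Suc_eq_plus1 add_diff_cancel_right')
  qed
  have "(\<integral>\<^sup>+x\<in>?tube ?K. ennreal (\<bar>f x\<bar> - 2 * \<epsilon>) \<partial>lborel)
      \<le> (\<integral>\<^sup>+x. (\<Sum>k\<in>{1..N}. ennreal \<epsilon> * indicator (?tube (A k)) x) \<partial>lborel)"
  proof (intro nn_integral_mono)
    fix x
    show "ennreal (\<bar>f x\<bar> - 2 * \<epsilon>) * indicator (?tube ?K) x \<le> (\<Sum>k\<in>{1..N}. ennreal \<epsilon> * indicator (?tube (A k)) x)"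
    proof (cases "x \<in> ?tube ?K")
      case True
      then obtain a s where a: "a \<in> ?K" "0 \<le> s" "s \<le> t" and x: "x = a + s *\<^sub>R e" by auto
      have "\<bar>f x\<bar> - 2 * \<epsilon> \<le> \<bar>f a\<bar> - \<epsilon>" using osc[of a s] a x by simp
      also have "\<bar>f a\<bar> / \<epsilon> - 1 \<le> real (nat \<lfloor>\<bar>f a\<bar> / \<epsilon>\<rfloor>)" by linarith
      then have "\<bar>f a\<bar> - \<epsilon> \<le> \<epsilon> * real (nat \<lfloor>\<bar>f a\<bar> / \<epsilon>\<rfloor>)" using \<epsilon> by (simp add: field_simps)
      also have "\<epsilon> * real (nat \<lfloor>\<bar>f a\<bar> / \<epsilon>\<rfloor>) = (\<Sum>k\<in>{1..N}. \<epsilon> * indicator (A k) a)"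
        by (rule count[OF a(1), symmetric])
      also have "\<dots> \<le> (\<Sum>k\<in>{1..N}. \<epsilon> * indicator (?tube (A k)) x)"
        using \<epsilon> a x by (intro sum_mono mult_left_mono) (auto simp: indicator_def)
      finally have "ennreal (\<bar>f x\<bar> - 2 * \<epsilon>) \<le> ennreal (\<Sum>k\<in>{1..N}. \<epsilon> * indicator (?tube (A k)) x)"
        by (rule ennreal_leI)
      also have "\<dots> = (\<Sum>k\<in>{1..N}. ennreal (\<epsilon> * indicator (?tube (A k)) x))"
        using \<epsilon> by (subst sum_ennreal) auto
      also have "\<dots> = (\<Sum>k\<in>{1..N}. ennreal \<epsilon> * indicator (?tube (A k)) x)"
        using \<epsilon> by (intro sum.cong) (auto simp: ennreal_mult ennreal_indicator)
      finally show ?thesis using True by simp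
    qed simp
  qed
  also have "\<dots> = (\<Sum>k\<in>{1..N}. ennreal \<epsilon> * emeasure lborel (?tube (A k)))"
    using tube_compact[OF A]
    by (subst nn_integral_sum) (auto intro!: sum.cong nn_integral_cmult_indicator borel_measurable_times_ennreal borel_measurable_indicator borel_compact)
  also have "\<dots> \<le> (\<Sum>k\<in>{1..N}. ennreal \<epsilon> * (ennreal t * emeasure ?H (A k)))"
    using A tube_measure[OF A e t]
    by (intro sum_mono mult_left_mono) (auto simp: emeasure_hausdorff_measure borel_compact)
  also have "\<dots> = ennreal t * (\<Sum>k\<in>{1..N}. ennreal \<epsilon> * emeasure ?H (A k))"
    by (simp add: sum_distrib_left mult.left_commute)
  also have "(\<Sum>k\<in>{1..N}. ennreal \<epsilon> * emeasure ?H (A k)) = (\<integral>\<^sup>+x. (\<Sum>k\<in>{1..N}. ennreal \<epsilon> * indicator (A k) x) \<partial>?H)"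
    using A by (subst nn_integral_sum) (auto intro!: sum.cong nn_integral_cmult_indicator[symmetric] borel_measurable_times_ennreal borel_measurable_indicator borel_compact)
  also have "\<dots> \<le> (\<integral>\<^sup>+x. ennreal \<bar>f x\<bar> * indicator ?K x \<partial>?H)"
  proof (intro nn_integral_mono)
    fix x
    show "(\<Sum>k\<in>{1..N}. ennreal \<epsilon> * indicator (A k) x) \<le> ennreal \<bar>f x\<bar> * indicator ?K x"
    proof (cases "x \<in> ?K")
      case True
      have "(\<Sum>k\<in>{1..N}. ennreal \<epsilon> * indicator (A k) x) = (\<Sum>k\<in>{1..N}. ennreal (\<epsilon> * indicator (A k) x))"
        using \<epsilon> by (intro sum.cong) (auto simp: ennreal_mult ennreal_indicator)
      also have "\<dots> = ennreal (\<Sum>k\<in>{1..N}. \<epsilon> * indicator (A k) x)"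
        using \<epsilon> by (subst sum_ennreal) auto
      also have "\<dots> \<le> ennreal \<bar>f x\<bar>"
      proof (rule ennreal_leI)
        have "real (nat \<lfloor>\<bar>f x\<bar> / \<epsilon>\<rfloor>) \<le> \<bar>f x\<bar> / \<epsilon>" using \<epsilon> by simp
        then have "\<epsilon> * real (nat \<lfloor>\<bar>f x\<bar> / \<epsilon>\<rfloor>) \<le> \<bar>f x\<bar>"
          using \<epsilon> by (metis mult.commute pos_le_divide_eq)
        then show "(\<Sum>k\<in>{1..N}. \<epsilon> * indicator (A k) x) \<le> \<bar>f x\<bar>"
          by (simp only: count[OF True])
      qed
      finally show ?thesis using True by simp
    qed (simp add: A_def)
  qed
  also have "\<dots> = (\<integral>\<^sup>+x. ennreal \<bar>f x\<bar> \<partial>surface_measure \<Omega>)"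
    unfolding surface_measure_def by (subst nn_integral_restrict_space) (auto simp: borel_closed)
  finally show ?thesis by (simp add: mult_left_mono)
qed

lemma segment_meets_frontier:
  fixes x :: "'a::euclidean_space"
  assumes "x \<in> \<Omega>" "x + t *\<^sub>R e \<notin> \<Omega>" "0 \<le> t"
  obtains s where "0 \<le> s" "s \<le> t" "x + s *\<^sub>R e \<in> frontier \<Omega>"
proof -
  have "connected ((\<lambda>s. x + s *\<^sub>R e) ` {0..t})"
    by (intro connected_continuous_image continuous_intros) auto
  moreover have "(\<lambda>s. x + s *\<^sub>R e) ` {0..t} \<inter> \<Omega> \<noteq> {}" using assms by (auto intro!: image_eqI[of _ _ 0])
  moreover have "(\<lambda>s. x + s *\<^sub>R e) ` {0..t} - \<Omega> \<noteq> {}" using assms by (auto intro!: image_eqI[of _ _ t])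
  ultimately have "(\<lambda>s. x + s *\<^sub>R e) ` {0..t} \<inter> frontier \<Omega> \<noteq> {}"
    by (rule connected_Int_frontier)
  then show ?thesis using that by auto
qed

text \<open>
  Let \<open>h\<close> be \<open>f\<close> soft-thresholded at the level \<open>2 L t\<close>, where \<open>L\<close> bounds the derivative. The
  difference quotient of \<open>h\<close> with step \<open>t\<close>, integrated over \<open>\<Omega>\<close>, is the difference of the integrals of
  \<open>h\<close> over a translate of \<open>\<Omega>\<close> and over \<open>\<Omega>\<close>, up to the factor \<open>t\<close>. The symmetric difference of these two sets
  lies in the tube swept out by the boundary, to which \<open>tube_integral\<close> applies. As \<open>t\<close> tends to \<open>0\<close>,
  the quotients converge to the derivative outside the null set of transversal zeros of \<open>f\<close>.
\<close>

theorem gauss_green_bound: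
  fixes f g :: "'a::euclidean_space \<Rightarrow> real"
  assumes op: "open \<Omega>" and bdd: "bounded \<Omega>" and e: "e \<in> Basis"
    and d: "\<And>x. ((\<lambda>s. f (x + s *\<^sub>R e)) has_real_derivative g x) (at 0)"
    and f: "continuous_on UNIV f" and g: "continuous_on UNIV g"
  shows "ennreal \<bar>\<integral>x. indicator \<Omega> x * g x \<partial>lborel\<bar> \<le> (\<integral>\<^sup>+x. ennreal \<bar>f x\<bar> \<partial>surface_measure \<Omega>)"
    (is "_ \<le> ?I")
proof -
  have [measurable]: "f \<in> borel_measurable borel" "g \<in> borel_measurable borel" "\<Omega> \<in> sets borel"
    using f g op by (auto intro: borel_measurable_continuous_onI)
  note d' = has_derivative_along[OF d]
  obtain R where R: "0 < R" "\<Omega> \<subseteq> cball 0 R" using bounded_subset_ballD[OF bdd] ball_subset_cball by blast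
  have ne: "norm e = 1" using e by simp
  have front: "frontier \<Omega> \<subseteq> cball 0 R"
    using closure_minimal[OF R(2) closed_cball] by (auto simp: frontier_def)
  obtain L0 where L0: "\<And>x. x \<in> cball 0 (R + 1) \<Longrightarrow> \<bar>g x\<bar> \<le> L0"
    using compact_imp_bounded[OF compact_continuous_image[OF continuous_on_subset[OF g subset_UNIV] compact_cball]]
    unfolding bounded_iff by (metis imageI real_norm_def)
  define L where "L = max L0 1"
  have L: "0 < L" "\<And>x. x \<in> cball 0 (R + 1) \<Longrightarrow> \<bar>g x\<bar> \<le> L" using L0 by (auto simp: L_def le_max_iff_disj)
  have near: "x + s *\<^sub>R e \<in> cball 0 (R + 1)" if "x \<in> cball 0 R" "0 \<le> s" "s \<le> 1" for x s
    using that norm_triangle_ineq[of x "s *\<^sub>R e"] ne by auto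
  have lip: "\<bar>f (x + s *\<^sub>R e) - f x\<bar> \<le> L * s" if x: "x \<in> cball 0 R" and s: "0 \<le> s" "s \<le> 1" for x s
  proof (cases "s = 0")
    case False
    then obtain z where z: "0 < z" "z < s" "f (x + s *\<^sub>R e) - f (x + 0 *\<^sub>R e) = (s - 0) * g (x + z *\<^sub>R e)"
      using MVT2[of 0 s "\<lambda>s. f (x + s *\<^sub>R e)" "\<lambda>s. g (x + s *\<^sub>R e)"] d' s by fastforce
    then show ?thesis
      using L(2)[OF near[OF x, of z]] s by (simp add: abs_mult mult.commute[of L] mult_left_mono)
  qed simp
  define soft where "soft = (\<lambda>\<epsilon> s::real. if s > 2 * \<epsilon> then s - 2 * \<epsilon> else if s < - 2 * \<epsilon> then s + 2 * \<epsilon> else 0)"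
  have soft_abs: "\<bar>soft \<epsilon> s\<bar> = max 0 (\<bar>s\<bar> - 2 * \<epsilon>)" if "0 \<le> \<epsilon>" for \<epsilon> s
    using that by (auto simp: soft_def)
  have soft_lip: "\<bar>soft \<epsilon> s - soft \<epsilon> r\<bar> \<le> \<bar>s - r\<bar>" if "0 \<le> \<epsilon>" for \<epsilon> s r
    using that by (auto simp: soft_def)
  have [measurable]: "soft \<epsilon> \<in> borel_measurable borel" for \<epsilon> unfolding soft_def by measurable
  define t where "t = (\<lambda>k::nat. 1 / real (Suc k))"
  have t: "0 < t k" "t k \<le> 1" for k by (auto simp: t_def)
  define h where "h = (\<lambda>k x. soft (L * t k) (f x))"
  have [measurable]: "h k \<in> borel_measurable borel" for k unfolding h_def by measurable
  define q where "q = (\<lambda>k x. indicator \<Omega> x * ((h k (x + t k *\<^sub>R e) - h k x) / t k))"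
  have [measurable]: "q k \<in> borel_measurable borel" for k unfolding q_def by measurable
  let ?tube = "\<lambda>k. (\<lambda>(a, s). a + s *\<^sub>R e) ` (frontier \<Omega> \<times> {0..t k})"
  have tube_compact: "compact (?tube k)" for k
    unfolding case_prod_beta
    by (intro compact_continuous_image compact_Times compact_Icc compact_frontier_bounded bdd continuous_intros)
  have fin: "integrable lborel (\<lambda>x::'a. indicator (cball 0 (R + 1)) x * c)" for c :: real
    using emeasure_bounded_finite[of "cball (0::'a) (R + 1)"]
    by (intro integrable_mult_left integrable_real_indicator) auto
  obtain M where M: "\<And>x. x \<in> cball 0 (R + 1) \<Longrightarrow> \<bar>f x\<bar> \<le> M"
    using compact_imp_bounded[OF compact_continuous_image[OF continuous_on_subset[OF f subset_UNIV] compact_cball]]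
    unfolding bounded_iff by (metis imageI real_norm_def)
  have bound: "ennreal \<bar>\<integral>x. q k x \<partial>lborel\<bar> \<le> ?I" for k
  proof -
    define T where "T = (\<lambda>x. indicator \<Omega> (x - t k *\<^sub>R e) - indicator \<Omega> x :: real)"
    have [measurable]: "T \<in> borel_measurable borel" unfolding T_def by measurable
    have Lt: "0 \<le> L * t k" using L t[of k] by simp
    have habs: "\<bar>h k x\<bar> \<le> M" if "x \<in> cball 0 (R + 1)" for x
      using soft_abs[OF Lt, of "f x"] M[OF that] Lt unfolding h_def by linarith
    have in_ball: "norm x \<le> R + 1" if "x \<in> \<Omega>" for x using that R by auto
    have habs1: "\<bar>h k (x + t k *\<^sub>R e)\<bar> \<le> \<bar>M\<bar>" "\<bar>h k x\<bar> \<le> \<bar>M\<bar>" if "x \<in> \<Omega>" for x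
      using that R t[of k] near[of x "t k"] in_ball[of x] habs[of "x + t k *\<^sub>R e"] habs[of x] by auto
    have i1: "integrable lborel (\<lambda>x. indicator \<Omega> x * h k (x + t k *\<^sub>R e))"
      using in_ball habs1
      by (intro Bochner_Integration.integrable_bound[OF fin[of M]]) (auto simp: indicator_def intro!: AE_I2)
    have i2: "integrable lborel (\<lambda>x. indicator \<Omega> x * h k x)"
      using in_ball habs1
      by (intro Bochner_Integration.integrable_bound[OF fin[of M]]) (auto simp: indicator_def intro!: AE_I2)
    have sh: "distr lborel borel ((+) (t k *\<^sub>R e)) = (lborel :: 'a measure)" by (rule lborel_distr_plus)
    have i1': "integrable lborel (\<lambda>x. indicator \<Omega> (x - t k *\<^sub>R e) * h k x)"
      by (subst sh[symmetric], subst integrable_distr_eq) (use i1 in \<open>simp_all add: add.commute\<close>)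
    have "t k * (\<integral>x. q k x \<partial>lborel) = (\<integral>x. indicator \<Omega> x * h k (x + t k *\<^sub>R e) - indicator \<Omega> x * h k x \<partial>lborel)"
    proof -
      have "t k * q k x = indicator \<Omega> x * h k (x + t k *\<^sub>R e) - indicator \<Omega> x * h k x" for x
        using t(1)[of k] by (simp add: q_def field_simps)
      then show ?thesis by (simp only: integral_mult_right_zero[symmetric])
    qed
    also have "\<dots> = (\<integral>x. indicator \<Omega> x * h k (x + t k *\<^sub>R e) \<partial>lborel) - (\<integral>x. indicator \<Omega> x * h k x \<partial>lborel)"
      by (rule Bochner_Integration.integral_diff[OF i1 i2])
    also have "(\<integral>x. indicator \<Omega> x * h k (x + t k *\<^sub>R e) \<partial>lborel) = (\<integral>x. indicator \<Omega> (x - t k *\<^sub>R e) * h k x \<partial>lborel)"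
      by (subst (2) sh[symmetric], subst integral_distr) (simp_all add: add.commute)
    also have "\<dots> - (\<integral>x. indicator \<Omega> x * h k x \<partial>lborel) = (\<integral>x. T x * h k x \<partial>lborel)"
      by (subst Bochner_Integration.integral_diff[OF i1' i2, symmetric]) (simp add: T_def left_diff_distrib)
    finally have "ennreal \<bar>t k * (\<integral>x. q k x \<partial>lborel)\<bar> = ennreal (norm (\<integral>x. T x * h k x \<partial>lborel))" by simp
    also have "\<dots> \<le> (\<integral>\<^sup>+x. ennreal (norm (T x * h k x)) \<partial>lborel)"
      using Bochner_Integration.integrable_diff[OF i1' i2]
      by (intro integral_norm_bound_ennreal) (simp add: T_def left_diff_distrib)
    also have "\<dots> \<le> (\<integral>\<^sup>+x\<in>?tube k. ennreal (\<bar>f x\<bar> - 2 * (L * t k)) \<partial>lborel)"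
    proof (intro nn_integral_mono)
      fix x
      \<comment> \<open>the segment between \<open>x\<close> and \<open>x - t e\<close> crosses the boundary\<close>
      have in_tube: "x \<in> ?tube k" if "T x \<noteq> 0"
      proof (cases "x \<in> \<Omega>")
        case True
        then have "x + t k *\<^sub>R (- e) \<notin> \<Omega>" using that by (auto simp: T_def indicator_def split: if_splits)
        then obtain s where s: "0 \<le> s" "s \<le> t k" "x + s *\<^sub>R (- e) \<in> frontier \<Omega>"
          using segment_meets_frontier[of x \<Omega> "t k" "- e"] True t[of k] by auto
        then show ?thesis by (intro image_eqI[of _ _ "(x + s *\<^sub>R (- e), s)"]) auto
      next
        case False
        then have "x - t k *\<^sub>R e \<in> \<Omega>" using that by (auto simp: T_def indicator_def split: if_splits)
        moreover have "(x - t k *\<^sub>R e) + t k *\<^sub>R e \<notin> \<Omega>" using False by simp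
        ultimately obtain s where s: "0 \<le> s" "s \<le> t k" "(x - t k *\<^sub>R e) + s *\<^sub>R e \<in> frontier \<Omega>"
          using segment_meets_frontier[of "x - t k *\<^sub>R e" \<Omega> "t k" e] t(1)[of k] by (metis less_imp_le)
        then show ?thesis
          by (intro image_eqI[of _ _ "((x - t k *\<^sub>R e) + s *\<^sub>R e, t k - s)"]) (auto simp: algebra_simps)
      qed
      have "\<bar>T x\<bar> \<le> 1" by (auto simp: T_def indicator_def)
      then have "\<bar>T x * h k x\<bar> \<le> max 0 (\<bar>f x\<bar> - 2 * (L * t k))"
        using soft_abs[OF Lt, of "f x"] by (simp add: h_def abs_mult mult_left_le_one_le)
      then have "ennreal (norm (T x * h k x)) \<le> ennreal (max 0 (\<bar>f x\<bar> - 2 * (L * t k)))"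
        by (intro ennreal_leI) simp
      also have "\<dots> = ennreal (\<bar>f x\<bar> - 2 * (L * t k))" by (simp add: max_def ennreal_neg)
      finally show "ennreal (norm (T x * h k x)) \<le> ennreal (\<bar>f x\<bar> - 2 * (L * t k)) * indicator (?tube k) x"
        using in_tube by (cases "T x = 0") (auto simp: indicator_def)
    qed
    also have "\<dots> \<le> ennreal (t k) * ?I"
    proof (intro tube_integral bdd e f t)
      show "0 < L * t k" using L t by simp
      fix a s assume a: "a \<in> frontier \<Omega>" and s: "0 \<le> s" "s \<le> t k"
      have "\<bar>f (a + s *\<^sub>R e) - f a\<bar> \<le> L * s" using lip[of a s] front a s t[of k] by auto
      also have "\<dots> \<le> L * t k" using L s by simp
      finally show "\<bar>f (a + s *\<^sub>R e)\<bar> \<le> \<bar>f a\<bar> + L * t k" by linarith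
    qed
    finally have *: "ennreal (t k) * ennreal \<bar>\<integral>x. q k x \<partial>lborel\<bar> \<le> ennreal (t k) * ?I"
      using t(1)[of k] by (simp add: abs_mult ennreal_mult)
    have "ennreal (1 / t k) * (ennreal (t k) * ennreal \<bar>\<integral>x. q k x \<partial>lborel\<bar>) \<le> ennreal (1 / t k) * (ennreal (t k) * ?I)"
      by (rule mult_left_mono[OF *]) simp
    moreover have "ennreal (1 / t k) * ennreal (t k) = 1"
      using t(1)[of k] by (subst ennreal_mult[symmetric]) auto
    ultimately show ?thesis by (simp only: mult.assoc[symmetric] mult_1_left)
  qed
  have "(\<lambda>k. \<integral>x. q k x \<partial>lborel) \<longlonglongrightarrow> (\<integral>x. indicator \<Omega> x * g x \<partial>lborel)"
  proof (rule integral_dominated_convergence[where w = "\<lambda>x. indicator (cball 0 (R + 1)) x * L"])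
    show "AE x in lborel. (\<lambda>k. q k x) \<longlonglongrightarrow> indicator \<Omega> x * g x"
    proof (rule AE_mp[OF AE_not_in[OF null_transversal_zeros[OF ne d f g]]], rule AE_I2, rule impI)
      fix x assume x0: "x \<notin> {x. f x = 0 \<and> g x \<noteq> 0}"
      have t0: "t \<longlonglongrightarrow> 0" unfolding t_def by (rule LIMSEQ_Suc[OF lim_inverse_n'])
      have quot: "(\<lambda>k. (f (x + t k *\<^sub>R e) - f x) / t k) \<longlonglongrightarrow> g x"
      proof -
        have "(\<lambda>s. (f (x + s *\<^sub>R e) - f x) / s) \<midarrow>0\<rightarrow> g x"
          using d[of x] unfolding DERIV_def by simp
        moreover have "filterlim t (at 0) sequentially"
          using t0 t(1) by (auto simp: filterlim_at intro!: always_eventually less_imp_neq[symmetric])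
        ultimately show ?thesis by (rule filterlim_compose)
      qed
      have Lt: "(\<lambda>k. 2 * (L * t k)) \<longlonglongrightarrow> 0"
        using tendsto_mult[OF tendsto_const[of "2 * L"] t0] by (simp add: mult.assoc)
      have fx: "(\<lambda>k. f (x + t k *\<^sub>R e)) \<longlonglongrightarrow> f x"
      proof -
        have "(\<lambda>k. x + t k *\<^sub>R e) \<longlonglongrightarrow> x + 0 *\<^sub>R e" by (intro tendsto_intros t0)
        moreover have "isCont f (x + 0 *\<^sub>R e)" using f by (simp add: continuous_on_eq_continuous_at)
        ultimately show ?thesis using isCont_tendsto_compose by fastforce
      qed
      \<comment> \<open>where \<open>f\<close> does not vanish, the threshold shifts both values by the same constant\<close>
      have ev: "\<forall>\<^sub>F k in sequentially. h k (x + t k *\<^sub>R e) - h k x = f (x + t k *\<^sub>R e) - f x" if "f x \<noteq> 0"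
      proof (cases "f x > 0")
        case True
        have "\<forall>\<^sub>F k in sequentially. 2 * (L * t k) < f x" using order_tendstoD(2)[OF Lt True] .
        moreover have "\<forall>\<^sub>F k in sequentially. 0 < f (x + t k *\<^sub>R e) - 2 * (L * t k)"
          using order_tendstoD(1)[OF tendsto_diff[OF fx Lt], of 0] True by simp
        ultimately show ?thesis by eventually_elim (simp add: h_def soft_def)
      next
        case False
        then have neg: "f x < 0" using that by simp
        have "\<forall>\<^sub>F k in sequentially. 2 * (L * t k) < - f x" using order_tendstoD(2)[OF Lt, of "- f x"] neg by simp
        moreover have "\<forall>\<^sub>F k in sequentially. f (x + t k *\<^sub>R e) + 2 * (L * t k) < 0"
          using order_tendstoD(2)[OF tendsto_add[OF fx Lt], of 0] neg by simp
        moreover have "\<forall>\<^sub>F k in sequentially. 0 < L * t k" using L t by simp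
        ultimately show ?thesis by eventually_elim (auto simp: h_def soft_def)
      qed
      consider "x \<notin> \<Omega>" | "f x \<noteq> 0" | "x \<in> \<Omega>" "f x = 0" "g x = 0" using x0 by auto
      then show "(\<lambda>k. q k x) \<longlonglongrightarrow> indicator \<Omega> x * g x"
      proof cases
        case 2
        have "\<forall>\<^sub>F k in sequentially. indicator \<Omega> x * ((f (x + t k *\<^sub>R e) - f x) / t k) = q k x"
          using ev[OF 2] by eventually_elim (simp add: q_def)
        then show ?thesis by (rule Lim_transform_eventually[rotated]) (intro tendsto_intros quot)
      next
        case 3
        have "q k x = 0" for k
        proof -
          have "\<bar>f (x + t k *\<^sub>R e)\<bar> \<le> L * t k" using lip[of x "t k"] 3 R t[of k] by auto
          moreover have "0 < L * t k" using L t by simp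
          ultimately show ?thesis using 3 by (auto simp: q_def h_def soft_def)
        qed
        then show ?thesis using 3 by simp
      qed (simp add: q_def)
    qed
    fix k
    show "AE x in lborel. norm (q k x) \<le> indicator (cball 0 (R + 1)) x * L"
    proof (intro AE_I2)
      fix x
      show "norm (q k x) \<le> indicator (cball 0 (R + 1)) x * L"
      proof (cases "x \<in> \<Omega>")
        case True
        then have x: "x \<in> cball 0 R" using R by auto
        have "\<bar>h k (x + t k *\<^sub>R e) - h k x\<bar> \<le> \<bar>f (x + t k *\<^sub>R e) - f x\<bar>"
          unfolding h_def using L t[of k] by (intro soft_lip) auto
        also have "\<dots> \<le> L * t k" using lip[OF x, of "t k"] t[of k] by simp
        finally have "\<bar>(h k (x + t k *\<^sub>R e) - h k x) / t k\<bar> \<le> L" using t(1)[of k] by (simp add: abs_divide field_simps)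
        then show ?thesis using x R True by (auto simp: q_def)
      qed (use L in \<open>simp add: q_def\<close>)
    qed
  qed (use fin in \<open>simp_all\<close>)
  then have "(\<lambda>k. ennreal \<bar>\<integral>x. q k x \<partial>lborel\<bar>) \<longlonglongrightarrow> ennreal \<bar>\<integral>x. indicator \<Omega> x * g x \<partial>lborel\<bar>"
    by (intro tendsto_ennrealI tendsto_rabs)
  then show ?thesis by (rule LIMSEQ_le_const2) (use bound in blast)
qed

section \<open>Ladyzhenskaya's inequality with boundary values\<close>

lemma bounded_continuous_on_bounded:
  fixes h :: "'a::euclidean_space \<Rightarrow> real"
  assumes "bounded \<Omega>" "continuous_on UNIV h"
  obtains M where "\<And>x. x \<in> closure \<Omega> \<Longrightarrow> \<bar>h x\<bar> \<le> M"
proof -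
  have "compact (closure \<Omega>)" using assms(1) by (simp add: compact_closure)
  then have "bounded (h ` closure \<Omega>)"
    using assms(2) by (intro compact_imp_bounded compact_continuous_image) (auto intro: continuous_on_subset)
  then show ?thesis using that unfolding bounded_iff by (metis imageI real_norm_def)
qed

lemma integrable_indicator_continuous:
  fixes h :: "'a::euclidean_space \<Rightarrow> real"
  assumes "open \<Omega>" "bounded \<Omega>" "continuous_on UNIV h"
  shows "integrable lborel (\<lambda>x. indicator \<Omega> x * h x)"
proof -
  obtain M where M: "\<And>x. x \<in> closure \<Omega> \<Longrightarrow> \<bar>h x\<bar> \<le> M"
    using bounded_continuous_on_bounded[OF assms(2,3)] by blast
  have [measurable]: "h \<in> borel_measurable borel" "\<Omega> \<in> sets borel"
    using assms by (auto intro: borel_measurable_continuous_onI)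
  have "integrable lborel (\<lambda>x::'a. indicator \<Omega> x * M)"
    using emeasure_bounded_finite[OF assms(2)] assms(1)
    by (intro integrable_mult_left integrable_real_indicator) auto
  then show ?thesis
    by (rule Bochner_Integration.integrable_bound)
       (use M closure_subset[of \<Omega>] in \<open>auto simp: indicator_def intro!: AE_I2 order_trans[OF _ abs_ge_self]\<close>)
qed

lemma nn_integral_surface_measure:
  "(\<integral>\<^sup>+x. h x \<partial>surface_measure \<Omega>) = (\<integral>\<^sup>+x. h x * indicator (frontier \<Omega>) x \<partial>hausdorff_measure (DIM('a) - 1))"
  for \<Omega> :: "'a::euclidean_space set"
  unfolding surface_measure_def by (subst nn_integral_restrict_space) (auto simp: borel_closed)

text \<open>
  The density of the Cauchy distribution with scale \<open>\<delta>\<close>. It serves as a mollifier: it has a closed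
  primitive between \<open>0\<close> and \<open>1\<close>, and no smoothness question arises.
\<close>

definition cauchy :: "real \<Rightarrow> real \<Rightarrow> real" where
  "cauchy \<delta> s = \<delta> / (pi * (\<delta>\<^sup>2 + s\<^sup>2))"

text \<open>
  The distribution function belonging to \<open>cauchy\<close>.
\<close>

definition cauchy_cdf :: "real \<Rightarrow> real \<Rightarrow> real" where
  "cauchy_cdf \<delta> s = arctan (s / \<delta>) / pi + 1 / 2"

lemma cauchy_nonneg: "0 < \<delta> \<Longrightarrow> 0 \<le> cauchy \<delta> s"
  by (simp add: cauchy_def)

lemma cauchy_denominator_nonzero: "0 < \<delta> \<Longrightarrow> \<delta>\<^sup>2 + s\<^sup>2 \<noteq> (0::real)"
  by (smt (verit) zero_less_power zero_le_power2)

lemma continuous_on_cauchy [continuous_intros]: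
  assumes "0 < \<delta>" "continuous_on S h" shows "continuous_on S (\<lambda>x. cauchy \<delta> (h x))"
  unfolding cauchy_def using assms cauchy_denominator_nonzero by (intro continuous_intros) auto

lemma continuous_on_cauchy_cdf [continuous_intros]:
  assumes "0 < \<delta>" "continuous_on S h" shows "continuous_on S (\<lambda>x. cauchy_cdf \<delta> (h x))"
  unfolding cauchy_cdf_def using assms by (intro continuous_intros) auto

lemma cauchy_cdf_bounds: "0 \<le> cauchy_cdf \<delta> s" "cauchy_cdf \<delta> s \<le> 1"
proof -
  have "- (pi / 2) < arctan (s / \<delta>)" "arctan (s / \<delta>) < pi / 2"
    using arctan_bounded[of "s / \<delta>"] by auto
  then show "0 \<le> cauchy_cdf \<delta> s" "cauchy_cdf \<delta> s \<le> 1" by (auto simp: cauchy_cdf_def field_simps)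
qed

lemma DERIV_cauchy_cdf:
  assumes "0 < \<delta>" shows "(cauchy_cdf \<delta> has_real_derivative cauchy \<delta> s) (at s)"
proof -
  have "((\<lambda>s. arctan (s / \<delta>) / pi + 1 / 2) has_real_derivative (inverse (1 + (s / \<delta>)\<^sup>2) * (1 / \<delta>)) / pi) (at s)"
    using assms by (auto intro!: derivative_eq_intros)
  moreover have "(inverse (1 + (s / \<delta>)\<^sup>2) * (1 / \<delta>)) / pi = cauchy \<delta> s"
    using assms cauchy_denominator_nonzero[OF assms, of s]
    by (simp add: cauchy_def field_simps power2_eq_square)
  ultimately show ?thesis by (simp add: cauchy_cdf_def[abs_def])
qed

lemma cauchy_scale:
  assumes "0 < \<delta>" shows "cauchy 1 s = \<delta> * cauchy \<delta> (\<delta> * s)"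
proof -
  have "\<delta>\<^sup>2 + (\<delta> * s)\<^sup>2 = \<delta>\<^sup>2 * (1 + s\<^sup>2)" by (simp add: power_mult_distrib algebra_simps)
  then show ?thesis using assms by (simp add: cauchy_def power2_eq_square)
qed

lemma cauchy_measurable [measurable]: "cauchy \<delta> \<in> borel_measurable borel"
  unfolding cauchy_def by measurable

lemma nn_integral_cauchy:
  assumes "0 < \<delta>" shows "(\<integral>\<^sup>+s. ennreal (cauchy \<delta> (c - s)) \<partial>lborel) = 1"
proof -
  have half: "(\<integral>\<^sup>+s. ennreal (cauchy \<delta> s) * indicator {0..} s \<partial>lborel) = ennreal (1 / 2)"
  proof -
    have "(\<integral>\<^sup>+s. ennreal (cauchy \<delta> s) * indicator {0..} s \<partial>lborel) = ennreal (1 - cauchy_cdf \<delta> 0)"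
    proof (rule nn_integral_FTC_atLeast)
      have "filterlim (\<lambda>s. s / \<delta>) at_top at_top"
        using filterlim_tendsto_pos_mult_at_top[OF tendsto_const[of "1 / \<delta>"] _ filterlim_ident] assms by simp
      then have "((\<lambda>s. arctan (s / \<delta>)) \<longlongrightarrow> pi / 2) at_top"
        by (rule filterlim_compose[OF tendsto_arctan_at_top])
      then have "((\<lambda>s. arctan (s / \<delta>) / pi + 1 / 2) \<longlongrightarrow> (pi / 2) / pi + 1 / 2) at_top"
        by (intro tendsto_intros) auto
      then show "(cauchy_cdf \<delta> \<longlongrightarrow> 1) at_top" by (simp add: cauchy_cdf_def[abs_def])
    qed (use DERIV_cauchy_cdf[OF assms] cauchy_nonneg[OF assms] in auto)
    then show ?thesis by (simp add: cauchy_cdf_def)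
  qed
  have sym: "cauchy \<delta> (- s) = cauchy \<delta> s" for s by (simp add: cauchy_def)
  have "(\<integral>\<^sup>+s. ennreal (cauchy \<delta> (c - s)) \<partial>lborel) = (\<integral>\<^sup>+s. ennreal (cauchy \<delta> s) \<partial>lborel)"
    using nn_integral_real_affine[of "\<lambda>s. ennreal (cauchy \<delta> s)" "-1" c] by simp
  also have "\<dots> = (\<integral>\<^sup>+s. ennreal (cauchy \<delta> s) * indicator {0..} s + ennreal (cauchy \<delta> s) * indicator {..0} s \<partial>lborel)"
  proof (rule nn_integral_cong_AE)
    show "AE s in lborel. ennreal (cauchy \<delta> s) =
        ennreal (cauchy \<delta> s) * indicator {0..} s + ennreal (cauchy \<delta> s) * indicator {..0} s"
      using AE_lborel_singleton[of "0::real"] by eventually_elim (auto simp: indicator_def)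
  qed
  also have "\<dots> = (\<integral>\<^sup>+s. ennreal (cauchy \<delta> s) * indicator {0..} s \<partial>lborel) + (\<integral>\<^sup>+s. ennreal (cauchy \<delta> s) * indicator {..0} s \<partial>lborel)"
    by (intro nn_integral_add) auto
  also have "(\<integral>\<^sup>+s. ennreal (cauchy \<delta> s) * indicator {..0} s \<partial>lborel) = (\<integral>\<^sup>+s. ennreal (cauchy \<delta> s) * indicator {0..} s \<partial>lborel)"
    by (subst nn_integral_real_affine[of _ "-1" 0]) (auto simp: sym indicator_def intro!: nn_integral_cong)
  also have "(\<integral>\<^sup>+s. ennreal (cauchy \<delta> s) * indicator {0..} s \<partial>lborel) + (\<integral>\<^sup>+s. ennreal (cauchy \<delta> s) * indicator {0..} s \<partial>lborel)
      = ennreal (1 / 2 + 1 / 2)"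
    unfolding half by (rule ennreal_plus[symmetric]) auto
  finally show ?thesis by simp
qed

text \<open>
  Tonelli's theorem requires \<open>N\<close> to be sigma-finite. The surface measure need not be, but its
  densities with finite total mass are finite measures.
\<close>

lemma nn_integral_cauchy_marginal:
  fixes N :: "'a::euclidean_space measure"
  assumes "finite_measure N" "sets N = sets borel" "0 < \<delta>"
  shows "(\<integral>\<^sup>+s. (\<integral>\<^sup>+p. ennreal (cauchy \<delta> (p \<bullet> b - s)) \<partial>N) \<partial>lborel) = emeasure N UNIV"
proof -
  interpret N: finite_measure N by fact
  interpret pair_sigma_finite lborel N by unfold_locales
  note [measurable_cong] = assms(2)
  have "(\<integral>\<^sup>+s. (\<integral>\<^sup>+p. ennreal (cauchy \<delta> (p \<bullet> b - s)) \<partial>N) \<partial>lborel) = (\<integral>\<^sup>+p. (\<integral>\<^sup>+s. ennreal (cauchy \<delta> (p \<bullet> b - s)) \<partial>lborel) \<partial>N)"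
    by (rule Fubini'[symmetric]) measurable
  also have "\<dots> = emeasure N UNIV"
    using assms sets_eq_imp_space_eq[OF assms(2)] by (simp add: nn_integral_cauchy)
  finally show ?thesis .
qed

lemma lborel_integral_affine:
  fixes F :: "'a::euclidean_space \<Rightarrow> real"
  assumes "0 < \<delta>" and [measurable]: "F \<in> borel_measurable borel"
  shows "(\<integral>p. F p \<partial>lborel) = (\<integral>q. \<delta> ^ DIM('a) * F (x + \<delta> *\<^sub>R q) \<partial>lborel)"
  using assms(1) by (subst lborel_affine[of \<delta> x]) (auto simp: integral_density integral_distr)

text \<open>
  The convolution of \<open>w\<close> with the product of Cauchy densities in all coordinates.
\<close>

definition cauchy_mollifier :: "real \<Rightarrow> ('a::euclidean_space \<Rightarrow> real) \<Rightarrow> 'a \<Rightarrow> real" where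
  "cauchy_mollifier \<delta> w x = (\<integral>p. w p * (\<Prod>b\<in>Basis. cauchy \<delta> ((p - x) \<bullet> b)) \<partial>lborel)"

lemma cauchy_mollifier_tendsto:
  fixes w :: "'a::euclidean_space \<Rightarrow> real"
  assumes op: "open \<Omega>" "x \<in> \<Omega>" and cont: "continuous_on \<Omega> w" and out: "\<And>p. p \<notin> \<Omega> \<Longrightarrow> w p = 0"
    and M: "\<And>p. \<bar>w p\<bar> \<le> M" and [measurable]: "w \<in> borel_measurable borel"
  shows "(\<lambda>k. cauchy_mollifier (1 / real (Suc k)) w x) \<longlonglongrightarrow> w x"
proof -
  let ?d = "\<lambda>k. 1 / real (Suc k)"
  let ?\<eta> = "\<lambda>q::'a. \<Prod>b\<in>Basis. cauchy 1 (q \<bullet> b)"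
  have \<eta>_int: "(\<integral>\<^sup>+q. ennreal (?\<eta> q) \<partial>lborel) = 1"
  proof -
    have sym: "cauchy 1 (0 - s) = cauchy 1 s" for s by (simp add: cauchy_def)
    have "(\<integral>\<^sup>+q. ennreal (?\<eta> q) \<partial>lborel) = (\<integral>\<^sup>+q. (\<Prod>b\<in>Basis. ennreal (cauchy 1 (q \<bullet> b))) \<partial>(lborel :: 'a measure))"
      by (intro nn_integral_cong) (simp add: prod_ennreal cauchy_nonneg)
    also have "\<dots> = (\<Prod>b\<in>(Basis :: 'a set). (\<integral>\<^sup>+s. ennreal (cauchy 1 s) \<partial>lborel))"
      by (rule nn_integral_lborel_prod) auto
    also have "\<dots> = 1" using nn_integral_cauchy[of 1 0] by (simp only: sym zero_less_one prod.neutral_const simp_thms True_implies_equals)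
    finally show ?thesis .
  qed
  have \<eta>0: "0 \<le> ?\<eta> q" for q by (intro prod_nonneg cauchy_nonneg ballI) auto
  have \<eta>_meas [measurable]: "?\<eta> \<in> borel_measurable borel" by measurable
  have \<eta>_integrable: "integrable lborel ?\<eta>"
    by (rule integrableI_nonneg) (use \<eta>0 \<eta>_int in auto)
  have \<eta>_1: "(\<integral>q. ?\<eta> q \<partial>lborel) = 1"
    using \<eta>0 \<eta>_int by (subst integral_eq_nn_integral) auto
  have mol: "cauchy_mollifier (?d k) w x = (\<integral>q. w (x + ?d k *\<^sub>R q) * ?\<eta> q \<partial>lborel)" for k
  proof -
    have d: "0 < ?d k" by simp
    have *: "(?d k) ^ DIM('a) * (\<Prod>b\<in>(Basis::'a set). cauchy (?d k) (?d k * (q \<bullet> b))) = ?\<eta> q" for q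
      by (simp only: cauchy_scale[OF d] prod.distrib prod_constant)
    have "cauchy_mollifier (?d k) w x = (\<integral>q. (?d k) ^ DIM('a) * (w (x + ?d k *\<^sub>R q) *
        (\<Prod>b\<in>Basis. cauchy (?d k) ((x + ?d k *\<^sub>R q - x) \<bullet> b))) \<partial>lborel)"
      unfolding cauchy_mollifier_def by (rule lborel_integral_affine[OF d]) measurable
    also have "\<dots> = (\<integral>q. w (x + ?d k *\<^sub>R q) * ?\<eta> q \<partial>lborel)"
    proof (rule Bochner_Integration.integral_cong[OF refl])
      fix q
      show "(?d k) ^ DIM('a) * (w (x + ?d k *\<^sub>R q) * (\<Prod>b\<in>Basis. cauchy (?d k) ((x + ?d k *\<^sub>R q - x) \<bullet> b)))
          = w (x + ?d k *\<^sub>R q) * ?\<eta> q"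
        by (simp only: *[symmetric] add_diff_cancel_left' inner_scaleR_left mult.left_commute)
    qed
    finally show ?thesis .
  qed
  have "(\<lambda>k. \<integral>q. w (x + ?d k *\<^sub>R q) * ?\<eta> q \<partial>lborel) \<longlonglongrightarrow> (\<integral>q. w x * ?\<eta> q \<partial>lborel)"
  proof (rule integral_dominated_convergence[where w = "\<lambda>q. M * ?\<eta> q"])
    show "AE q in lborel. (\<lambda>k. w (x + ?d k *\<^sub>R q) * ?\<eta> q) \<longlonglongrightarrow> w x * ?\<eta> q"
    proof (intro AE_I2 tendsto_mult tendsto_const)
      fix q
      have "(\<lambda>k. x + ?d k *\<^sub>R q) \<longlonglongrightarrow> x + 0 *\<^sub>R q"
        by (intro tendsto_intros LIMSEQ_Suc[OF lim_inverse_n'])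
      moreover have "isCont w (x + 0 *\<^sub>R q)" using op cont by (simp add: continuous_on_eq_continuous_at)
      ultimately show "(\<lambda>k. w (x + ?d k *\<^sub>R q)) \<longlonglongrightarrow> w x"
        using isCont_tendsto_compose by fastforce
    qed
    show "AE q in lborel. norm (w (x + ?d k *\<^sub>R q) * ?\<eta> q) \<le> M * ?\<eta> q" for k
      using M \<eta>0 by (intro AE_I2) (simp add: abs_mult mult_right_mono)
  qed (use \<eta>_integrable in auto)
  then show ?thesis by (simp only: mol \<eta>_1 integral_mult_right_zero mult_1_right)
qed

text \<open>
  The mollification of \<open>f\<^sup>2\<close> is bounded by a quantity that does not depend on the coordinate of \<open>x\<close> in
  direction \<open>e\<close>: integrate the kernel by parts in that direction, where its primitive is at most \<open>1\<close>.
\<close>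

lemma cauchy_mollifier_bound:
  fixes f g :: "'a::euclidean_space \<Rightarrow> real"
  assumes op: "open \<Omega>" and bdd: "bounded \<Omega>" and e: "e \<in> Basis"
    and d: "\<And>x. ((\<lambda>s. f (x + s *\<^sub>R e)) has_real_derivative g x) (at 0)"
    and f: "continuous_on UNIV f" and g: "continuous_on UNIV g" and \<delta>: "0 < \<delta>"
  shows "ennreal (cauchy_mollifier \<delta> (\<lambda>p. indicator \<Omega> p * (f p)\<^sup>2) x)
      \<le> (\<integral>\<^sup>+p. ennreal (indicator \<Omega> p * (2 * \<bar>f p * g p\<bar>)) * ennreal (\<Prod>b\<in>Basis-{e}. cauchy \<delta> ((p - x) \<bullet> b)) \<partial>lborel)
       + (\<integral>\<^sup>+p. ennreal ((f p)\<^sup>2) * ennreal (\<Prod>b\<in>Basis-{e}. cauchy \<delta> ((p - x) \<bullet> b)) \<partial>surface_measure \<Omega>)"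
proof -
  let ?z = "\<lambda>p. \<Prod>b\<in>Basis-{e}. cauchy \<delta> ((p - x) \<bullet> b)"
  let ?P = "\<lambda>p. cauchy_cdf \<delta> ((p - x) \<bullet> e)" and ?p = "\<lambda>p. cauchy \<delta> ((p - x) \<bullet> e)"
  let ?F = "\<lambda>p. (f p)\<^sup>2 * ?P p * ?z p"
  let ?G1 = "\<lambda>p. (f p)\<^sup>2 * (\<Prod>b\<in>Basis. cauchy \<delta> ((p - x) \<bullet> b))"
  let ?G2 = "\<lambda>p. 2 * (f p * g p) * ?P p * ?z p"
  have z0: "0 \<le> ?z p" for p by (intro prod_nonneg cauchy_nonneg \<delta> ballI)
  have prod: "(\<Prod>b\<in>Basis. cauchy \<delta> ((p - x) \<bullet> b)) = ?p p * ?z p" for p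
    using e by (subst prod.remove[of _ e]) auto
  have cz: "continuous_on UNIV ?z" by (intro continuous_intros \<delta>)
  have cP: "continuous_on UNIV ?P" "continuous_on UNIV ?p" by (intro continuous_intros \<delta>)+
  have c1: "continuous_on UNIV ?G1" and c2: "continuous_on UNIV ?G2" and cF: "continuous_on UNIV ?F"
    by (intro continuous_intros \<delta> f g cz cP)+
  have cabs: "continuous_on UNIV (\<lambda>p. 2 * \<bar>f p * g p\<bar> * ?z p)" by (intro continuous_intros f g cz)
  have i1: "integrable lborel (\<lambda>p. indicator \<Omega> p * ?G1 p)" and i2: "integrable lborel (\<lambda>p. indicator \<Omega> p * ?G2 p)"
    and i3: "integrable lborel (\<lambda>p. indicator \<Omega> p * (2 * \<bar>f p * g p\<bar> * ?z p))"
    by (intro integrable_indicator_continuous op bdd c1 c2 cabs)+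
  have gg: "ennreal \<bar>\<integral>p. indicator \<Omega> p * (?G1 p + ?G2 p) \<partial>lborel\<bar> \<le> (\<integral>\<^sup>+p. ennreal \<bar>?F p\<bar> \<partial>surface_measure \<Omega>)"
  proof (rule gauss_green_bound[OF op bdd e _ cF])
    fix p
    have z: "?z (p + s *\<^sub>R e) = ?z p" for s
      using e by (intro prod.cong refl) (auto simp: inner_simps inner_Basis)
    have P: "?P (p + s *\<^sub>R e) = cauchy_cdf \<delta> ((p - x) \<bullet> e + s)" for s
    proof -
      have "(p + s *\<^sub>R e - x) \<bullet> e = (p - x) \<bullet> e + s" using e by (simp add: inner_simps)
      then show ?thesis by simp
    qed
    have dP: "((\<lambda>s. cauchy_cdf \<delta> ((p - x) \<bullet> e + s)) has_real_derivative ?p p) (at 0)"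
      using DERIV_cauchy_cdf[OF \<delta>, of "(p - x) \<bullet> e"] DERIV_shift[of "cauchy_cdf \<delta>" _ 0 "(p - x) \<bullet> e"]
      by (simp add: add.commute)
    have "((\<lambda>s. (f (p + s *\<^sub>R e))\<^sup>2 * cauchy_cdf \<delta> ((p - x) \<bullet> e + s) * ?z p) has_real_derivative
        (2 * f p * g p * ?P p + (f p)\<^sup>2 * ?p p) * ?z p) (at 0)"
      by (rule derivative_eq_intros d dP refl | simp)+
    then show "((\<lambda>s. ?F (p + s *\<^sub>R e)) has_real_derivative ?G1 p + ?G2 p) (at 0)"
      by (simp only: z P prod) (simp add: algebra_simps)
  qed (intro continuous_on_add c1 c2)
  have "cauchy_mollifier \<delta> (\<lambda>p. indicator \<Omega> p * (f p)\<^sup>2) x = (\<integral>p. indicator \<Omega> p * ?G1 p \<partial>lborel)"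
    by (simp add: cauchy_mollifier_def mult.assoc)
  also have "\<dots> = (\<integral>p. indicator \<Omega> p * (?G1 p + ?G2 p) \<partial>lborel) - (\<integral>p. indicator \<Omega> p * ?G2 p \<partial>lborel)"
    by (subst distrib_left, subst Bochner_Integration.integral_add[OF i1 i2]) simp
  also have "- (\<integral>p. indicator \<Omega> p * ?G2 p \<partial>lborel) \<le> (\<integral>p. indicator \<Omega> p * (2 * \<bar>f p * g p\<bar> * ?z p) \<partial>lborel)"
  proof (subst Bochner_Integration.integral_minus[symmetric], rule integral_mono[OF _ i3])
    show "integrable lborel (\<lambda>p. - (indicator \<Omega> p * ?G2 p))" using i2 by simp
    fix p
    have "- (f p * g p * ?P p) \<le> \<bar>f p * g p\<bar> * 1"
      using cauchy_cdf_bounds[of \<delta> "(p - x) \<bullet> e"]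
      by (metis abs_ge_minus_self abs_mult abs_of_nonneg abs_ge_zero mult_left_mono order_trans)
    then have "2 * (- (f p * g p * ?P p)) * ?z p \<le> 2 * \<bar>f p * g p\<bar> * ?z p"
      using z0[of p] by (intro mult_right_mono) auto
    then show "- (indicator \<Omega> p * ?G2 p) \<le> indicator \<Omega> p * (2 * \<bar>f p * g p\<bar> * ?z p)"
      by (auto simp: indicator_def algebra_simps)
  qed
  then have "(\<integral>p. indicator \<Omega> p * (?G1 p + ?G2 p) \<partial>lborel) - (\<integral>p. indicator \<Omega> p * ?G2 p \<partial>lborel)
     \<le> (\<integral>p. indicator \<Omega> p * (2 * \<bar>f p * g p\<bar> * ?z p) \<partial>lborel) + \<bar>\<integral>p. indicator \<Omega> p * (?G1 p + ?G2 p) \<partial>lborel\<bar>"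
    by linarith
  finally have "ennreal (cauchy_mollifier \<delta> (\<lambda>p. indicator \<Omega> p * (f p)\<^sup>2) x)
     \<le> ennreal ((\<integral>p. indicator \<Omega> p * (2 * \<bar>f p * g p\<bar> * ?z p) \<partial>lborel) + \<bar>\<integral>p. indicator \<Omega> p * (?G1 p + ?G2 p) \<partial>lborel\<bar>)"
    by (rule ennreal_leI)
  also have "\<dots> = ennreal (\<integral>p. indicator \<Omega> p * (2 * \<bar>f p * g p\<bar> * ?z p) \<partial>lborel) + ennreal \<bar>\<integral>p. indicator \<Omega> p * (?G1 p + ?G2 p) \<partial>lborel\<bar>"
    using z0 by (intro ennreal_plus integral_nonneg) auto
  also have "\<dots> \<le> (\<integral>\<^sup>+p. ennreal (indicator \<Omega> p * (2 * \<bar>f p * g p\<bar>)) * ennreal (?z p) \<partial>lborel)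
       + (\<integral>\<^sup>+p. ennreal ((f p)\<^sup>2) * ennreal (?z p) \<partial>surface_measure \<Omega>)"
  proof (rule add_mono)
    have "ennreal (\<integral>p. indicator \<Omega> p * (2 * \<bar>f p * g p\<bar> * ?z p) \<partial>lborel) = (\<integral>\<^sup>+p. ennreal (indicator \<Omega> p * (2 * \<bar>f p * g p\<bar> * ?z p)) \<partial>lborel)"
      using z0 by (intro nn_integral_eq_integral[symmetric] i3) auto
    also have "\<dots> = (\<integral>\<^sup>+p. ennreal (indicator \<Omega> p * (2 * \<bar>f p * g p\<bar>)) * ennreal (?z p) \<partial>lborel)"
      using z0 by (intro nn_integral_cong) (subst ennreal_mult[symmetric], auto simp: mult.assoc)
    finally show "ennreal (\<integral>p. indicator \<Omega> p * (2 * \<bar>f p * g p\<bar> * ?z p) \<partial>lborel) \<le> \<dots>" by simp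
    have "(\<integral>\<^sup>+p. ennreal \<bar>?F p\<bar> \<partial>surface_measure \<Omega>) \<le> (\<integral>\<^sup>+p. ennreal ((f p)\<^sup>2) * ennreal (?z p) \<partial>surface_measure \<Omega>)"
    proof (intro nn_integral_mono)
      fix p
      have "\<bar>?F p\<bar> \<le> (f p)\<^sup>2 * ?z p"
        using z0[of p] cauchy_cdf_bounds[of \<delta> "(p - x) \<bullet> e"]
        by (simp add: abs_mult mult_right_mono mult_left_le)
      then show "ennreal \<bar>?F p\<bar> \<le> ennreal ((f p)\<^sup>2) * ennreal (?z p)"
        using z0[of p] by (subst ennreal_mult[symmetric]) (auto intro: ennreal_leI)
    qed
    with gg show "ennreal \<bar>\<integral>p. indicator \<Omega> p * (?G1 p + ?G2 p) \<partial>lborel\<bar> \<le> \<dots>"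
      by (rule order_trans)
  qed
  finally show ?thesis .
qed

text \<open>
  In two dimensions, the mollified \<open>f\<^sup>2\<close> is bounded by a function of the first coordinate alone, and
  by one of the second coordinate alone, each with integral at most \<open>X\<close>; hence the integral of its
  square is at most \<open>X\<^sup>2\<close>. In one dimension the bound is a constant, whence the volume of \<open>\<Omega>\<close>. Removing
  the mollification is Fatou's lemma.
\<close>

theorem ladyzhenskaya_boundary:
  fixes f :: "'a::euclidean_space \<Rightarrow> real" and g :: "'a \<Rightarrow> 'a \<Rightarrow> real"
  assumes op: "open \<Omega>" and bdd: "bounded \<Omega>" and dim: "DIM('a) \<le> 2"
    and d: "\<And>e x. e \<in> Basis \<Longrightarrow> ((\<lambda>s. f (x + s *\<^sub>R e)) has_real_derivative g e x) (at 0)"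
    and f: "continuous_on UNIV f" and g: "\<And>e. e \<in> Basis \<Longrightarrow> continuous_on UNIV (g e)"
    and X: "0 \<le> X" "\<And>e. e \<in> Basis \<Longrightarrow> (\<integral>\<^sup>+p. ennreal (indicator \<Omega> p * (2 * \<bar>f p * g e p\<bar>)) \<partial>lborel)
      + (\<integral>\<^sup>+p. ennreal ((f p)\<^sup>2) \<partial>surface_measure \<Omega>) \<le> ennreal X"
  shows "(\<integral>\<^sup>+p. ennreal (indicator \<Omega> p * (f p) ^ 4) \<partial>lborel) \<le> ennreal (max 1 (measure lborel \<Omega>) * X\<^sup>2)"
proof -
  have [measurable]: "f \<in> borel_measurable borel" "\<Omega> \<in> sets borel"
    using f op by (auto intro: borel_measurable_continuous_onI)
  have gm [measurable]: "e \<in> Basis \<Longrightarrow> g e \<in> borel_measurable borel" for e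
    using g by (auto intro: borel_measurable_continuous_onI)
  let ?w = "\<lambda>p. indicator \<Omega> p * (f p)\<^sup>2"
  let ?W = "\<lambda>\<delta>. cauchy_mollifier \<delta> ?w"
  let ?z = "\<lambda>\<delta> e x p. \<Prod>b\<in>Basis-{e}. cauchy \<delta> ((p - x) \<bullet> b)"
  define N1 where "N1 = (\<lambda>e. density lborel (\<lambda>p. ennreal (indicator \<Omega> p * (2 * \<bar>f p * g e p\<bar>))))"
  define N2 where "N2 = density (hausdorff_measure (DIM('a) - 1)) (\<lambda>p. ennreal ((f p)\<^sup>2) * indicator (frontier \<Omega>) p)"
  have fr [measurable]: "frontier \<Omega> \<in> sets borel" by (simp add: borel_closed)
  have sets [measurable_cong]: "sets (N1 e) = sets borel" "sets N2 = sets borel" for e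
    by (simp_all add: N1_def N2_def)
  have N1: "emeasure (N1 e) UNIV = (\<integral>\<^sup>+p. ennreal (indicator \<Omega> p * (2 * \<bar>f p * g e p\<bar>)) \<partial>lborel)" if "e \<in> Basis" for e
    using gm[OF that] by (simp add: N1_def emeasure_density)
  have N2: "emeasure N2 UNIV = (\<integral>\<^sup>+p. ennreal ((f p)\<^sup>2) \<partial>surface_measure \<Omega>)"
    by (simp add: N2_def emeasure_density nn_integral_surface_measure)
  have N: "emeasure (N1 e) UNIV + emeasure N2 UNIV \<le> ennreal X" if "e \<in> Basis" for e
    using X(2)[OF that] N1[OF that] N2 by simp
  have fin: "finite_measure (N1 e)" "finite_measure N2" if "e \<in> Basis" for e
  proof -
    have "emeasure (N1 e) UNIV < top" "emeasure N2 UNIV < top"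
      using N[OF that] by (auto simp: top_unique less_top[symmetric])
    moreover have "space (N1 e) = UNIV" "space N2 = UNIV" by (simp_all add: N1_def N2_def)
    ultimately show "finite_measure (N1 e)" "finite_measure N2" by (auto intro!: finite_measureI)
  qed
  have bound: "ennreal (?W \<delta> x) \<le> (\<integral>\<^sup>+p. ennreal (?z \<delta> e x p) \<partial>N1 e) + (\<integral>\<^sup>+p. ennreal (?z \<delta> e x p) \<partial>N2)"
    if "e \<in> Basis" "0 < \<delta>" for e \<delta> x
  proof -
    have "(\<integral>\<^sup>+p. ennreal (?z \<delta> e x p) \<partial>N1 e) =
        (\<integral>\<^sup>+p. ennreal (indicator \<Omega> p * (2 * \<bar>f p * g e p\<bar>)) * ennreal (?z \<delta> e x p) \<partial>lborel)"
      using gm[OF that(1)] unfolding N1_def by (subst nn_integral_density) auto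
    moreover have "(\<integral>\<^sup>+p. ennreal (?z \<delta> e x p) \<partial>N2) = (\<integral>\<^sup>+p. ennreal ((f p)\<^sup>2) * ennreal (?z \<delta> e x p) \<partial>surface_measure \<Omega>)"
      unfolding N2_def by (subst nn_integral_density) (auto simp: nn_integral_surface_measure mult_ac)
    ultimately show ?thesis
      using cauchy_mollifier_bound[OF op bdd that(1) d[OF that(1)] f g[OF that(1)] that(2)] by simp
  qed
  have W0: "0 \<le> ?W \<delta> x" if "0 < \<delta>" for \<delta> x
    unfolding cauchy_mollifier_def using that
    by (intro Bochner_Integration.integral_nonneg mult_nonneg_nonneg prod_nonneg cauchy_nonneg ballI) auto
  have Wm [measurable]: "?W \<delta> \<in> borel_measurable borel" for \<delta>
    unfolding cauchy_mollifier_def by measurable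
  have main: "(\<integral>\<^sup>+x. ennreal (indicator \<Omega> x * (?W \<delta> x)\<^sup>2) \<partial>lborel) \<le> ennreal (max 1 (measure lborel \<Omega>) * X\<^sup>2)"
    if \<delta>: "0 < \<delta>" for \<delta>
  proof (cases "DIM('a) = 1")
    case True
    then obtain e :: 'a where e: "Basis = {e}" by (meson card_1_singletonE)
    have "ennreal (?W \<delta> x) \<le> ennreal X" for x
    proof -
      have "ennreal (?W \<delta> x) \<le> emeasure (N1 e) UNIV + emeasure N2 UNIV"
        using bound[of e \<delta> x] \<delta> sets_eq_imp_space_eq[OF sets(1)[of e]] sets_eq_imp_space_eq[OF sets(2)] by (simp add: e)
      also have "\<dots> \<le> ennreal X" by (rule N) (simp add: e)
      finally show ?thesis .
    qed
    then have WX: "?W \<delta> x \<le> X" for x using X(1) by (simp add: ennreal_le_iff)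
    have "(\<integral>\<^sup>+x. ennreal (indicator \<Omega> x * (?W \<delta> x)\<^sup>2) \<partial>lborel) \<le> (\<integral>\<^sup>+x. ennreal (X\<^sup>2) * indicator \<Omega> x \<partial>lborel)"
      using W0[OF \<delta>] WX by (intro nn_integral_mono) (auto simp: indicator_def intro!: ennreal_leI power_mono)
    also have "\<dots> = ennreal (X\<^sup>2) * emeasure lborel \<Omega>" by (rule nn_integral_cmult_indicator) simp
    also have "\<dots> = ennreal (X\<^sup>2 * measure lborel \<Omega>)"
      using emeasure_bounded_finite[OF bdd] by (simp add: emeasure_eq_ennreal_measure ennreal_mult)
    also have "\<dots> \<le> ennreal (max 1 (measure lborel \<Omega>) * X\<^sup>2)"
      by (intro ennreal_leI) (simp add: mult.commute mult_right_mono)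
    finally show ?thesis .
  next
    case False
    then have "card (Basis :: 'a set) = 2" using dim DIM_positive[where 'a='a] by linarith
    then obtain e e' :: 'a where e: "Basis = {e, e'}" "e \<noteq> e'" by (meson card_2_iff)
    then have eB: "e \<in> Basis" "e' \<in> Basis" by auto
    have rem: "Basis - {e} = {e'}" "Basis - {e'} = {e}" using e by auto
    define A where "A = (\<lambda>b c s. (\<integral>\<^sup>+p. ennreal (cauchy \<delta> (p \<bullet> c - s)) \<partial>N1 b) + (\<integral>\<^sup>+p. ennreal (cauchy \<delta> (p \<bullet> c - s)) \<partial>N2))"
    have marg: "(\<integral>\<^sup>+s. A b c s \<partial>lborel) \<le> ennreal X" "A b c \<in> borel_measurable borel" if "b \<in> Basis" for b c
    proof -
      interpret n1: finite_measure "N1 b" by (rule fin[OF that])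
      interpret n2: finite_measure N2 by (rule fin[OF that])
      show "A b c \<in> borel_measurable borel" unfolding A_def by measurable
      have "(\<integral>\<^sup>+s. A b c s \<partial>lborel) = (\<integral>\<^sup>+s. (\<integral>\<^sup>+p. ennreal (cauchy \<delta> (p \<bullet> c - s)) \<partial>N1 b) \<partial>lborel)
         + (\<integral>\<^sup>+s. (\<integral>\<^sup>+p. ennreal (cauchy \<delta> (p \<bullet> c - s)) \<partial>N2) \<partial>lborel)"
        unfolding A_def by (intro nn_integral_add) measurable
      also have "\<dots> = emeasure (N1 b) UNIV + emeasure N2 UNIV"
        using nn_integral_cauchy_marginal[OF fin(1)[OF that] sets(1) \<delta>] nn_integral_cauchy_marginal[OF fin(2)[OF that] sets(2) \<delta>]
        by simp
      also note N[OF that]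
      finally show "(\<integral>\<^sup>+s. A b c s \<partial>lborel) \<le> ennreal X" .
    qed
    have WA: "ennreal (?W \<delta> x) \<le> A e e' (x \<bullet> e')" "ennreal (?W \<delta> x) \<le> A e' e (x \<bullet> e)" for x
      using bound[OF eB(1) \<delta>, of x] bound[OF eB(2) \<delta>, of x] by (simp_all add: rem A_def inner_diff_left)
    let ?A = "\<lambda>b. if b = e then A e' e else A e e'"
    have "(\<integral>\<^sup>+x. ennreal (indicator \<Omega> x * (?W \<delta> x)\<^sup>2) \<partial>lborel) \<le> (\<integral>\<^sup>+x. (\<Prod>b\<in>Basis. ?A b (x \<bullet> b)) \<partial>lborel)"
    proof (intro nn_integral_mono)
      fix x
      have "ennreal (indicator \<Omega> x * (?W \<delta> x)\<^sup>2) \<le> ennreal (?W \<delta> x) * ennreal (?W \<delta> x)"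
        using W0[OF \<delta>] by (subst ennreal_mult[symmetric]) (auto simp: indicator_def power2_eq_square intro!: ennreal_leI)
      also have "\<dots> \<le> A e' e (x \<bullet> e) * A e e' (x \<bullet> e')" using WA by (intro mult_mono) auto
      also have "\<dots> = (\<Prod>b\<in>Basis. ?A b (x \<bullet> b))" unfolding e(1) using e(2) by auto
      finally show "ennreal (indicator \<Omega> x * (?W \<delta> x)\<^sup>2) \<le> \<dots>" .
    qed
    also have "\<dots> = (\<Prod>b\<in>(Basis::'a set). (\<integral>\<^sup>+s. ?A b s \<partial>lborel))"
      by (rule nn_integral_lborel_prod) (use marg eB in auto)
    also have "\<dots> = (\<integral>\<^sup>+s. A e' e s \<partial>lborel) * (\<integral>\<^sup>+s. A e e' s \<partial>lborel)"
      unfolding e(1) using e(2) by auto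
    also have "\<dots> \<le> ennreal X * ennreal X" using marg eB by (intro mult_mono) auto
    also have "\<dots> = ennreal (X\<^sup>2)" using X(1) by (simp add: ennreal_mult power2_eq_square)
    also have "\<dots> \<le> ennreal (max 1 (measure lborel \<Omega>) * X\<^sup>2)"
      using mult_right_mono[of 1 "max 1 (measure lborel \<Omega>)" "X\<^sup>2"] by (intro ennreal_leI) simp
    finally show ?thesis .
  qed
  obtain M where M: "\<And>x. x \<in> closure \<Omega> \<Longrightarrow> \<bar>(f x)\<^sup>2\<bar> \<le> M"
    using bounded_continuous_on_bounded[OF bdd continuous_on_power[OF f]] by metis
  have lim: "(\<lambda>k. indicator \<Omega> x * (?W (1 / real (Suc k)) x)\<^sup>2) \<longlonglongrightarrow> indicator \<Omega> x * (f x) ^ 4" for x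
  proof (cases "x \<in> \<Omega>")
    case True
    have "(\<lambda>k. ?W (1 / real (Suc k)) x) \<longlonglongrightarrow> ?w x"
    proof (rule cauchy_mollifier_tendsto[OF op True])
      show "continuous_on \<Omega> ?w"
        by (rule continuous_on_eq[of _ "\<lambda>x. (f x)\<^sup>2"]) (auto intro!: continuous_intros continuous_on_subset[OF f])
      show "\<bar>?w p\<bar> \<le> max M 0" for p using M[of p] closure_subset[of \<Omega>] by (auto simp: indicator_def le_max_iff_disj)
    qed auto
    then have "(\<lambda>k. (?W (1 / real (Suc k)) x)\<^sup>2) \<longlonglongrightarrow> (?w x)\<^sup>2" by (rule tendsto_power)
    then show ?thesis using True by simp
  qed simp
  have "(\<integral>\<^sup>+p. ennreal (indicator \<Omega> p * (f p) ^ 4) \<partial>lborel)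
      = (\<integral>\<^sup>+x. liminf (\<lambda>k. ennreal (indicator \<Omega> x * (?W (1 / real (Suc k)) x)\<^sup>2)) \<partial>lborel)"
    using lim by (intro nn_integral_cong lim_imp_Liminf[symmetric] tendsto_ennrealI) auto
  also have "\<dots> \<le> liminf (\<lambda>k. (\<integral>\<^sup>+x. ennreal (indicator \<Omega> x * (?W (1 / real (Suc k)) x)\<^sup>2) \<partial>lborel))"
    by (rule nn_integral_liminf) measurable
  also have "\<dots> \<le> liminf (\<lambda>k::nat. ennreal (max 1 (measure lborel \<Omega>) * X\<^sup>2))"
    by (intro Liminf_mono always_eventually allI main) simp
  also have "\<dots> = ennreal (max 1 (measure lborel \<Omega>) * X\<^sup>2)" by (rule Liminf_const) simp
  finally show ?thesis .
qed

section \<open>Smooth functions and test functions\<close>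

text \<open>
  Smoothness is propagated through the algebra generated by the functions \<open>bump\<close> of affine functions of
  single coordinates, which is closed under partial derivatives.
\<close>

lemma partials_append: "partials (is @ js) f = partials is (partials js f)"
  by (induction "is") auto

lemma smooth_partials: "smooth f \<Longrightarrow> smooth (partials is f)"
  unfolding smooth_def by (metis partials_append)

lemma smooth_differentiable: "smooth f \<Longrightarrow> f differentiable (at x)"
  unfolding smooth_def by (metis partials.simps(1))

lemma smooth_continuous: "smooth f \<Longrightarrow> continuous_on S f"
  by (meson continuous_at_imp_continuous_on differentiable_imp_continuous_within smooth_differentiable)

lemma smooth_directional:
  assumes "smooth f"
  shows "((\<lambda>s. f (x + s *\<^sub>R axis i 1)) has_real_derivative partials [i] f x) (at 0)"
proof -
  have f: "(f has_derivative frechet_derivative f (at x)) (at x)"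
    using smooth_differentiable[OF assms] frechet_derivative_works by blast
  have l: "((\<lambda>s. x + s *\<^sub>R axis i 1) has_derivative (\<lambda>s. s *\<^sub>R axis i 1)) (at (0::real))"
    by (auto intro!: derivative_eq_intros)
  have "((\<lambda>s. f (x + s *\<^sub>R axis i 1)) has_derivative (\<lambda>s. frechet_derivative f (at x) (s *\<^sub>R axis i 1))) (at (0::real))"
    using has_derivative_compose[OF l, of f] f by simp
  moreover have "frechet_derivative f (at x) (s *\<^sub>R axis i 1) = partials [i] f x * s" for s
    using linear_frechet_derivative[OF smooth_differentiable[OF assms, of x]] by (simp add: linear_cmul)
  ultimately show ?thesis by (simp add: has_field_derivative_def)
qed

lemma partials_eq_0:
  assumes "smooth f" "open U" "\<And>x. x \<in> U \<Longrightarrow> f x = 0" "x \<in> U"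
  shows "partials [i] f x = 0"
proof -
  have "(f has_derivative (\<lambda>_. 0)) (at x)"
    by (rule has_derivative_transform_within_open[OF has_derivative_const assms(2,4)]) (use assms in auto)
  then have "frechet_derivative f (at x) = (\<lambda>_. 0)" by (metis frechet_derivative_at)
  then show ?thesis by simp
qed

lemma test_function_partial:
  assumes "test_function \<Omega> \<phi>" shows "test_function \<Omega> (partials [i] \<phi>)"
proof -
  have sm: "smooth \<phi>" and c: "compact (closure {x. \<phi> x \<noteq> 0})" and sub: "closure {x. \<phi> x \<noteq> 0} \<subseteq> \<Omega>"
    using assms by (auto simp: test_function_def)
  have "partials [i] \<phi> x = 0" if "x \<notin> closure {x. \<phi> x \<noteq> 0}" for x
    using that closure_subset[of "{x. \<phi> x \<noteq> 0}"]
    by (intro partials_eq_0[OF sm, of "- closure {x. \<phi> x \<noteq> 0}"]) auto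
  then have cl: "closure {x. partials [i] \<phi> x \<noteq> 0} \<subseteq> closure {x. \<phi> x \<noteq> 0}"
    by (intro closure_minimal) auto
  then have "compact (closure {x. partials [i] \<phi> x \<noteq> 0})"
    using closed_Int_compact[OF closed_closure c] by (metis inf.absorb_iff1)
  then show ?thesis
    using cl sub smooth_partials[OF sm] unfolding test_function_def by blast
qed

text \<open>
  The family \<open>exp(-1/s) / s\<^sup>m\<close>, extended by \<open>0\<close> to \<open>s \<le> 0\<close>; its linear span is closed under derivatives.
\<close>

definition bump :: "nat \<Rightarrow> real \<Rightarrow> real" where
  "bump m s = (if 0 < s then exp (- 1 / s) / s ^ m else 0)"

lemma bump_bound: assumes "0 < s" shows "bump m s \<le> fact (m + 2) * s\<^sup>2"
proof -
  have "sum (\<lambda>n. (1 / s) ^ n /\<^sub>R fact n) {m + 2} \<le> (\<Sum>n. (1 / s) ^ n /\<^sub>R fact n)"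
    using assms by (intro sum_le_suminf summable_exp_generic) auto
  then have "(1 / s) ^ (m + 2) / fact (m + 2) \<le> exp (1 / s)"
    by (simp add: exp_def scaleR_conv_of_real divide_inverse mult.commute)
  moreover have "(1 / s) ^ (m + 2) = 1 / (s ^ m * s\<^sup>2)" by (simp add: power_one_over power2_eq_square)
  ultimately have "1 / (s ^ m * s\<^sup>2) / fact (m + 2) \<le> exp (1 / s)" by (simp only:)
  then have "1 / (s ^ m * s\<^sup>2) \<le> exp (1 / s) * fact (m + 2)"
    by (subst (asm) pos_divide_le_eq) simp_all
  then have "1 / (s ^ m * s\<^sup>2) * s\<^sup>2 \<le> exp (1 / s) * fact (m + 2) * s\<^sup>2"
    by (rule mult_right_mono) simp
  moreover have "1 / (s ^ m * s\<^sup>2) * s\<^sup>2 = 1 / s ^ m" using assms by simp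
  ultimately have "1 / s ^ m \<le> fact (m + 2) * exp (1 / s) * s\<^sup>2" by (simp only: mult.commute[of "exp (1 / s)"])
  then have "exp (- (1 / s)) * (1 / s ^ m) \<le> exp (- (1 / s)) * (fact (m + 2) * exp (1 / s) * s\<^sup>2)"
    by (rule mult_left_mono) simp
  also have "\<dots> = (exp (- (1 / s)) * exp (1 / s)) * (fact (m + 2) * s\<^sup>2)" by simp
  also have "exp (- (1 / s)) * exp (1 / s) = 1" by (simp add: exp_add[symmetric])
  finally show ?thesis using assms by (simp add: bump_def)
qed

lemma bump_nonneg: "0 \<le> bump m s"
  by (simp add: bump_def)

lemma DERIV_bump: "(bump m has_real_derivative bump (m + 2) s - real m * bump (m + 1) s) (at s)"
proof -
  consider "0 < s" | "s < 0" | "s = 0" by linarith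
  then show ?thesis
  proof cases
    case 1
    have "((\<lambda>s. exp (- 1 / s) / s ^ m) has_real_derivative
       (exp (- 1 / s) * (1 / s\<^sup>2) * s ^ m - exp (- 1 / s) * (real m * s ^ (m - 1))) / (s ^ m * s ^ m)) (at s)"
      using 1 by (auto intro!: derivative_eq_intros simp: power2_eq_square)
    moreover have "(exp (- 1 / s) * (1 / s\<^sup>2) * s ^ m - exp (- 1 / s) * (real m * s ^ (m - 1))) / (s ^ m * s ^ m)
        = bump (m + 2) s - real m * bump (m + 1) s"
      using 1 by (cases m) (simp_all add: bump_def field_simps power2_eq_square)
    ultimately have "((\<lambda>s. exp (- 1 / s) / s ^ m) has_real_derivative bump (m + 2) s - real m * bump (m + 1) s) (at s)" by simp
    then show ?thesis
      by (rule DERIV_cong_ev[OF refl _ refl, THEN iffD1, rotated])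
         (use 1 eventually_nhds_in_open[of "{0<..}" s] in \<open>auto simp: bump_def elim!: eventually_mono\<close>)
  next
    case 2
    have "((\<lambda>s. 0) has_real_derivative bump (m + 2) s - real m * bump (m + 1) s) (at s)"
      using 2 by (simp add: bump_def)
    then show ?thesis
      by (rule DERIV_cong_ev[OF refl _ refl, THEN iffD1, rotated])
         (use 2 eventually_nhds_in_open[of "{..<0}" s] in \<open>auto simp: bump_def elim!: eventually_mono\<close>)
  next
    case 3
    have "((\<lambda>h. (bump m (0 + h) - bump m 0) / h) \<longlongrightarrow> 0) (at 0)"
    proof (rule tendsto_0_le[where K = "fact (m + 2)"])
      show "((\<lambda>h::real. h) \<longlongrightarrow> 0) (at 0)" by (rule tendsto_ident_at)
      show "\<forall>\<^sub>F h in at 0. norm ((bump m (0 + h) - bump m 0) / h) \<le> norm h * fact (m + 2)"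
      proof (intro always_eventually allI)
        fix h :: real
        show "norm ((bump m (0 + h) - bump m 0) / h) \<le> norm h * fact (m + 2)"
        proof (cases "0 < h")
          case True
          then show ?thesis using bump_bound[of h m] bump_nonneg[of m h]
            by (simp add: bump_def[of m 0] field_simps power2_eq_square abs_of_nonneg)
        qed (simp add: bump_def mult_nonpos_nonneg)
      qed
    qed
    then show ?thesis using 3 by (simp add: DERIV_def bump_def)
  qed
qed

text \<open>
  The algebra of functions on which differentiability need only be checked for the generators.
\<close>

inductive bump_algebra :: "(real^'n \<Rightarrow> real) \<Rightarrow> bool" where
  base: "bump_algebra (\<lambda>x. bump m (c * x $ i + d))"
| const: "bump_algebra (\<lambda>x. c)"
| add: "bump_algebra f \<Longrightarrow> bump_algebra g \<Longrightarrow> bump_algebra (\<lambda>x. f x + g x)"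
| mult: "bump_algebra f \<Longrightarrow> bump_algebra g \<Longrightarrow> bump_algebra (\<lambda>x. f x * g x)"

lemma bump_algebra_derivative:
  fixes f :: "real^'n \<Rightarrow> real"
  assumes "bump_algebra f"
  shows "(\<forall>x. f differentiable (at x)) \<and> (\<forall>i. bump_algebra (\<lambda>x. frechet_derivative f (at x) (axis i 1)))"
  using assms
proof induction
  case (base m c j d)
  let ?D = "\<lambda>x::real^'n. bump (m + 2) (c * x $ j + d) - real m * bump (m + 1) (c * x $ j + d)"
  have D: "((\<lambda>x. bump m (c * x $ j + d)) has_derivative (\<lambda>h. ?D x * (c * h $ j))) (at x)" for x :: "real^'n"
  proof -
    have "((\<lambda>x::real^'n. c * x $ j + d) has_derivative (\<lambda>h. c * h $ j)) (at x)"
      by (auto intro!: derivative_eq_intros bounded_linear.has_derivative[OF bounded_linear_vec_nth])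
    then show ?thesis
      using has_derivative_compose[of "\<lambda>x::real^'n. c * x $ j + d" "\<lambda>h. c * h $ j" x UNIV "bump m" "(*) (?D x)"]
        DERIV_bump[of m "c * x $ j + d"] by (simp add: has_field_derivative_def)
  qed
  have "frechet_derivative (\<lambda>x. bump m (c * x $ j + d)) (at x) (axis i 1) = ?D x * (c * axis i 1 $ j)" for i and x :: "real^'n"
    using frechet_derivative_at[OF D[of x]] by metis
  moreover have "bump_algebra (\<lambda>x::real^'n. (bump (m + 2) (c * x $ j + d) + (- real m) * bump (m + 1) (c * x $ j + d)) * (c * axis i 1 $ j))" for i
    by (intro bump_algebra.intros)
  moreover have "\<forall>x. (\<lambda>x. bump m (c * x $ j + d)) differentiable (at x)"
    unfolding differentiable_def using D by blast
  ultimately show ?case by simp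
next
  case (const c)
  have "frechet_derivative (\<lambda>x::real^'n. c) (at x) = (\<lambda>_. 0)" for x by (rule frechet_derivative_const)
  then show ?case using bump_algebra.const[of 0] by simp
next
  case (add f g)
  have "frechet_derivative (\<lambda>x. f x + g x) (at x) = (\<lambda>h. frechet_derivative f (at x) h + frechet_derivative g (at x) h)" for x
    using add.IH by (intro frechet_derivative_at[symmetric] has_derivative_add) (auto simp: frechet_derivative_works)
  then show ?case using add.IH by (auto intro!: bump_algebra.add)
next
  case (mult f g)
  have "frechet_derivative (\<lambda>x. f x * g x) (at x) = (\<lambda>h. f x * frechet_derivative g (at x) h + frechet_derivative f (at x) h * g x)" for x
    using mult.IH by (intro frechet_derivative_at[symmetric] has_derivative_mult) (auto simp: frechet_derivative_works)
  then show ?case using mult.IH mult.hyps by (auto intro!: bump_algebra.add bump_algebra.mult)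
qed

lemma bump_algebra_smooth:
  assumes "bump_algebra f" shows "smooth f"
proof -
  have "bump_algebra (partials is f)" for "is"
    by (induction "is") (use assms bump_algebra_derivative in auto)
  then show ?thesis unfolding smooth_def using bump_algebra_derivative by blast
qed

lemma bump_algebra_prod:
  "finite A \<Longrightarrow> (\<And>a. a \<in> A \<Longrightarrow> bump_algebra (f a)) \<Longrightarrow> bump_algebra (\<lambda>x. \<Prod>a\<in>A. f a x)"
  by (induction A rule: finite_induct) (auto intro: bump_algebra.intros)

text \<open>
  Test functions supported in the box with corners \<open>a\<close>, \<open>b\<close> that increase to its indicator function:
  \<open>exp(-1/((k+1) s))\<close> tends to \<open>1\<close> for \<open>s > 0\<close>.
\<close>

definition box_bump :: "real^'n \<Rightarrow> real^'n \<Rightarrow> nat \<Rightarrow> real^'n \<Rightarrow> real" where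
  "box_bump a b k x = (\<Prod>i\<in>UNIV. bump 0 (real (Suc k) * x $ i - real (Suc k) * a $ i) * bump 0 (real (Suc k) * b $ i - real (Suc k) * x $ i))"

lemma smooth_box_bump: "smooth (box_bump a b k)"
proof -
  have "bump_algebra (\<lambda>x. \<Prod>i\<in>UNIV. bump 0 (real (Suc k) * x $ i + (- real (Suc k) * a $ i)) * bump 0 ((- real (Suc k)) * x $ i + real (Suc k) * b $ i))"
    by (intro bump_algebra_prod bump_algebra.intros) auto
  moreover have "box_bump a b k = (\<lambda>x. \<Prod>i\<in>UNIV. bump 0 (real (Suc k) * x $ i + (- real (Suc k) * a $ i)) * bump 0 ((- real (Suc k)) * x $ i + real (Suc k) * b $ i))"
    by (simp add: box_bump_def fun_eq_iff del: of_nat_Suc)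
  ultimately show ?thesis using bump_algebra_smooth by metis
qed

lemma bump_0_le_1: "bump 0 s \<le> 1" by (simp add: bump_def)

lemma box_bump_bounds: "0 \<le> box_bump a b k x" "box_bump a b k x \<le> 1"
  by (auto simp: box_bump_def bump_0_le_1 bump_nonneg intro!: prod_nonneg prod_le_1 mult_le_one)

lemma box_bump_outside: assumes "x \<notin> box a b" shows "box_bump a b k x = 0"
proof -
  obtain i where "\<not> (a $ i < x $ i \<and> x $ i < b $ i)" using assms by (auto simp: mem_box_cart)
  then have "bump 0 (real (Suc k) * x $ i - real (Suc k) * a $ i) * bump 0 (real (Suc k) * b $ i - real (Suc k) * x $ i) = 0"
    by (auto simp: bump_def zero_less_mult_iff right_diff_distrib[symmetric] simp del: of_nat_Suc)
  then show ?thesis unfolding box_bump_def by (intro prod_zero) auto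
qed

lemma bump_0_tendsto: assumes "0 < s" shows "(\<lambda>k. bump 0 (real (Suc k) * s)) \<longlonglongrightarrow> 1"
proof -
  have "(\<lambda>k. exp (- (1 / s) * (1 / real (Suc k)))) \<longlonglongrightarrow> exp (- (1 / s) * 0)"
    by (intro tendsto_intros LIMSEQ_Suc[OF lim_inverse_n'])
  moreover have "exp (- (1 / s) * (1 / real (Suc k))) = bump 0 (real (Suc k) * s)" for k
    using assms by (simp add: bump_def field_simps del: of_nat_Suc)
  ultimately show ?thesis by simp
qed

lemma box_bump_tendsto: "(\<lambda>k. box_bump a b k x) \<longlonglongrightarrow> indicator (box a b) x"
proof (cases "x \<in> box a b")
  case True
  have "(\<lambda>k. box_bump a b k x) \<longlonglongrightarrow> (\<Prod>i\<in>(UNIV::'a set). 1 * 1)"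
    unfolding box_bump_def right_diff_distrib[symmetric]
    using True by (intro tendsto_prod tendsto_mult bump_0_tendsto) (auto simp: mem_box_cart)
  then show ?thesis using True by simp
qed (simp add: box_bump_outside)

lemma test_function_box_bump:
  fixes a b :: "real^'n"
  assumes "cbox a b \<subseteq> \<Omega>" shows "test_function \<Omega> (box_bump a b k)"
proof -
  have cl: "closure {x. box_bump a b k x \<noteq> 0} \<subseteq> cbox a b"
    using box_bump_outside[of _ a b k] box_subset_cbox[of a b] by (intro closure_minimal closed_cbox) blast
  then have "compact (closure {x. box_bump a b k x \<noteq> 0})"
    using closed_Int_compact[OF closed_closure compact_cbox] by (metis inf.absorb_iff1)
  then show ?thesis using cl assms smooth_box_bump unfolding test_function_def by blast
qed

section \<open>Square-integrable functions on a bounded open set\<close>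

lemma integral_lebesgue_on_open:
  fixes h :: "'a::euclidean_space \<Rightarrow> real"
  assumes "open \<Omega>" and [measurable]: "h \<in> borel_measurable borel"
  shows "(\<integral>x. h x \<partial>lebesgue_on \<Omega>) = (\<integral>x. indicator \<Omega> x * h x \<partial>lborel)"
proof -
  have [measurable]: "\<Omega> \<in> sets borel" using assms by simp
  have "(\<integral>x. h x \<partial>lebesgue_on \<Omega>) = (\<integral>x. indicator \<Omega> x *\<^sub>R h x \<partial>lebesgue)"
    by (rule integral_restrict_space) auto
  also have "\<dots> = (\<integral>x. indicator \<Omega> x *\<^sub>R h x \<partial>lborel)" by (rule integral_completion) measurable
  finally show ?thesis by simp
qed

lemma borel_measurable_lebesgue_on:
  "h \<in> borel_measurable borel \<Longrightarrow> h \<in> borel_measurable (lebesgue_on \<Omega>)"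
  by (intro measurable_restrict_space1 measurable_completion) simp

lemma L2_measurable: "L2 M f \<Longrightarrow> f \<in> borel_measurable M"
  by (simp add: L2_def)

lemma L2_square_integrable: "L2 M f \<Longrightarrow> integrable M (\<lambda>x. (f x)\<^sup>2)"
  by (simp add: L2_def)

lemma L2_mult_integrable:
  assumes "L2 M f" "L2 M g" shows "integrable M (\<lambda>x. f x * g x)"
proof (rule Bochner_Integration.integrable_bound)
  show "integrable M (\<lambda>x. (f x)\<^sup>2 + (g x)\<^sup>2)" using assms by (auto simp: L2_def)
  show "(\<lambda>x. f x * g x) \<in> borel_measurable M" using assms by (auto simp: L2_def)
  have "\<bar>a * b\<bar> \<le> \<bar>a\<^sup>2 + b\<^sup>2\<bar>" for a b :: real
  proof -
    have "2 * (\<bar>a\<bar> * \<bar>b\<bar>) \<le> a\<^sup>2 + b\<^sup>2"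
      using zero_le_power2[of "\<bar>a\<bar> - \<bar>b\<bar>"] by (simp add: power2_diff)
    moreover have "0 \<le> \<bar>a\<bar> * \<bar>b\<bar>" by simp
    ultimately have "\<bar>a\<bar> * \<bar>b\<bar> \<le> a\<^sup>2 + b\<^sup>2" by linarith
    then show ?thesis by (simp add: abs_mult)
  qed
  then show "AE x in M. norm (f x * g x) \<le> norm ((f x)\<^sup>2 + (g x)\<^sup>2)" by simp
qed

lemma L2_add: assumes "L2 M f" "L2 M g" shows "L2 M (\<lambda>x. f x + g x)"
proof -
  have "integrable M (\<lambda>x. (f x)\<^sup>2 + (g x)\<^sup>2 + 2 * (f x * g x))"
    using assms L2_mult_integrable[OF assms] by (intro Bochner_Integration.integrable_add) (auto simp: L2_def)
  moreover have "(\<lambda>x. f x + g x) \<in> borel_measurable M"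
    using assms by (intro borel_measurable_add) (auto dest: L2_measurable)
  ultimately show ?thesis by (simp add: L2_def power2_sum mult.assoc)
qed

lemma L2_cmult: "L2 M f \<Longrightarrow> L2 M (\<lambda>x. c * f x)"
  by (auto simp: L2_def power_mult_distrib)

lemma L2_diff: "L2 M f \<Longrightarrow> L2 M g \<Longrightarrow> L2 M (\<lambda>x. f x - g x)"
  using L2_add[of M f "\<lambda>x. (-1) * g x"] L2_cmult[of M g "-1"] by simp

lemma L2_zero: "L2 M (\<lambda>x. 0)" by (simp add: L2_def)

lemma L2_sum: "(\<And>i. i \<in> A \<Longrightarrow> L2 M (f i)) \<Longrightarrow> L2 M (\<lambda>x. \<Sum>i\<in>A. f i x)"
  by (induction A rule: infinite_finite_induct) (auto intro: L2_add L2_zero)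

lemma L2_bounded:
  assumes "finite_measure M" "f \<in> borel_measurable M" "\<And>x. x \<in> space M \<Longrightarrow> \<bar>f x\<bar> \<le> C"
  shows "L2 M f"
proof -
  interpret finite_measure M by fact
  have "(f x)\<^sup>2 \<le> C\<^sup>2" if "x \<in> space M" for x using assms(3)[OF that] by (metis abs_ge_zero power2_abs power_mono)
  then have "integrable M (\<lambda>x. (f x)\<^sup>2)" using assms(2) by (intro integrable_const_bound[where B = "C\<^sup>2"]) auto
  then show ?thesis using assms(2) by (simp add: L2_def)
qed

lemma L2_Cauchy_Schwarz:
  assumes f: "L2 M f" and g: "L2 M g"
  shows "\<bar>\<integral>x. f x * g x \<partial>M\<bar> \<le> sqrt (\<integral>x. (f x)\<^sup>2 \<partial>M) * sqrt (\<integral>x. (g x)\<^sup>2 \<partial>M)"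
proof -
  let ?a = "\<integral>x. (f x)\<^sup>2 \<partial>M" and ?b = "\<integral>x. f x * g x \<partial>M" and ?c = "\<integral>x. (g x)\<^sup>2 \<partial>M"
  note i = L2_square_integrable[OF f] L2_mult_integrable[OF f g] L2_square_integrable[OF g]
  have "0 \<le> ?a * t\<^sup>2 + 2 * ?b * t + ?c" for t
  proof -
    have "0 \<le> (\<integral>x. (t * f x + g x)\<^sup>2 \<partial>M)" by (rule Bochner_Integration.integral_nonneg) simp
    also have "(\<integral>x. (t * f x + g x)\<^sup>2 \<partial>M) = (\<integral>x. t\<^sup>2 * (f x)\<^sup>2 + (2 * t) * (f x * g x) + (g x)\<^sup>2 \<partial>M)"
      by (simp add: power2_sum power_mult_distrib algebra_simps)
    also have "\<dots> = t\<^sup>2 * ?a + (2 * t) * ?b + ?c"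
      using i by (simp add: Bochner_Integration.integral_add)
    finally show ?thesis by (simp add: algebra_simps)
  qed
  note pos = this
  have a0: "0 \<le> ?a" and c0: "0 \<le> ?c" by (auto intro!: Bochner_Integration.integral_nonneg)
  have "?b\<^sup>2 \<le> ?a * ?c"
  proof (cases "?a = 0")
    case True
    have "?b = 0"
    proof (rule ccontr)
      assume "?b \<noteq> 0"
      then show False using pos[of "- (?c + 1) / (2 * ?b)"] True by (simp add: field_simps)
    qed
    then show ?thesis using True by simp
  next
    case False
    have "?a * (- ?b / ?a)\<^sup>2 + 2 * ?b * (- ?b / ?a) + ?c = ?c - ?b\<^sup>2 / ?a"
      using False by (simp add: power2_eq_square)
    then have "?b\<^sup>2 / ?a \<le> ?c" using pos[of "- ?b / ?a"] by simp
    moreover have "0 < ?a" using False a0 by linarith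
    ultimately show ?thesis by (simp only: pos_divide_le_eq mult.commute)
  qed
  then have "sqrt (?b\<^sup>2) \<le> sqrt (?a * ?c)" by (rule real_sqrt_le_mono)
  then show ?thesis by (simp add: real_sqrt_mult)
qed

lemma L2_integral_0:
  assumes "L2 M f" "(\<integral>x. (f x)\<^sup>2 \<partial>M) = 0" shows "AE x in M. f x = 0"
proof -
  have "AE x in M. (f x)\<^sup>2 = 0"
    using assms integral_nonneg_eq_0_iff_AE[of M "\<lambda>x. (f x)\<^sup>2"] by (simp add: L2_def)
  then show ?thesis by simp
qed

section \<open>Weak derivatives\<close>

text \<open>
  The densities given by the positive and the negative part of \<open>v\<close> agree on the generating boxes.
\<close>

lemma AE_zero_if_box_integrals_zero:
  fixes v :: "'a::euclidean_space \<Rightarrow> real"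
  assumes v: "integrable lborel v" and z: "\<And>a b. (\<integral>x. indicator (box a b) x * v x \<partial>lborel) = 0"
  shows "AE x in lborel. v x = 0"
proof -
  have [measurable]: "v \<in> borel_measurable borel" using v by auto
  let ?P = "density lborel (\<lambda>x. ennreal (v x))" and ?N = "density lborel (\<lambda>x. ennreal (- v x))"
  have fin: "(\<integral>\<^sup>+x. ennreal (v x) \<partial>lborel) < top" "(\<integral>\<^sup>+x. ennreal (- v x) \<partial>lborel) < top"
  proof -
    have "(\<integral>\<^sup>+x. ennreal (v x) \<partial>lborel) \<le> (\<integral>\<^sup>+x. ennreal (norm (v x)) \<partial>lborel)"
      "(\<integral>\<^sup>+x. ennreal (- v x) \<partial>lborel) \<le> (\<integral>\<^sup>+x. ennreal (norm (v x)) \<partial>lborel)"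
      by (intro nn_integral_mono ennreal_leI; simp)+
    then show "(\<integral>\<^sup>+x. ennreal (v x) \<partial>lborel) < top" "(\<integral>\<^sup>+x. ennreal (- v x) \<partial>lborel) < top"
      using v unfolding integrable_iff_bounded by (auto simp: less_top[symmetric] top_unique)
  qed
  have box_eq: "emeasure ?P (box a b) = emeasure ?N (box a b)" for a b
  proof -
    have vi: "integrable lborel (\<lambda>x. indicator (box a b) x * v x)"
      by (rule Bochner_Integration.integrable_bound[OF v]) (auto simp: indicator_def)
    have e: "emeasure ?P (box a b) = (\<integral>\<^sup>+x. ennreal (indicator (box a b) x * v x) \<partial>lborel)"
      "emeasure ?N (box a b) = (\<integral>\<^sup>+x. ennreal (- (indicator (box a b) x * v x)) \<partial>lborel)"
      by (auto simp: emeasure_density indicator_def intro!: nn_integral_cong)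
    have "emeasure ?P (box a b) < top" "emeasure ?N (box a b) < top"
    proof -
      have "emeasure ?P (box a b) \<le> (\<integral>\<^sup>+x. ennreal (v x) \<partial>lborel)" "emeasure ?N (box a b) \<le> (\<integral>\<^sup>+x. ennreal (- v x) \<partial>lborel)"
        unfolding e by (intro nn_integral_mono; auto simp: indicator_def)+
      then show "emeasure ?P (box a b) < top" "emeasure ?N (box a b) < top" using fin by auto
    qed
    moreover have "enn2real (emeasure ?P (box a b)) = enn2real (emeasure ?N (box a b))"
      using real_lebesgue_integral_def[OF vi] z[of a b] e by simp
    ultimately show ?thesis by (metis ennreal_enn2real)
  qed
  have "?P = ?N"
  proof (rule measure_eqI_generator_eq)
    let ?E = "range (\<lambda>(a, b). box a b :: 'a set)"
    show "Int_stable ?E" by (auto simp: Int_stable_def box_Int_box)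
    show "?E \<subseteq> Pow UNIV" "sets ?P = sigma_sets UNIV ?E" "sets ?N = sigma_sets UNIV ?E"
      by (simp_all add: borel_eq_box)
    show "range (\<lambda>n::nat. box (- (real n *\<^sub>R One)) (real n *\<^sub>R One)) \<subseteq> ?E" by auto
    show "(\<Union>n::nat. box (- (real n *\<^sub>R One)) (real n *\<^sub>R One)) = (UNIV :: 'a set)"
      unfolding UN_box_eq_UNIV by auto
    fix n :: nat
    have "emeasure ?P (box (- (real n *\<^sub>R One)) (real n *\<^sub>R One)) \<le> (\<integral>\<^sup>+x. ennreal (v x) \<partial>lborel)"
      by (subst emeasure_density) (auto intro!: nn_integral_mono simp: indicator_def)
    then show "emeasure ?P (box (- (real n *\<^sub>R One)) (real n *\<^sub>R One)) \<noteq> \<infinity>" using fin by (auto simp: top_unique)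
  qed (use box_eq in auto)
  then have "AE x in lborel. ennreal (v x) = ennreal (- v x)"
    using fin by (subst (asm) finite_density_unique) auto
  then show ?thesis
  proof eventually_elim
    case (elim x)
    then show ?case by (cases "0 \<le> v x") (auto simp: ennreal_neg ennreal_eq_0_iff)
  qed
qed

text \<open>All properties of Sobolev functions used here hold on every bounded open set.\<close>

locale bounded_open =
  fixes \<Omega> :: "(real^'n) set"
  assumes op: "open \<Omega>" and bdd: "bounded \<Omega>"
begin

abbreviation "M \<equiv> lebesgue_on \<Omega>"

lemma Omega_sets [measurable]: "\<Omega> \<in> sets borel" using op by simp

lemma finite_M: "finite_measure M"
proof (rule finite_measureI)
  have "emeasure M \<Omega> = emeasure lborel \<Omega>" using op by (subst emeasure_restrict_space) auto
  then show "emeasure M (space M) \<noteq> \<infinity>" using emeasure_bounded_finite[OF bdd] by (simp add: less_top)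
qed

lemma L2_continuous: assumes "continuous_on UNIV f" shows "L2 M f"
proof -
  obtain C where "\<And>x. x \<in> closure \<Omega> \<Longrightarrow> \<bar>f x\<bar> \<le> C" using bounded_continuous_on_bounded[OF bdd assms] by blast
  then show ?thesis
    using closure_subset[of \<Omega>] assms
    by (intro L2_bounded[OF finite_M, of _ C] borel_measurable_lebesgue_on borel_measurable_continuous_onI) auto
qed

lemma L2_smooth: "smooth f \<Longrightarrow> L2 M f"
  by (intro L2_continuous smooth_continuous)

lemma L2_partials: "smooth f \<Longrightarrow> L2 M (partials is f)"
  by (intro L2_smooth smooth_partials)

lemma test_smooth: "test_function \<Omega> \<phi> \<Longrightarrow> smooth \<phi>" by (simp add: test_function_def)

text \<open>
  The fundamental lemma of the calculus of variations. On the boxes inside \<open>\<Omega>\<close>, \<open>box_bump\<close> turns the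
  hypothesis into vanishing integrals. The function \<open>v\<close> is a Borel representative of \<open>w\<close>, extended by \<open>0\<close>.
\<close>

theorem AE_zero_if_test_zero:
  assumes w: "L2 M w" and z: "\<And>\<phi>. test_function \<Omega> \<phi> \<Longrightarrow> ip \<Omega> w \<phi> = 0"
  shows "AE x in M. w x = 0"
proof -
  have wi: "integrable M w" using L2_mult_integrable[OF w L2_continuous[of "\<lambda>_. 1"]] by simp
  define w0 where "w0 = (\<lambda>x. indicator \<Omega> x * w x)"
  have w0i: "integrable lebesgue w0"
    using wi op by (subst (asm) integrable_restrict_space) (auto simp: w0_def)
  then obtain v where v: "v \<in> borel_measurable lborel" "AE x in lborel. w0 x = v x"
    using completion_ex_borel_measurable_real[of w0 lborel] by auto
  then have vl: "AE x in lebesgue. w0 x = v x" by (simp add: AE_completion)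
  have "integrable lebesgue v"
    using w0i vl v(1) by (subst integrable_cong_AE[symmetric, of w0]) (auto intro: measurable_completion)
  then have vi: "integrable lborel v" using v(1) by (subst (asm) integrable_completion) auto
  have box0: "(\<integral>x. indicator (box a b) x * v x \<partial>lborel) = 0" if "cbox a b \<subseteq> \<Omega>" for a b
  proof -
    have "(\<lambda>k. \<integral>x. w x * box_bump a b k x \<partial>M) \<longlonglongrightarrow> (\<integral>x. w x * indicator (box a b) x \<partial>M)"
    proof (rule integral_dominated_convergence[where w = "\<lambda>x. \<bar>w x\<bar>"])
      show "(\<lambda>x. w x * indicator (box a b) x) \<in> borel_measurable M"
        by (intro borel_measurable_times L2_measurable[OF w] borel_measurable_lebesgue_on borel_measurable_indicator) simp
      show "(\<lambda>x. w x * box_bump a b k x) \<in> borel_measurable M" for k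
        using L2_measurable[OF w] L2_measurable[OF L2_smooth[OF smooth_box_bump[of a b k]]] by auto
      show "AE x in M. (\<lambda>k. w x * box_bump a b k x) \<longlonglongrightarrow> w x * indicator (box a b) x"
        by (intro AE_I2 tendsto_mult tendsto_const box_bump_tendsto)
      show "AE x in M. norm (w x * box_bump a b k x) \<le> \<bar>w x\<bar>" for k
        using box_bump_bounds[of a b k] by (intro AE_I2) (simp add: abs_mult mult_left_le)
    qed (use wi in auto)
    moreover have "(\<integral>x. w x * box_bump a b k x \<partial>M) = 0" for k
      using z[OF test_function_box_bump[OF that, of k]] by (simp add: ip_def)
    ultimately have "(\<integral>x. w x * indicator (box a b) x \<partial>M) = 0"
      by (simp add: LIMSEQ_const_iff)
    also have "(\<integral>x. w x * indicator (box a b) x \<partial>M) = (\<integral>x. indicator (box a b) x * w0 x \<partial>lebesgue)"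
      using op by (subst integral_restrict_space) (auto simp: w0_def mult_ac)
    also have "\<dots> = (\<integral>x. indicator (box a b) x * v x \<partial>lebesgue)"
    proof (rule integral_cong_AE)
      show "(\<lambda>x. indicator (box a b) x * w0 x) \<in> borel_measurable lebesgue"
        using w0i by (intro borel_measurable_times borel_measurable_indicator) auto
      show "(\<lambda>x. indicator (box a b) x * v x) \<in> borel_measurable lebesgue"
        using v(1) by (intro borel_measurable_times borel_measurable_indicator measurable_completion) auto
    qed (use vl in \<open>auto elim: eventually_mono\<close>)
    also have "\<dots> = (\<integral>x. indicator (box a b) x * v x \<partial>lborel)"
      using v(1) by (intro integral_completion) auto
    finally show ?thesis by simp
  qed
  have local: "AE x in lborel. x \<in> box a b \<longrightarrow> v x = 0" if ab: "cbox a b \<subseteq> \<Omega>" for a b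
  proof -
    have "AE x in lborel. indicator (box a b) x * v x = 0"
    proof (rule AE_zero_if_box_integrals_zero)
      show "integrable lborel (\<lambda>x. indicator (box a b) x * v x)"
        using v(1) by (intro Bochner_Integration.integrable_bound[OF vi]) (auto simp: indicator_def)
      fix c d
      obtain p q where pq: "box c d \<inter> box a b = box p q" "cbox p q \<subseteq> cbox a b \<or> box p q = {}"
      proof -
        let ?p = "\<Sum>i\<in>Basis. max (c \<bullet> i) (a \<bullet> i) *\<^sub>R i" and ?q = "\<Sum>i\<in>Basis. min (d \<bullet> i) (b \<bullet> i) *\<^sub>R i"
        have "box c d \<inter> box a b = box ?p ?q" by (rule box_Int_box)
        moreover have "cbox ?p ?q \<subseteq> cbox a b" by (auto simp: mem_box)
        ultimately show ?thesis using that by blast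
      qed
      have "(\<integral>x. indicator (box c d) x * (indicator (box a b) x * v x) \<partial>lborel) = (\<integral>x. indicator (box p q) x * v x \<partial>lborel)"
        unfolding pq(1)[symmetric] by (intro Bochner_Integration.integral_cong) (auto simp: indicator_def)
      also have "\<dots> = 0" using pq(2) box0[of p q] ab by auto
      finally show "(\<integral>x. indicator (box c d) x * (indicator (box a b) x * v x) \<partial>lborel) = 0" .
    qed
    then show ?thesis by eventually_elim (simp add: indicator_def)
  qed
  obtain D where D: "countable D" "D \<subseteq> Pow \<Omega>" "\<And>X. X \<in> D \<Longrightarrow> \<exists>a b. X = cbox a b" "\<Union>D = \<Omega>"
    using open_countable_Union_open_cbox[OF op] by metis
  have "AE x in lborel. x \<in> \<Omega> \<longrightarrow> v x = 0"
  proof -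
    have "AE x in lborel. x \<in> X \<longrightarrow> v x = 0" if X: "X \<in> D" for X
    proof -
      obtain a b where ab: "X = cbox a b" using D(3)[OF X] by blast
      have "negligible (cbox a b - box a b)" by (rule negligible_frontier_interval)
      then have "AE x in lebesgue. x \<notin> cbox a b - box a b"
        unfolding negligible_iff_null_sets by (rule AE_not_in)
      then have "AE x in lborel. x \<notin> cbox a b - box a b"
        by (subst (asm) AE_completion_iff) auto
      moreover have "AE x in lborel. x \<in> box a b \<longrightarrow> v x = 0" using local[of a b] D(2) X ab by auto
      ultimately show ?thesis unfolding ab by eventually_elim auto
    qed
    then have "AE x in lborel. \<forall>X\<in>D. x \<in> X \<longrightarrow> v x = 0" unfolding AE_ball_countable[OF D(1)] by blast
    then show ?thesis by eventually_elim (use D(4) in blast)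
  qed
  then have "AE x in lebesgue. x \<in> \<Omega> \<longrightarrow> v x = 0" by (rule AE_completion)
  with vl have "AE x in lebesgue. x \<in> \<Omega> \<longrightarrow> w x = 0"
    by eventually_elim (auto simp: w0_def)
  then show ?thesis using op by (subst AE_restrict_space_iff) auto
qed

lemma ip_real: "ip \<Omega> u v = (\<integral>x. u x * v x \<partial>M)" for u v :: "real^'n \<Rightarrow> real"
  by (simp add: ip_def)

lemma weak_derivative_unique:
  assumes "L2 M w" "weak_derivative \<Omega> \<beta> u w" "L2 M w'" "weak_derivative \<Omega> \<beta> u w'"
  shows "AE x in M. w x = w' x"
proof -
  obtain js where js: "mset js = \<beta>" using ex_mset by blast
  have "AE x in M. w x - w' x = 0"
  proof (rule AE_zero_if_test_zero)
    fix \<phi> assume t: "test_function \<Omega> \<phi>"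
    have \<phi>: "L2 M \<phi>" using t by (intro L2_smooth test_smooth)
    have "(-1) ^ size \<beta> * ip \<Omega> w \<phi> = (-1) ^ size \<beta> * ip \<Omega> w' \<phi>"
      using assms(2,4) t js unfolding weak_derivative_def by metis
    then have "ip \<Omega> w \<phi> = ip \<Omega> w' \<phi>" by simp
    then show "ip \<Omega> (\<lambda>x. w x - w' x) \<phi> = 0"
      using L2_mult_integrable[OF assms(1) \<phi>] L2_mult_integrable[OF assms(3) \<phi>]
      by (simp add: ip_real left_diff_distrib)
  qed (intro L2_diff assms)
  then show ?thesis by simp
qed

lemma wderiv_spec:
  assumes "\<exists>w. L2 M w \<and> weak_derivative \<Omega> \<beta> u w"
  shows "L2 M (wderiv \<Omega> \<beta> u)" "weak_derivative \<Omega> \<beta> u (wderiv \<Omega> \<beta> u)"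
  using someI_ex[OF assms] by (auto simp: wderiv_def)

lemma wderiv_eqI:
  assumes "L2 M w" "weak_derivative \<Omega> \<beta> u w"
  shows "L2 M (wderiv \<Omega> \<beta> u)" "AE x in M. wderiv \<Omega> \<beta> u x = w x"
proof -
  have ex: "\<exists>w. L2 M w \<and> weak_derivative \<Omega> \<beta> u w" using assms by blast
  show "L2 M (wderiv \<Omega> \<beta> u)" using wderiv_spec[OF ex] by blast
  show "AE x in M. wderiv \<Omega> \<beta> u x = w x"
    using weak_derivative_unique wderiv_spec[OF ex] assms by blast
qed

lemma weak_derivative_linear:
  assumes "L2 M u" "L2 M v" "L2 M w" "L2 M z" "weak_derivative \<Omega> \<beta> u w" "weak_derivative \<Omega> \<beta> v z"
  shows "weak_derivative \<Omega> \<beta> (\<lambda>x. a * u x + b * v x) (\<lambda>x. a * w x + b * z x)"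
proof -
  have lin: "ip \<Omega> (\<lambda>x. a * f x + b * g x) h = a * ip \<Omega> f h + b * ip \<Omega> g h"
    if "L2 M f" "L2 M g" "L2 M h" for f g h :: "real^'n \<Rightarrow> real"
    using L2_mult_integrable[OF that(1,3)] L2_mult_integrable[OF that(2,3)]
    by (simp add: ip_real distrib_right mult.assoc)
  show ?thesis
    unfolding weak_derivative_def
  proof (intro allI impI, elim conjE)
    fix \<phi> js assume t: "test_function \<Omega> \<phi>" and js: "mset js = \<beta>"
    have "ip \<Omega> u (partials js \<phi>) = (-1) ^ size \<beta> * ip \<Omega> w \<phi>" "ip \<Omega> v (partials js \<phi>) = (-1) ^ size \<beta> * ip \<Omega> z \<phi>"
      using assms(5,6) t js unfolding weak_derivative_def by blast+
    moreover have "L2 M \<phi>" "L2 M (partials js \<phi>)" using t by (auto intro: L2_smooth L2_partials test_smooth)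
    ultimately show "ip \<Omega> (\<lambda>x. a * u x + b * v x) (partials js \<phi>) = (-1) ^ size \<beta> * ip \<Omega> (\<lambda>x. a * w x + b * z x) \<phi>"
      using assms(1-4) by (simp add: lin algebra_simps)
  qed
qed

text \<open>
  A partial derivative of a test function is a test function, so a second weak derivative of \<open>u\<close> is
  a first weak derivative of \<open>v\<close>.
\<close>

lemma weak_derivative_iterate:
  assumes "weak_derivative \<Omega> {#i#} u v" "weak_derivative \<Omega> {#i, i#} u w"
  shows "weak_derivative \<Omega> {#i#} v w"
  unfolding weak_derivative_def
proof (intro allI impI, elim conjE)
  fix \<phi> js assume t: "test_function \<Omega> \<phi>" and "mset js = {#i#}"
  then have js: "js = [i]" by (simp add: mset_single_iff)
  have "ip \<Omega> u (partials [i] (partials [i] \<phi>)) = - ip \<Omega> v (partials [i] \<phi>)"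
    using assms(1) test_function_partial[OF t, of i] unfolding weak_derivative_def by fastforce
  moreover have "ip \<Omega> u (partials [i, i] \<phi>) = ip \<Omega> w \<phi>"
    using assms(2)[unfolded weak_derivative_def, rule_format, of \<phi> "[i, i]"] t by simp
  ultimately show "ip \<Omega> v (partials js \<phi>) = (-1) ^ size {#i#} * ip \<Omega> w \<phi>" using js by simp
qed

lemma gauss_green:
  assumes "\<And>x. ((\<lambda>s. f (x + s *\<^sub>R axis i 1)) has_real_derivative g x) (at 0)"
    "continuous_on UNIV f" "continuous_on UNIV g"
  shows "ennreal \<bar>\<integral>x. g x \<partial>M\<bar> \<le> (\<integral>\<^sup>+x. ennreal \<bar>f x\<bar> \<partial>surface_measure \<Omega>)"
  using gauss_green_bound[OF op bdd _ assms] assms(3)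
  by (simp add: axis_in_Basis_iff integral_lebesgue_on_open[OF op] borel_measurable_continuous_onI)

lemma gauss_green_product:
  assumes "smooth f" "smooth g"
  shows "ennreal \<bar>\<integral>x. partials [i] f x * g x + f x * partials [i] g x \<partial>M\<bar>
      \<le> (\<integral>\<^sup>+x. ennreal \<bar>f x * g x\<bar> \<partial>surface_measure \<Omega>)"
proof (rule gauss_green)
  fix x
  show "((\<lambda>s. f (x + s *\<^sub>R axis i 1) * g (x + s *\<^sub>R axis i 1)) has_real_derivative
      partials [i] f x * g x + f x * partials [i] g x) (at 0)"
    using DERIV_mult[OF smooth_directional[OF assms(1), of x i] smooth_directional[OF assms(2), of x i]]
    by (simp add: algebra_simps)
qed (intro continuous_intros smooth_continuous smooth_partials assms)+

text \<open>
  Integration by parts: the product with a test function vanishes on the boundary.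
\<close>

lemma weak_derivative_smooth:
  assumes f: "smooth f" shows "weak_derivative \<Omega> {#i#} f (partials [i] f)"
  unfolding weak_derivative_def
proof (intro allI impI, elim conjE)
  fix \<phi> js assume t: "test_function \<Omega> \<phi>" and "mset js = {#i#}"
  then have js: "js = [i]" by (simp add: mset_single_iff)
  have \<phi>: "smooth \<phi>" using t by (rule test_smooth)
  have "\<phi> x = 0" if "x \<in> frontier \<Omega>" for x
    using that t closure_subset[of "{x. \<phi> x \<noteq> 0}"] op unfolding test_function_def frontier_def
    by (auto simp: interior_open)
  then have "ennreal \<bar>f x * \<phi> x\<bar> * indicator (frontier \<Omega>) x = 0" for x
    by (cases "x \<in> frontier \<Omega>") simp_all
  then have "(\<integral>\<^sup>+x. ennreal \<bar>f x * \<phi> x\<bar> \<partial>surface_measure \<Omega>) = 0"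
    by (simp only: nn_integral_surface_measure nn_integral_const mult_zero_left)
  then have "(\<integral>x. partials [i] f x * \<phi> x + f x * partials [i] \<phi> x \<partial>M) = 0"
    using gauss_green_product[OF f \<phi>, of i] by simp
  moreover have "(\<integral>x. partials [i] f x * \<phi> x + f x * partials [i] \<phi> x \<partial>M)
      = (\<integral>x. partials [i] f x * \<phi> x \<partial>M) + (\<integral>x. f x * partials [i] \<phi> x \<partial>M)"
    by (intro Bochner_Integration.integral_add L2_mult_integrable L2_smooth smooth_partials f \<phi>)
  ultimately show "ip \<Omega> f (partials js \<phi>) = (-1) ^ size {#i#} * ip \<Omega> (partials [i] f) \<phi>"
    by (simp add: ip_real js del: partials.simps)
qed

end

section \<open>Traces and approximation by smooth functions\<close>

lemma null_comparison:
  fixes f g :: "nat \<Rightarrow> real"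
  assumes "\<And>j. \<bar>f j\<bar> \<le> g j" "g \<longlonglongrightarrow> 0" shows "f \<longlonglongrightarrow> 0"
  by (rule Lim_null_comparison[OF always_eventually assms(2)]) (use assms(1) in simp)

text \<open>
  Convergence in the square mean.
\<close>

definition L2_lim :: "'a measure \<Rightarrow> (nat \<Rightarrow> 'a \<Rightarrow> real) \<Rightarrow> ('a \<Rightarrow> real) \<Rightarrow> bool" where
  "L2_lim M f f0 \<longleftrightarrow> (\<forall>j. L2 M (f j)) \<and> L2 M f0 \<and> (\<lambda>j. \<integral>x. (f j x - f0 x)\<^sup>2 \<partial>M) \<longlonglongrightarrow> 0"

lemma L2_lim_const: "L2 M f \<Longrightarrow> L2_lim M (\<lambda>_. f) f"
  by (simp add: L2_lim_def)

lemma L2_lim_integral_mult: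
  assumes f: "L2_lim M f f0" and g: "L2_lim M g g0"
  shows "(\<lambda>j. \<integral>x. f j x * g j x \<partial>M) \<longlonglongrightarrow> (\<integral>x. f0 x * g0 x \<partial>M)"
proof -
  let ?n = "\<lambda>f. sqrt (\<integral>x. (f x)\<^sup>2 \<partial>M)"
  let ?F = "\<lambda>j x. f j x - f0 x" and ?G = "\<lambda>j x. g j x - g0 x"
  have L: "L2 M (f j)" "L2 M f0" "L2 M (g j)" "L2 M g0" "L2 M (?F j)" "L2 M (?G j)" for j
    using f g by (auto simp: L2_lim_def intro: L2_diff)
  have nF: "(\<lambda>j. ?n (?F j)) \<longlonglongrightarrow> 0" and nG: "(\<lambda>j. ?n (?G j)) \<longlonglongrightarrow> 0"
    using f g tendsto_real_sqrt[of _ 0] by (auto simp: L2_lim_def)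
  have bound: "\<bar>(\<integral>x. f j x * g j x \<partial>M) - (\<integral>x. f0 x * g0 x \<partial>M)\<bar> \<le> ?n (?F j) * ?n (?G j) + ?n (?F j) * ?n g0 + ?n f0 * ?n (?G j)" for j
  proof -
    note i = L2_mult_integrable[OF L(5)[of j] L(6)[of j]] L2_mult_integrable[OF L(5)[of j] L(4)] L2_mult_integrable[OF L(2) L(6)[of j]]
      L2_mult_integrable[OF L(1)[of j] L(3)[of j]] L2_mult_integrable[OF L(2) L(4)]
    have "(\<integral>x. f j x * g j x \<partial>M) - (\<integral>x. f0 x * g0 x \<partial>M) = (\<integral>x. ?F j x * ?G j x + ?F j x * g0 x + f0 x * ?G j x \<partial>M)"
      by (subst Bochner_Integration.integral_diff[OF i(4,5), symmetric]) (simp add: algebra_simps)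
    also have "\<dots> = (\<integral>x. ?F j x * ?G j x \<partial>M) + (\<integral>x. ?F j x * g0 x \<partial>M) + (\<integral>x. f0 x * ?G j x \<partial>M)"
      using i by (subst Bochner_Integration.integral_add, auto)+
    finally show ?thesis
      using L2_Cauchy_Schwarz[OF L(5)[of j] L(6)[of j]] L2_Cauchy_Schwarz[OF L(5)[of j] L(4)] L2_Cauchy_Schwarz[OF L(2) L(6)[of j]]
      by simp
  qed
  have "(\<lambda>j. ?n (?F j) * ?n (?G j) + ?n (?F j) * ?n g0 + ?n f0 * ?n (?G j)) \<longlonglongrightarrow> 0 * 0 + 0 * ?n g0 + ?n f0 * 0"
    by (intro tendsto_intros nF nG)
  then have "(\<lambda>j. ?n (?F j) * ?n (?G j) + ?n (?F j) * ?n g0 + ?n f0 * ?n (?G j)) \<longlonglongrightarrow> 0"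
    by (simp only: mult_zero_left mult_zero_right add_0_right)
  with bound have "(\<lambda>j. (\<integral>x. f j x * g j x \<partial>M) - (\<integral>x. f0 x * g0 x \<partial>M)) \<longlonglongrightarrow> 0"
    by (rule null_comparison)
  then show ?thesis by (rule LIM_zero_cancel)
qed

lemma L2_mult_bounded:
  assumes f: "L2 M f" and h: "h \<in> borel_measurable M" "\<And>x. x \<in> space M \<Longrightarrow> \<bar>h x\<bar> \<le> C"
  shows "L2 M (\<lambda>x. h x * f x)" "(\<integral>x. (h x * f x)\<^sup>2 \<partial>M) \<le> C\<^sup>2 * (\<integral>x. (f x)\<^sup>2 \<partial>M)"
proof -
  have le: "(h x * f x)\<^sup>2 \<le> C\<^sup>2 * (f x)\<^sup>2" if "x \<in> space M" for x
    using h(2)[OF that] by (metis abs_ge_zero power2_abs power_mono power_mult_distrib mult_right_mono zero_le_power2)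
  have m: "(\<lambda>x. h x * f x) \<in> borel_measurable M" by (intro borel_measurable_times h L2_measurable[OF f])
  have i: "integrable M (\<lambda>x. C\<^sup>2 * (f x)\<^sup>2)" using L2_square_integrable[OF f] by simp
  have i2: "integrable M (\<lambda>x. (h x * f x)\<^sup>2)"
    using m le by (intro Bochner_Integration.integrable_bound[OF i]) (auto intro!: AE_I2)
  then show "L2 M (\<lambda>x. h x * f x)" using m by (simp add: L2_def)
  have "(\<integral>x. (h x * f x)\<^sup>2 \<partial>M) \<le> (\<integral>x. C\<^sup>2 * (f x)\<^sup>2 \<partial>M)" using le by (intro integral_mono i i2) auto
  then show "(\<integral>x. (h x * f x)\<^sup>2 \<partial>M) \<le> C\<^sup>2 * (\<integral>x. (f x)\<^sup>2 \<partial>M)" by simp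
qed

lemma L2_lim_mult_bounded:
  assumes f: "L2_lim M f f0" and h: "h \<in> borel_measurable M" "\<And>x. x \<in> space M \<Longrightarrow> \<bar>h x\<bar> \<le> C"
  shows "L2_lim M (\<lambda>j x. h x * f j x) (\<lambda>x. h x * f0 x)"
proof -
  have L: "L2 M (f j)" "L2 M f0" "L2 M (\<lambda>x. f j x - f0 x)" for j using f by (auto simp: L2_lim_def intro: L2_diff)
  have "(\<lambda>j. C\<^sup>2 * (\<integral>x. (f j x - f0 x)\<^sup>2 \<partial>M)) \<longlonglongrightarrow> C\<^sup>2 * 0"
    using f by (intro tendsto_intros) (auto simp: L2_lim_def)
  then have "(\<lambda>j. C\<^sup>2 * (\<integral>x. (f j x - f0 x)\<^sup>2 \<partial>M)) \<longlonglongrightarrow> 0" by (simp only: mult_zero_right)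
  moreover have "\<bar>\<integral>x. (h x * f j x - h x * f0 x)\<^sup>2 \<partial>M\<bar> \<le> C\<^sup>2 * (\<integral>x. (f j x - f0 x)\<^sup>2 \<partial>M)" for j
    using L2_mult_bounded(2)[OF L(3)[of j] h]
    by (simp add: right_diff_distrib[symmetric])
  ultimately have "(\<lambda>j. \<integral>x. (h x * f j x - h x * f0 x)\<^sup>2 \<partial>M) \<longlonglongrightarrow> 0"
    by (rule null_comparison[rotated])
  then show ?thesis using L2_mult_bounded(1)[OF _ h] L by (simp add: L2_lim_def)
qed

lemma L2_lim_diff:
  assumes f: "L2_lim M f f0" and g: "L2_lim M g g0"
  shows "L2_lim M (\<lambda>j x. f j x - g j x) (\<lambda>x. f0 x - g0 x)"
proof -
  have L: "L2 M (f j)" "L2 M f0" "L2 M (g j)" "L2 M g0" for j using f g by (auto simp: L2_lim_def)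
  have "(\<lambda>j. 2 * (\<integral>x. (f j x - f0 x)\<^sup>2 \<partial>M) + 2 * (\<integral>x. (g j x - g0 x)\<^sup>2 \<partial>M)) \<longlonglongrightarrow> 2 * 0 + 2 * 0"
    using f g by (intro tendsto_intros) (auto simp: L2_lim_def)
  then have "(\<lambda>j. 2 * (\<integral>x. (f j x - f0 x)\<^sup>2 \<partial>M) + 2 * (\<integral>x. (g j x - g0 x)\<^sup>2 \<partial>M)) \<longlonglongrightarrow> 0"
    by (simp only: mult_zero_right add_0_right)
  moreover have "\<bar>\<integral>x. (f j x - g j x - (f0 x - g0 x))\<^sup>2 \<partial>M\<bar> \<le>
      2 * (\<integral>x. (f j x - f0 x)\<^sup>2 \<partial>M) + 2 * (\<integral>x. (g j x - g0 x)\<^sup>2 \<partial>M)" for j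
  proof -
    have i: "integrable M (\<lambda>x. (f j x - f0 x)\<^sup>2)" "integrable M (\<lambda>x. (g j x - g0 x)\<^sup>2)"
      "integrable M (\<lambda>x. (f j x - g j x - (f0 x - g0 x))\<^sup>2)"
      by (intro L2_square_integrable L2_diff L)+
    have "(\<integral>x. (f j x - g j x - (f0 x - g0 x))\<^sup>2 \<partial>M) \<le> (\<integral>x. 2 * (f j x - f0 x)\<^sup>2 + 2 * (g j x - g0 x)\<^sup>2 \<partial>M)"
    proof (rule integral_mono[OF i(3)])
      show "integrable M (\<lambda>x. 2 * (f j x - f0 x)\<^sup>2 + 2 * (g j x - g0 x)\<^sup>2)" using i by simp
      have "(a - b - (c - d))\<^sup>2 \<le> 2 * (a - c)\<^sup>2 + 2 * (b - d)\<^sup>2" for a b c d :: real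
        using zero_le_power2[of "(a - c) + (b - d)"] by (simp add: power2_eq_square algebra_simps)
      then show "(f j x - g j x - (f0 x - g0 x))\<^sup>2 \<le> 2 * (f j x - f0 x)\<^sup>2 + 2 * (g j x - g0 x)\<^sup>2" for x .
    qed
    also have "\<dots> = 2 * (\<integral>x. (f j x - f0 x)\<^sup>2 \<partial>M) + 2 * (\<integral>x. (g j x - g0 x)\<^sup>2 \<partial>M)"
      using i by (subst Bochner_Integration.integral_add) auto
    finally show ?thesis by (simp add: Bochner_Integration.integral_nonneg)
  qed
  ultimately have "(\<lambda>j. \<integral>x. (f j x - g j x - (f0 x - g0 x))\<^sup>2 \<partial>M) \<longlonglongrightarrow> 0"
    by (rule null_comparison[rotated])
  then show ?thesis using L by (auto simp: L2_lim_def intro: L2_diff)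
qed

lemma L2_lim_integral_square:
  "L2_lim M f f0 \<Longrightarrow> (\<lambda>j. \<integral>x. (f j x)\<^sup>2 \<partial>M) \<longlonglongrightarrow> (\<integral>x. (f0 x)\<^sup>2 \<partial>M)"
  using L2_lim_integral_mult[of M f f0 f f0] by (simp add: power2_eq_square)

lemma L2_lim_AE_subseq:
  assumes "L2_lim M f f0"
  obtains r :: "nat \<Rightarrow> nat" where "strict_mono r" "AE x in M. (\<lambda>j. f (r j) x) \<longlonglongrightarrow> f0 x"
proof -
  have "\<exists>r::nat \<Rightarrow> nat. strict_mono r \<and> (AE x in M. (\<lambda>j. (f (r j) x - f0 x)\<^sup>2) \<longlonglongrightarrow> 0)"
    using assms by (intro tendsto_L1_AE_subseq) (auto simp: L2_lim_def intro!: L2_square_integrable L2_diff)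
  then obtain r :: "nat \<Rightarrow> nat" where r: "strict_mono r" "AE x in M. (\<lambda>j. (f (r j) x - f0 x)\<^sup>2) \<longlonglongrightarrow> 0" by blast
  have "AE x in M. (\<lambda>j. f (r j) x) \<longlonglongrightarrow> f0 x"
    using r(2)
  proof eventually_elim
    case (elim x)
    then have "(\<lambda>j. sqrt ((f (r j) x - f0 x)\<^sup>2)) \<longlonglongrightarrow> sqrt 0" by (rule tendsto_real_sqrt)
    then have "(\<lambda>j. f (r j) x - f0 x) \<longlonglongrightarrow> 0" by (simp add: tendsto_rabs_zero_iff)
    then show ?case by (rule LIM_zero_cancel)
  qed
  with r(1) that show ?thesis by blast
qed

context bounded_open
begin

text \<open>
  The smooth functions \<open>\<phi> j\<close> tend to \<open>u\<close> and their gradients to \<open>g\<close> in \<open>L\<^sup>2(\<Omega>)\<close>, and their boundary values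
  tend to \<open>w\<close>. Thus \<open>w\<close> is the trace of \<open>u\<close>; the case \<open>w = 0\<close> is that of vanishing trace.
\<close>

definition smooth_approx :: "(nat \<Rightarrow> real^'n \<Rightarrow> real) \<Rightarrow> (real^'n \<Rightarrow> real) \<Rightarrow> ('n \<Rightarrow> real^'n \<Rightarrow> real) \<Rightarrow> (real^'n \<Rightarrow> real) \<Rightarrow> bool" where
  "smooth_approx \<phi> u g w \<longleftrightarrow> (\<forall>j. smooth (\<phi> j)) \<and> L2_lim M \<phi> u \<and> (\<forall>i. L2_lim M (\<lambda>j. partials [i] (\<phi> j)) (g i)) \<and>
     (\<lambda>j. \<integral>\<^sup>+x. ennreal ((\<phi> j x - w x)\<^sup>2) \<partial>surface_measure \<Omega>) \<longlonglongrightarrow> 0"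

lemma sobolev_D:
  assumes "sobolev \<Omega> r u" "int (size \<beta>) \<le> \<lfloor>r\<rfloor>"
  shows "L2 M (wderiv \<Omega> \<beta> u)" "weak_derivative \<Omega> \<beta> u (wderiv \<Omega> \<beta> u)"
proof -
  have "\<exists>w. L2 M w \<and> weak_derivative \<Omega> \<beta> u w" using assms unfolding sobolev_def by blast
  then show "L2 M (wderiv \<Omega> \<beta> u)" "weak_derivative \<Omega> \<beta> u (wderiv \<Omega> \<beta> u)" by (rule wderiv_spec)+
qed

lemma sobolev_L2: "sobolev \<Omega> r u \<Longrightarrow> L2 M u" by (simp add: sobolev_def)

lemma integral_square_cong_AE:
  assumes "L2 M f" "L2 M g" "AE x in M. f x = g x"
  shows "(\<integral>x. (f x)\<^sup>2 \<partial>M) = (\<integral>x. (g x)\<^sup>2 \<partial>M)"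
  using assms by (intro integral_cong_AE) (auto simp: L2_def elim: eventually_mono)

lemma sobolev_norm_1_bounds:
  assumes v: "L2 M v" and g: "\<And>i. L2 M (g i)" "\<And>i. weak_derivative \<Omega> {#i#} v (g i)"
  shows "(\<integral>x. (v x)\<^sup>2 \<partial>M) \<le> (sobolev_norm \<Omega> 1 v)\<^sup>2" "(\<integral>x. (g i x)\<^sup>2 \<partial>M) \<le> (sobolev_norm \<Omega> 1 v)\<^sup>2"
proof -
  have idx: "{\<beta> :: 'n multiset. int (size \<beta>) \<le> \<lfloor>1::real\<rfloor>} = insert {#} (range (\<lambda>i. {#i#}))"
  proof (intro equalityI subsetI)
    fix \<beta> :: "'n multiset" assume "\<beta> \<in> {\<beta>. int (size \<beta>) \<le> \<lfloor>1::real\<rfloor>}"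
    then have "size \<beta> = 0 \<or> size \<beta> = 1" by (simp add: le_Suc_eq)
    then show "\<beta> \<in> insert {#} (range (\<lambda>i. {#i#}))" using size_1_singleton_mset by fastforce
  qed auto
  have sq: "ip \<Omega> f f = (\<integral>x. (f x)\<^sup>2 \<partial>M)" for f :: "real^'n \<Rightarrow> real" by (simp add: ip_real power2_eq_square)
  have nn: "0 \<le> ip \<Omega> f f" for f :: "real^'n \<Rightarrow> real" unfolding sq by (rule Bochner_Integration.integral_nonneg) simp
  let ?S = "\<Sum>\<beta>\<in>insert {#} (range (\<lambda>i. {#i#})). ip \<Omega> (wderiv \<Omega> \<beta> v) (wderiv \<Omega> \<beta> v)"
  have S: "(sobolev_norm \<Omega> 1 v)\<^sup>2 = ?S"
    unfolding sobolev_norm_def idx using sum_nonneg[of "insert {#} (range (\<lambda>i. {#i#}))" "\<lambda>\<beta>. ip \<Omega> (wderiv \<Omega> \<beta> v) (wderiv \<Omega> \<beta> v)"] nn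
    by simp
  have le: "ip \<Omega> (wderiv \<Omega> \<beta> v) (wderiv \<Omega> \<beta> v) \<le> ?S" if "\<beta> \<in> insert {#} (range (\<lambda>i. {#i#}))" for \<beta>
    using that nn by (intro member_le_sum) auto
  have "weak_derivative \<Omega> {#} v v" by (simp add: weak_derivative_def)
  then have "(\<integral>x. (v x)\<^sup>2 \<partial>M) = ip \<Omega> (wderiv \<Omega> {#} v) (wderiv \<Omega> {#} v)"
    unfolding sq using wderiv_eqI[OF v, of "{#}" v] v by (intro integral_square_cong_AE[symmetric]) auto
  then show "(\<integral>x. (v x)\<^sup>2 \<partial>M) \<le> (sobolev_norm \<Omega> 1 v)\<^sup>2" using le[of "{#}"] S by simp
  have "(\<integral>x. (g i x)\<^sup>2 \<partial>M) = ip \<Omega> (wderiv \<Omega> {#i#} v) (wderiv \<Omega> {#i#} v)"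
    unfolding sq using wderiv_eqI[OF g(1)[of i] g(2)[of i]] g(1)[of i] by (intro integral_square_cong_AE[symmetric]) auto
  then show "(\<integral>x. (g i x)\<^sup>2 \<partial>M) \<le> (sobolev_norm \<Omega> 1 v)\<^sup>2" using le[of "{#i#}"] S by simp
qed

lemma has_trace_approx:
  assumes "has_trace \<Omega> u w"
  obtains \<phi> where "smooth_approx \<phi> u (\<lambda>i. wderiv \<Omega> {#i#} u) w"
proof -
  obtain \<phi> where sm: "\<And>j. smooth (\<phi> j)" and n: "(\<lambda>j. sobolev_norm \<Omega> 1 (\<lambda>x. \<phi> j x - u x)) \<longlonglongrightarrow> 0"
    and tr: "(\<lambda>j. \<integral>\<^sup>+x. ennreal ((\<phi> j x - w x)\<^sup>2) \<partial>surface_measure \<Omega>) \<longlonglongrightarrow> 0" and u: "sobolev \<Omega> 1 u"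
    using assms unfolding has_trace_def by blast
  let ?g = "\<lambda>i. wderiv \<Omega> {#i#} u"
  have g: "L2 M (?g i)" "weak_derivative \<Omega> {#i#} u (?g i)" for i using sobolev_D[OF u, of "{#i#}"] by auto
  have d: "weak_derivative \<Omega> {#i#} (\<lambda>x. \<phi> j x - u x) (\<lambda>x. partials [i] (\<phi> j) x - ?g i x)" for i j
    using weak_derivative_linear[OF L2_smooth[OF sm[of j]] sobolev_L2[OF u] L2_partials[OF sm[of j], of "[i]"] g(1)[of i]
      weak_derivative_smooth[OF sm] g(2)[of i], of 1 "-1"] by simp
  have Lv: "L2 M (\<lambda>x. \<phi> j x - u x)" and Ld: "L2 M (\<lambda>x. partials [i] (\<phi> j) x - ?g i x)" for i j
    by (intro L2_diff L2_smooth L2_partials sm sobolev_L2[OF u] g(1))+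
  note b = sobolev_norm_1_bounds[OF Lv Ld d]
  have n2: "(\<lambda>j. (sobolev_norm \<Omega> 1 (\<lambda>x. \<phi> j x - u x))\<^sup>2) \<longlonglongrightarrow> 0" using tendsto_power[OF n, of 2] by simp
  have "(\<lambda>j. \<integral>x. (\<phi> j x - u x)\<^sup>2 \<partial>M) \<longlonglongrightarrow> 0" "(\<lambda>j. \<integral>x. (partials [i] (\<phi> j) x - ?g i x)\<^sup>2 \<partial>M) \<longlonglongrightarrow> 0" for i
    by (rule null_comparison[OF _ n2]; use b in \<open>simp add: Bochner_Integration.integral_nonneg del: partials.simps\<close>)+
  then have "smooth_approx \<phi> u ?g w"
    unfolding smooth_approx_def L2_lim_def using sm tr sobolev_L2[OF u] g(1) by (auto intro: L2_smooth L2_partials simp del: partials.simps)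
  then show ?thesis by (rule that)
qed

lemma smooth_approx_D:
  assumes "smooth_approx \<phi> u g w"
  shows "smooth (\<phi> j)" "L2_lim M \<phi> u" "L2_lim M (\<lambda>j. partials [i] (\<phi> j)) (g i)"
    "(\<lambda>j. \<integral>\<^sup>+x. ennreal ((\<phi> j x - w x)\<^sup>2) \<partial>surface_measure \<Omega>) \<longlonglongrightarrow> 0" "L2 M u" "L2 M (g i)"
  using assms by (auto simp: smooth_approx_def L2_lim_def)

lemma surface_measurable [measurable (raw)]:
  "h \<in> borel_measurable borel \<Longrightarrow> h \<in> borel_measurable (surface_measure \<Omega>)"
  unfolding surface_measure_def by (intro measurable_restrict_space1) (simp add: measurable_def)

lemma ennreal_squeeze_null:
  fixes a :: "nat \<Rightarrow> real" and b :: "nat \<Rightarrow> ennreal"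
  assumes "\<And>j. ennreal \<bar>a j\<bar> \<le> b j" "b \<longlonglongrightarrow> 0" shows "a \<longlonglongrightarrow> 0"
proof -
  have "(\<lambda>j. ennreal \<bar>a j\<bar>) \<longlonglongrightarrow> 0"
    by (rule tendsto_sandwich[OF _ _ tendsto_const assms(2)]) (use assms(1) in auto)
  then have "(\<lambda>j. \<bar>a j\<bar>) \<longlonglongrightarrow> 0" using tendsto_ennreal_iff[of "\<lambda>j. \<bar>a j\<bar>" sequentially 0] by simp
  then show ?thesis by (simp add: tendsto_rabs_zero_iff)
qed

text \<open>
  The integral of \<open>\<partial>\<^sub>i(u\<^sup>2 \<psi>)\<close> vanishes if \<open>u\<close> has vanishing trace. Only \<open>u\<^sup>2\<close> occurs, because convergence
  of the traces in the square mean controls no higher power on the boundary.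
\<close>

lemma zero_trace_square:
  assumes a: "smooth_approx \<phi> u g (\<lambda>_. 0)"
    and d: "\<And>x. ((\<lambda>s. \<psi> (x + s *\<^sub>R axis i 1)) has_real_derivative \<psi>' x) (at 0)"
    and \<psi>: "continuous_on UNIV \<psi>" "continuous_on UNIV \<psi>'"
  shows "(\<integral>x. u x * (\<psi>' x * u x) \<partial>M) + 2 * (\<integral>x. g i x * (\<psi> x * u x) \<partial>M) = 0"
proof -
  note A = smooth_approx_D[OF a]
  obtain C where C: "\<And>x. x \<in> closure \<Omega> \<Longrightarrow> \<bar>\<psi> x\<bar> \<le> C" using bounded_continuous_on_bounded[OF bdd \<psi>(1)] by blast
  obtain C' where C': "\<And>x. x \<in> closure \<Omega> \<Longrightarrow> \<bar>\<psi>' x\<bar> \<le> C'" using bounded_continuous_on_bounded[OF bdd \<psi>(2)] by blast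
  have m: "\<psi> \<in> borel_measurable M" "\<psi>' \<in> borel_measurable M"
    by (intro borel_measurable_lebesgue_on borel_measurable_continuous_onI \<psi>)+
  have l1: "L2_lim M (\<lambda>j x. \<psi> x * \<phi> j x) (\<lambda>x. \<psi> x * u x)" and l2: "L2_lim M (\<lambda>j x. \<psi>' x * \<phi> j x) (\<lambda>x. \<psi>' x * u x)"
    by (rule L2_lim_mult_bounded[OF A(2) m(1), of C] L2_lim_mult_bounded[OF A(2) m(2), of C'];
        use C C' closure_subset[of \<Omega>] in auto)+
  let ?I = "\<lambda>j. (\<integral>x. \<phi> j x * (\<psi>' x * \<phi> j x) \<partial>M) + 2 * (\<integral>x. partials [i] (\<phi> j) x * (\<psi> x * \<phi> j x) \<partial>M)"
  have lim: "?I \<longlonglongrightarrow> (\<integral>x. u x * (\<psi>' x * u x) \<partial>M) + 2 * (\<integral>x. g i x * (\<psi> x * u x) \<partial>M)"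
    by (intro tendsto_intros L2_lim_integral_mult A l1 l2)
  have "ennreal \<bar>?I j\<bar> \<le> ennreal C * (\<integral>\<^sup>+x. ennreal ((\<phi> j x - 0)\<^sup>2) \<partial>surface_measure \<Omega>)" for j
  proof -
    have cj: "continuous_on UNIV (\<phi> j)" "continuous_on UNIV (partials [i] (\<phi> j))"
      by (intro smooth_continuous smooth_partials A)+
    have L: "L2 M (\<phi> j)" "L2 M (partials [i] (\<phi> j))" "L2 M (\<lambda>x. \<psi> x * \<phi> j x)" "L2 M (\<lambda>x. \<psi>' x * \<phi> j x)"
      using A(2,3) l1 l2 unfolding L2_lim_def by blast+
    have "?I j = (\<integral>x. \<phi> j x * (\<psi>' x * \<phi> j x) + 2 * (partials [i] (\<phi> j) x * (\<psi> x * \<phi> j x)) \<partial>M)"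
      using L2_mult_integrable[OF L(1,4)] L2_mult_integrable[OF L(2,3)]
      by (subst Bochner_Integration.integral_add) auto
    also have "ennreal \<bar>\<dots>\<bar> \<le> (\<integral>\<^sup>+x. ennreal \<bar>(\<phi> j x)\<^sup>2 * \<psi> x\<bar> \<partial>surface_measure \<Omega>)"
    proof (rule gauss_green)
      fix x
      have "((\<lambda>s. (\<phi> j (x + s *\<^sub>R axis i 1))\<^sup>2 * \<psi> (x + s *\<^sub>R axis i 1)) has_real_derivative
         2 * \<phi> j x * partials [i] (\<phi> j) x * \<psi> x + (\<phi> j x)\<^sup>2 * \<psi>' x) (at 0)"
        by (rule derivative_eq_intros smooth_directional[OF A(1)] d refl | simp)+
      then show "((\<lambda>s. (\<phi> j (x + s *\<^sub>R axis i 1))\<^sup>2 * \<psi> (x + s *\<^sub>R axis i 1)) has_real_derivative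
         \<phi> j x * (\<psi>' x * \<phi> j x) + 2 * (partials [i] (\<phi> j) x * (\<psi> x * \<phi> j x))) (at 0)"
        by (simp add: algebra_simps power2_eq_square)
    qed (intro continuous_intros cj \<psi>)+
    also have "\<dots> \<le> (\<integral>\<^sup>+x. ennreal C * ennreal ((\<phi> j x - 0)\<^sup>2) \<partial>surface_measure \<Omega>)"
      unfolding nn_integral_surface_measure
    proof (intro nn_integral_mono)
      fix x
      show "ennreal \<bar>(\<phi> j x)\<^sup>2 * \<psi> x\<bar> * indicator (frontier \<Omega>) x \<le> ennreal C * ennreal ((\<phi> j x - 0)\<^sup>2) * indicator (frontier \<Omega>) x"
      proof (cases "x \<in> frontier \<Omega>")
        case True
        then have b: "\<bar>\<psi> x\<bar> \<le> C" using C by (simp add: frontier_def)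
        then have "\<bar>(\<phi> j x)\<^sup>2 * \<psi> x\<bar> \<le> C * (\<phi> j x - 0)\<^sup>2" by (simp add: abs_mult mult.commute mult_right_mono)
        then have "ennreal \<bar>(\<phi> j x)\<^sup>2 * \<psi> x\<bar> \<le> ennreal C * ennreal ((\<phi> j x - 0)\<^sup>2)"
          using b by (subst ennreal_mult[symmetric]) (auto intro: ennreal_leI)
        then show ?thesis using True by simp
      qed simp
    qed
    also have "\<dots> = ennreal C * (\<integral>\<^sup>+x. ennreal ((\<phi> j x - 0)\<^sup>2) \<partial>surface_measure \<Omega>)"
      using borel_measurable_continuous_onI[OF cj(1)] by (intro nn_integral_cmult) auto
    finally show ?thesis .
  qed
  moreover have "(\<lambda>j. ennreal C * (\<integral>\<^sup>+x. ennreal ((\<phi> j x - 0)\<^sup>2) \<partial>surface_measure \<Omega>)) \<longlonglongrightarrow> ennreal C * 0"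
    by (intro ennreal_tendsto_cmult A) simp
  ultimately have "?I \<longlonglongrightarrow> 0" by (intro ennreal_squeeze_null) auto
  then show ?thesis using lim LIMSEQ_unique by blast
qed

lemma zero_trace_gradient:
  assumes a: "smooth_approx \<phi> u g (\<lambda>_. 0)" shows "(\<integral>x. u x * g i x \<partial>M) = 0"
  using zero_trace_square[OF a, of "\<lambda>_. 1" i "\<lambda>_. 0"] by (simp add: mult.commute)

text \<open>
  This is \<open>zero_trace_square\<close> for \<open>\<psi> = x\<^sub>i\<close>.
\<close>

lemma poincare:
  assumes a: "smooth_approx \<phi> u g (\<lambda>_. 0)" and R: "\<And>x. x \<in> \<Omega> \<Longrightarrow> norm x \<le> R" "0 \<le> R"
  shows "(\<integral>x. (u x)\<^sup>2 \<partial>M) \<le> 4 * R\<^sup>2 * (\<integral>x. (g i x)\<^sup>2 \<partial>M)"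
proof -
  note A = smooth_approx_D[OF a]
  let ?a = "\<integral>x. (u x)\<^sup>2 \<partial>M" and ?b = "\<integral>x. (g i x)\<^sup>2 \<partial>M"
  have nn: "0 \<le> ?a" "0 \<le> ?b" by (auto intro: Bochner_Integration.integral_nonneg)
  have "(\<integral>x. u x * (1 * u x) \<partial>M) + 2 * (\<integral>x. g i x * (x $ i * u x) \<partial>M) = 0"
    by (rule zero_trace_square[OF a]) (auto intro!: derivative_eq_intros continuous_intros)
  then have "?a = - 2 * (\<integral>x. g i x * (x $ i * u x) \<partial>M)" by (simp add: power2_eq_square)
  also have "\<dots> \<le> 2 * \<bar>\<integral>x. g i x * (x $ i * u x) \<partial>M\<bar>" by simp
  also have "\<dots> \<le> 2 * (sqrt ?b * sqrt (\<integral>x. (x $ i * u x)\<^sup>2 \<partial>M))"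
  proof -
    have m: "(\<lambda>x. x $ i) \<in> borel_measurable M" by (intro borel_measurable_lebesgue_on borel_measurable_continuous_onI continuous_intros)
    have b: "\<bar>x $ i\<bar> \<le> R" if "x \<in> space M" for x using component_le_norm_cart[of x i] R that by force
    show ?thesis using L2_Cauchy_Schwarz[OF A(6) L2_mult_bounded(1)[OF A(5) m b]] by simp
  qed
  also have "\<dots> \<le> 2 * (sqrt ?b * (R * sqrt ?a))"
  proof -
    have m: "(\<lambda>x. x $ i) \<in> borel_measurable M" by (intro borel_measurable_lebesgue_on borel_measurable_continuous_onI continuous_intros)
    have b: "\<bar>x $ i\<bar> \<le> R" if "x \<in> space M" for x using component_le_norm_cart[of x i] R that by force
    have "sqrt (\<integral>x. (x $ i * u x)\<^sup>2 \<partial>M) \<le> sqrt (R\<^sup>2 * ?a)"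
      using L2_mult_bounded(2)[OF A(5) m b] by (rule real_sqrt_le_mono)
    also have "\<dots> = R * sqrt ?a" using R by (simp add: real_sqrt_mult)
    finally show ?thesis using nn by (intro mult_left_mono) auto
  qed
  finally have "sqrt ?a * sqrt ?a \<le> (2 * R * sqrt ?b) * sqrt ?a" using nn by (simp add: mult_ac)
  then have "sqrt ?a \<le> 2 * R * sqrt ?b"
  proof (cases "?a = 0")
    case False
    then have "0 < sqrt ?a" using nn by (simp add: order_less_le)
    with \<open>sqrt ?a * sqrt ?a \<le> (2 * R * sqrt ?b) * sqrt ?a\<close> show ?thesis by (rule mult_right_le_imp_le)
  qed (use nn R in simp)
  then have "(sqrt ?a)\<^sup>2 \<le> (2 * R * sqrt ?b)\<^sup>2" using nn by (intro power_mono) auto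
  then show ?thesis using nn by (simp add: power_mult_distrib)
qed

text \<open>
  The product of the approximations of \<open>u\<close> and of \<open>\<partial>\<^sub>iu\<close> has boundary integral tending to \<open>0\<close>, because
  the former have vanishing and the latter bounded boundary values in the square mean.
\<close>

lemma gradient_laplacian:
  assumes a: "smooth_approx \<phi> u g (\<lambda>_. 0)" and b: "smooth_approx \<psi> (g i) z w" and w: "L2 (surface_measure \<Omega>) w"
  shows "(\<integral>x. (g i x)\<^sup>2 \<partial>M) = - (\<integral>x. u x * z i x \<partial>M)"
proof -
  note A = smooth_approx_D[OF a] note B = smooth_approx_D[OF b]
  let ?S = "surface_measure \<Omega>"
  let ?I = "\<lambda>j. (\<integral>x. partials [i] (\<phi> j) x * \<psi> j x \<partial>M) + (\<integral>x. \<phi> j x * partials [i] (\<psi> j) x \<partial>M)"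
  have lim: "?I \<longlonglongrightarrow> (\<integral>x. g i x * g i x \<partial>M) + (\<integral>x. u x * z i x \<partial>M)"
    by (intro tendsto_intros L2_lim_integral_mult A B)
  have meas: "\<phi> j \<in> borel_measurable ?S" "\<psi> j \<in> borel_measurable ?S" for j
    by (intro surface_measurable borel_measurable_continuous_onI smooth_continuous A B)+
  have wm: "w \<in> borel_measurable ?S" using w by (simp add: L2_def)
  let ?F = "\<lambda>j. \<integral>\<^sup>+x. ennreal ((\<phi> j x - 0)\<^sup>2) \<partial>?S" and ?G = "\<lambda>j. \<integral>\<^sup>+x. ennreal ((\<psi> j x - w x)\<^sup>2) \<partial>?S"
    and ?W = "\<integral>\<^sup>+x. ennreal ((w x)\<^sup>2) \<partial>?S"
  have W: "?W < top" using w by (simp add: L2_def integrable_iff_bounded less_top)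
  have "ennreal \<bar>(?I j)\<^sup>2\<bar> \<le> ?F j * (2 * ?W + 2 * ?G j)" for j
  proof -
    have "?I j = (\<integral>x. partials [i] (\<phi> j) x * \<psi> j x + \<phi> j x * partials [i] (\<psi> j) x \<partial>M)"
      by (intro Bochner_Integration.integral_add[symmetric] L2_mult_integrable L2_smooth smooth_partials A B)
    then have "ennreal \<bar>?I j\<bar> \<le> (\<integral>\<^sup>+x. ennreal \<bar>\<phi> j x * \<psi> j x\<bar> \<partial>?S)"
      using gauss_green_product[OF A(1)[of j] B(1)[of j], of i] by simp
    also have "\<dots> = (\<integral>\<^sup>+x. ennreal \<bar>\<phi> j x\<bar> * ennreal \<bar>\<psi> j x\<bar> \<partial>?S)" by (simp add: abs_mult ennreal_mult)
    finally have "(ennreal \<bar>?I j\<bar>)\<^sup>2 \<le> (\<integral>\<^sup>+x. ennreal \<bar>\<phi> j x\<bar> * ennreal \<bar>\<psi> j x\<bar> \<partial>?S)\<^sup>2" by (rule power_mono) simp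
    also have "\<dots> \<le> (\<integral>\<^sup>+x. (ennreal \<bar>\<phi> j x\<bar>)\<^sup>2 \<partial>?S) * (\<integral>\<^sup>+x. (ennreal \<bar>\<psi> j x\<bar>)\<^sup>2 \<partial>?S)"
      using meas[of j] by (intro Cauchy_Schwarz_nn_integral) auto
    also have "\<dots> = ?F j * (\<integral>\<^sup>+x. ennreal ((\<psi> j x)\<^sup>2) \<partial>?S)" by (simp add: ennreal_power)
    also have "(\<integral>\<^sup>+x. ennreal ((\<psi> j x)\<^sup>2) \<partial>?S) \<le> (\<integral>\<^sup>+x. 2 * ennreal ((w x)\<^sup>2) + 2 * ennreal ((\<psi> j x - w x)\<^sup>2) \<partial>?S)"
    proof (intro nn_integral_mono)
      fix x
      have "(\<psi> j x)\<^sup>2 \<le> 2 * (w x)\<^sup>2 + 2 * (\<psi> j x - w x)\<^sup>2"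
        using zero_le_power2[of "\<psi> j x - 2 * w x"] by (simp add: power2_eq_square algebra_simps)
      then have "ennreal ((\<psi> j x)\<^sup>2) \<le> ennreal (2 * (w x)\<^sup>2 + 2 * (\<psi> j x - w x)\<^sup>2)" by (rule ennreal_leI)
      then show "ennreal ((\<psi> j x)\<^sup>2) \<le> 2 * ennreal ((w x)\<^sup>2) + 2 * ennreal ((\<psi> j x - w x)\<^sup>2)"
        by (simp add: ennreal_mult)
    qed
    also have "\<dots> = 2 * ?W + 2 * ?G j"
      using meas[of j] wm by (simp add: nn_integral_add nn_integral_cmult)
    finally show ?thesis by (simp add: ennreal_power mult_left_mono)
  qed
  moreover have "(\<lambda>j. ?F j * (2 * ?W + 2 * ?G j)) \<longlonglongrightarrow> 0 * (2 * ?W + 2 * 0)"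
  proof (rule tendsto_mult_ennreal)
    show "?F \<longlonglongrightarrow> 0" by (rule A)
    show "(\<lambda>j. 2 * ?W + 2 * ?G j) \<longlonglongrightarrow> 2 * ?W + 2 * 0"
      by (intro tendsto_add tendsto_const ennreal_tendsto_cmult B) simp
  qed (use W in \<open>auto simp: ennreal_mult_eq_top_iff\<close>)
  ultimately have "(\<lambda>j. (?I j)\<^sup>2) \<longlonglongrightarrow> 0" by (intro ennreal_squeeze_null) auto
  moreover have "(\<lambda>j. (?I j)\<^sup>2) \<longlonglongrightarrow> ((\<integral>x. g i x * g i x \<partial>M) + (\<integral>x. u x * z i x \<partial>M))\<^sup>2"
    by (intro tendsto_power lim)
  ultimately have "((\<integral>x. g i x * g i x \<partial>M) + (\<integral>x. u x * z i x \<partial>M))\<^sup>2 = 0" using LIMSEQ_unique by blast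
  then show ?thesis by (simp add: power2_eq_square eq_neg_iff_add_eq_0)
qed

end

section \<open>Fourth powers of functions with vanishing trace\<close>

lemma partials_diff:
  assumes "smooth f" "smooth g"
  shows "partials is (\<lambda>x. f x - g x) = (\<lambda>x. partials is f x - partials is g x)"
proof (induction "is")
  case (Cons i "is")
  have "frechet_derivative (\<lambda>x. partials is f x - partials is g x) (at x) =
     (\<lambda>h. frechet_derivative (partials is f) (at x) h - frechet_derivative (partials is g) (at x) h)" for x
    using smooth_differentiable[OF smooth_partials[OF assms(1)]] smooth_differentiable[OF smooth_partials[OF assms(2)]]
    by (intro frechet_derivative_at[symmetric] has_derivative_diff) (simp_all add: frechet_derivative_works[symmetric])
  then show ?case using Cons by simp
qed simp

lemma smooth_diff:
  assumes "smooth f" "smooth g" shows "smooth (\<lambda>x. f x - g x)"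
  unfolding smooth_def partials_diff[OF assms]
  using assms unfolding smooth_def by (auto intro: differentiable_diff)

lemma nn_integral_lebesgue_on_open:
  fixes h :: "'a::euclidean_space \<Rightarrow> ennreal"
  assumes "open \<Omega>" and [measurable]: "h \<in> borel_measurable borel"
  shows "(\<integral>\<^sup>+x. h x \<partial>lebesgue_on \<Omega>) = (\<integral>\<^sup>+x. h x * indicator \<Omega> x \<partial>lborel)"
proof -
  have [measurable]: "\<Omega> \<in> sets borel" using assms by simp
  have "(\<integral>\<^sup>+x. h x \<partial>lebesgue_on \<Omega>) = (\<integral>\<^sup>+x. h x * indicator \<Omega> x \<partial>lebesgue)"
    by (rule nn_integral_restrict_space) auto
  also have "\<dots> = (\<integral>\<^sup>+x. h x * indicator \<Omega> x \<partial>lborel)" by (rule nn_integral_completion) 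
  finally show ?thesis .
qed

lemma L2_abs: "L2 M f \<Longrightarrow> L2 M (\<lambda>x. \<bar>f x\<bar>)" by (auto simp: L2_def)

lemma L2_Cauchy_Schwarz_abs:
  assumes "L2 M f" "L2 M g"
  shows "(\<integral>x. \<bar>f x * g x\<bar> \<partial>M) \<le> sqrt (\<integral>x. (f x)\<^sup>2 \<partial>M) * sqrt (\<integral>x. (g x)\<^sup>2 \<partial>M)"
  using L2_Cauchy_Schwarz[OF L2_abs[OF assms(1)] L2_abs[OF assms(2)]] by (simp add: abs_mult)

context bounded_open
begin

text \<open>
  The domain-dependent factor in Ladyzhenskaya's inequality; the volume only matters in one dimension.
\<close>

definition C4 :: real where "C4 = max 1 (measure lborel \<Omega>)"

lemma C4_ge_1: "1 \<le> C4" by (simp add: C4_def)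

lemma L4_smooth:
  assumes dim: "CARD('n) \<le> 2" and f: "smooth f" and B: "0 \<le> B" "(\<integral>\<^sup>+x. ennreal ((f x)\<^sup>2) \<partial>surface_measure \<Omega>) \<le> ennreal B"
  shows "(\<integral>\<^sup>+x. ennreal (f x ^ 4) \<partial>M) \<le>
    ennreal (C4 * (2 * (sqrt (\<integral>x. (f x)\<^sup>2 \<partial>M) * sqrt (\<Sum>i\<in>UNIV. \<integral>x. (partials [i] f x)\<^sup>2 \<partial>M)) + B)\<^sup>2)"
proof -
  let ?a = "\<integral>x. (f x)\<^sup>2 \<partial>M" and ?b = "\<Sum>i\<in>UNIV. \<integral>x. (partials [i] f x)\<^sup>2 \<partial>M"
  have [measurable]: "f \<in> borel_measurable borel" by (intro borel_measurable_continuous_onI smooth_continuous f)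
  have nn: "0 \<le> ?a" "0 \<le> (\<integral>x. (partials [i] f x)\<^sup>2 \<partial>M)" for i by (auto intro: Bochner_Integration.integral_nonneg)
  have "(\<integral>\<^sup>+x. ennreal (f x ^ 4) \<partial>M) = (\<integral>\<^sup>+x. ennreal (indicator \<Omega> x * f x ^ 4) \<partial>lborel)"
    by (subst nn_integral_lebesgue_on_open[OF op]) (auto intro!: nn_integral_cong simp: indicator_def)
  also have "\<dots> \<le> ennreal (max 1 (measure lborel \<Omega>) * (2 * (sqrt ?a * sqrt ?b) + B)\<^sup>2)"
  proof (rule ladyzhenskaya_boundary[OF op bdd, where g = "\<lambda>e x. frechet_derivative f (at x) e"])
    show "0 \<le> 2 * (sqrt ?a * sqrt ?b) + B" using nn B by (intro add_nonneg_nonneg mult_nonneg_nonneg) (auto intro: sum_nonneg)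
    fix e :: "real^'n" assume "e \<in> Basis"
    then obtain i where e: "e = axis i 1" by (auto simp: Basis_vec_def)
    have g: "(\<lambda>x. frechet_derivative f (at x) e) = partials [i] f" by (simp add: e)
    show "((\<lambda>s. f (x + s *\<^sub>R e)) has_real_derivative frechet_derivative f (at x) e) (at 0)" for x
      using smooth_directional[OF f, of x i] by (simp add: e)
    show "continuous_on UNIV (\<lambda>x. frechet_derivative f (at x) e)" unfolding g by (intro smooth_continuous smooth_partials f)
    have c: "continuous_on UNIV (\<lambda>x. 2 * \<bar>f x * partials [i] f x\<bar>)"
      by (intro continuous_intros smooth_continuous smooth_partials f)
    have "(\<integral>\<^sup>+p. ennreal (indicator \<Omega> p * (2 * \<bar>f p * partials [i] f p\<bar>)) \<partial>lborel) = ennreal (\<integral>p. indicator \<Omega> p * (2 * \<bar>f p * partials [i] f p\<bar>) \<partial>lborel)"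
      by (intro nn_integral_eq_integral integrable_indicator_continuous op bdd c) (auto simp: indicator_def)
    also have "(\<integral>p. indicator \<Omega> p * (2 * \<bar>f p * partials [i] f p\<bar>) \<partial>lborel) = 2 * (\<integral>p. \<bar>f p * partials [i] f p\<bar> \<partial>M)"
      by (subst integral_lebesgue_on_open[OF op, symmetric]) (intro borel_measurable_continuous_onI c, simp del: partials.simps)
    also have "\<dots> \<le> 2 * (sqrt ?a * sqrt (\<integral>x. (partials [i] f x)\<^sup>2 \<partial>M))"
      by (intro mult_left_mono L2_Cauchy_Schwarz_abs L2_smooth smooth_partials f) auto
    also have "\<dots> \<le> 2 * (sqrt ?a * sqrt ?b)"
      using nn by (intro mult_left_mono real_sqrt_le_mono member_le_sum) auto
    finally have "(\<integral>\<^sup>+p. ennreal (indicator \<Omega> p * (2 * \<bar>f p * partials [i] f p\<bar>)) \<partial>lborel) \<le> ennreal (2 * (sqrt ?a * sqrt ?b))"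
      by (simp add: ennreal_leI)
    then have "(\<integral>\<^sup>+p. ennreal (indicator \<Omega> p * (2 * \<bar>f p * partials [i] f p\<bar>)) \<partial>lborel)
      + (\<integral>\<^sup>+p. ennreal ((f p)\<^sup>2) \<partial>surface_measure \<Omega>) \<le> ennreal (2 * (sqrt ?a * sqrt ?b)) + ennreal B"
      by (rule add_mono[OF _ B(2)])
    also have "\<dots> = ennreal (2 * (sqrt ?a * sqrt ?b) + B)"
      using nn B by (intro ennreal_plus[symmetric] mult_nonneg_nonneg real_sqrt_ge_zero sum_nonneg) auto
    finally show "(\<integral>\<^sup>+p. ennreal (indicator \<Omega> p * (2 * \<bar>f p * frechet_derivative f (at p) e\<bar>)) \<partial>lborel)
      + (\<integral>\<^sup>+p. ennreal ((f p)\<^sup>2) \<partial>surface_measure \<Omega>) \<le> ennreal (2 * (sqrt ?a * sqrt ?b) + B)"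
      by (simp only: e partials.simps)
  qed (use dim smooth_continuous[OF f] in auto)
  finally show ?thesis by (simp add: C4_def)
qed

text \<open>
  Fatou's lemma along an almost everywhere convergent subsequence. The bound \<open>B\<close> for the boundary values
  is needed for sequences whose traces do not tend to \<open>0\<close>, see \<open>L4_convergence\<close>.
\<close>

lemma L4_limit:
  assumes dim: "CARD('n) \<le> 2" and f: "\<And>j. smooth (\<phi> j)" and u: "L2_lim M \<phi> u"
    and g: "\<And>i. L2_lim M (\<lambda>j. partials [i] (\<phi> j)) (g i)"
    and B: "0 \<le> B" "\<forall>\<^sub>F j in sequentially. (\<integral>\<^sup>+x. ennreal ((\<phi> j x)\<^sup>2) \<partial>surface_measure \<Omega>) \<le> ennreal B"
  shows "(\<integral>\<^sup>+x. ennreal (u x ^ 4) \<partial>M) \<le>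
    ennreal (C4 * (2 * (sqrt (\<integral>x. (u x)\<^sup>2 \<partial>M) * sqrt (\<Sum>i\<in>UNIV. \<integral>x. (g i x)\<^sup>2 \<partial>M)) + B)\<^sup>2)"
proof -
  obtain r :: "nat \<Rightarrow> nat" where r: "strict_mono r" and ae: "AE x in M. (\<lambda>j. \<phi> (r j) x) \<longlonglongrightarrow> u x"
    using L2_lim_AE_subseq[OF u] by blast
  let ?X = "\<lambda>j. C4 * (2 * (sqrt (\<integral>x. (\<phi> j x)\<^sup>2 \<partial>M) * sqrt (\<Sum>i\<in>UNIV. \<integral>x. (partials [i] (\<phi> j) x)\<^sup>2 \<partial>M)) + B)\<^sup>2"
  let ?Y = "C4 * (2 * (sqrt (\<integral>x. (u x)\<^sup>2 \<partial>M) * sqrt (\<Sum>i\<in>UNIV. \<integral>x. (g i x)\<^sup>2 \<partial>M)) + B)\<^sup>2"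
  have X: "?X \<longlonglongrightarrow> ?Y"
    by (intro tendsto_intros L2_lim_integral_square u g)
  have "(\<integral>\<^sup>+x. ennreal (u x ^ 4) \<partial>M) = (\<integral>\<^sup>+x. liminf (\<lambda>j. ennreal (\<phi> (r j) x ^ 4)) \<partial>M)"
  proof (rule nn_integral_cong_AE)
    show "AE x in M. ennreal (u x ^ 4) = liminf (\<lambda>j. ennreal (\<phi> (r j) x ^ 4))"
      using ae by eventually_elim (auto intro!: lim_imp_Liminf[symmetric] tendsto_ennrealI tendsto_power)
  qed
  also have "\<dots> \<le> liminf (\<lambda>j. \<integral>\<^sup>+x. ennreal (\<phi> (r j) x ^ 4) \<partial>M)"
    using L2_measurable[OF L2_smooth[OF f]] by (intro nn_integral_liminf) auto
  also have "\<dots> \<le> liminf (\<lambda>j. ennreal (?X (r j)))"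
  proof (rule Liminf_mono)
    have "\<forall>\<^sub>F j in sequentially. (\<integral>\<^sup>+x. ennreal ((\<phi> (r j) x)\<^sup>2) \<partial>surface_measure \<Omega>) \<le> ennreal B"
      using B(2) r eventually_subseq by blast
    then show "\<forall>\<^sub>F j in sequentially. (\<integral>\<^sup>+x. ennreal (\<phi> (r j) x ^ 4) \<partial>M) \<le> ennreal (?X (r j))"
      by eventually_elim (intro L4_smooth dim f B)
  qed
  also have "\<dots> = ennreal ?Y"
    using LIMSEQ_subseq_LIMSEQ[OF X r] by (intro lim_imp_Liminf tendsto_ennrealI) (auto simp: o_def)
  finally show ?thesis .
qed

lemma L2_square:
  assumes "L2 M u" "(\<integral>\<^sup>+x. ennreal (u x ^ 4) \<partial>M) \<le> ennreal c" "0 \<le> c"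
  shows "L2 M (\<lambda>x. (u x)\<^sup>2)" "(\<integral>x. ((u x)\<^sup>2)\<^sup>2 \<partial>M) \<le> c"
proof -
  have m: "u \<in> borel_measurable M" using assms(1) by (rule L2_measurable)
  have "(\<integral>\<^sup>+x. ennreal (norm (((u x)\<^sup>2)\<^sup>2)) \<partial>M) \<le> ennreal c" using assms(2) by simp
  then have i: "integrable M (\<lambda>x. ((u x)\<^sup>2)\<^sup>2)"
    using m by (intro integrableI_bounded) (auto intro: le_less_trans)
  then show "L2 M (\<lambda>x. (u x)\<^sup>2)" using m by (simp add: L2_def)
  have "ennreal (\<integral>x. ((u x)\<^sup>2)\<^sup>2 \<partial>M) = (\<integral>\<^sup>+x. ennreal (((u x)\<^sup>2)\<^sup>2) \<partial>M)"
    using i by (intro nn_integral_eq_integral[symmetric]) auto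
  also have "\<dots> \<le> ennreal c" using assms(2) by simp
  finally show "(\<integral>x. ((u x)\<^sup>2)\<^sup>2 \<partial>M) \<le> c" using assms(3) by simp
qed

theorem ladyzhenskaya:
  assumes dim: "CARD('n) \<le> 2" and a: "smooth_approx \<phi> u g (\<lambda>_. 0)"
  shows "L2 M (\<lambda>x. (u x)\<^sup>2)"
    "(\<integral>x. ((u x)\<^sup>2)\<^sup>2 \<partial>M) \<le> 4 * C4 * (\<integral>x. (u x)\<^sup>2 \<partial>M) * (\<Sum>i\<in>UNIV. \<integral>x. (g i x)\<^sup>2 \<partial>M)"
proof -
  note A = smooth_approx_D[OF a]
  let ?a = "\<integral>x. (u x)\<^sup>2 \<partial>M" and ?b = "\<Sum>i\<in>UNIV. \<integral>x. (g i x)\<^sup>2 \<partial>M"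
  let ?Y = "\<lambda>B. C4 * (2 * (sqrt ?a * sqrt ?b) + B)\<^sup>2"
  have nn: "0 \<le> ?a" "0 \<le> ?b" by (auto intro!: Bochner_Integration.integral_nonneg sum_nonneg)
  have Y0: "0 \<le> ?Y B" for B using C4_ge_1 by (intro mult_nonneg_nonneg) auto
  have bound: "(\<integral>\<^sup>+x. ennreal (u x ^ 4) \<partial>M) \<le> ennreal (?Y B)" if B: "0 < B" for B
  proof (rule L4_limit[OF dim A(1,2,3)])
    have "\<forall>\<^sub>F j in sequentially. (\<integral>\<^sup>+x. ennreal ((\<phi> j x - 0)\<^sup>2) \<partial>surface_measure \<Omega>) < ennreal B"
      using A(4) B by (intro order_tendstoD(2)[of _ 0]) auto
    then show "\<forall>\<^sub>F j in sequentially. (\<integral>\<^sup>+x. ennreal ((\<phi> j x)\<^sup>2) \<partial>surface_measure \<Omega>) \<le> ennreal B"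
      by eventually_elim simp
  qed (use B in auto)
  show "L2 M (\<lambda>x. (u x)\<^sup>2)" using L2_square[OF A(5) bound[of 1] Y0] by simp
  have "(\<lambda>k. ?Y (1 / real (Suc k))) \<longlonglongrightarrow> ?Y 0"
    by (intro tendsto_intros LIMSEQ_Suc[OF lim_inverse_n'])
  moreover have "(\<integral>x. ((u x)\<^sup>2)\<^sup>2 \<partial>M) \<le> ?Y (1 / real (Suc k))" for k
    by (rule L2_square(2)[OF A(5) bound Y0]) simp
  ultimately have "(\<integral>x. ((u x)\<^sup>2)\<^sup>2 \<partial>M) \<le> ?Y 0" by (intro LIMSEQ_le_const) auto
  also have "?Y 0 = 4 * C4 * ?a * ?b" using nn by (simp add: power_mult_distrib)
  finally show "(\<integral>x. ((u x)\<^sup>2)\<^sup>2 \<partial>M) \<le> 4 * C4 * ?a * ?b" .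
qed

text \<open>
  The smooth approximations of a function with vanishing trace converge in \<open>L\<^sup>4(\<Omega>)\<close> as well: \<open>L4_limit\<close>
  applies to the sequence \<open>\<phi> l - \<phi> j\<close> in \<open>j\<close>. Integrals here are real-valued and therefore default to \<open>0\<close>
  where integrability fails, which can only happen for finitely many \<open>l\<close>.
\<close>

lemma L4_convergence:
  assumes dim: "CARD('n) \<le> 2" and a: "smooth_approx \<phi> u g (\<lambda>_. 0)"
  shows "\<forall>\<^sub>F l in sequentially. L2 M (\<lambda>x. (\<phi> l x - u x)\<^sup>2)" "(\<lambda>l. \<integral>x. ((\<phi> l x - u x)\<^sup>2)\<^sup>2 \<partial>M) \<longlonglongrightarrow> 0"
proof -
  note A = smooth_approx_D[OF a]
  let ?S = "surface_measure \<Omega>"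
  let ?F = "\<lambda>j. \<integral>\<^sup>+x. ennreal ((\<phi> j x)\<^sup>2) \<partial>?S"
  have F: "?F \<longlonglongrightarrow> 0" using A(4) by simp
  define B where "B = (\<lambda>l. 2 * enn2real (?F l) + 2 / real (Suc l))"
  let ?Y = "\<lambda>l. C4 * (2 * (sqrt (\<integral>x. (\<phi> l x - u x)\<^sup>2 \<partial>M) * sqrt (\<Sum>i\<in>UNIV. \<integral>x. (partials [i] (\<phi> l) x - g i x)\<^sup>2 \<partial>M)) + B l)\<^sup>2"
  have Y0: "0 \<le> ?Y l" for l using C4_ge_1 by (intro mult_nonneg_nonneg) auto
  have Ld: "L2 M (\<lambda>x. \<phi> l x - u x)" for l by (intro L2_diff L2_smooth A)
  have meas: "\<phi> j \<in> borel_measurable ?S" for j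
    by (intro surface_measurable borel_measurable_continuous_onI smooth_continuous A)
  have fin: "\<forall>\<^sub>F l in sequentially. ?F l < top" using order_tendstoD(2)[OF F] by simp
  have bound: "(\<integral>\<^sup>+x. ennreal ((\<phi> l x - u x) ^ 4) \<partial>M) \<le> ennreal (?Y l)" if l: "?F l < top" for l
  proof (rule L4_limit[OF dim, where \<phi> = "\<lambda>j x. \<phi> l x - \<phi> j x"])
    show "smooth (\<lambda>x. \<phi> l x - \<phi> j x)" for j by (intro smooth_diff A)
    show "L2_lim M (\<lambda>j x. \<phi> l x - \<phi> j x) (\<lambda>x. \<phi> l x - u x)"
      by (intro L2_lim_diff L2_lim_const L2_smooth A)
    show "L2_lim M (\<lambda>j. partials [i] (\<lambda>x. \<phi> l x - \<phi> j x)) (\<lambda>x. partials [i] (\<phi> l) x - g i x)" for i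
      unfolding partials_diff[OF A(1) A(1)] by (intro L2_lim_diff L2_lim_const L2_partials A)
    show "0 \<le> B l" by (simp add: B_def)
    have "\<forall>\<^sub>F j in sequentially. ?F j < ennreal (1 / real (Suc l))" by (intro order_tendstoD(2)[OF F]) simp
    then show "\<forall>\<^sub>F j in sequentially. (\<integral>\<^sup>+x. ennreal ((\<phi> l x - \<phi> j x)\<^sup>2) \<partial>?S) \<le> ennreal (B l)"
    proof eventually_elim
      case (elim j)
      have "(\<integral>\<^sup>+x. ennreal ((\<phi> l x - \<phi> j x)\<^sup>2) \<partial>?S) \<le> (\<integral>\<^sup>+x. 2 * ennreal ((\<phi> l x)\<^sup>2) + 2 * ennreal ((\<phi> j x)\<^sup>2) \<partial>?S)"
      proof (intro nn_integral_mono)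
        fix x
        have "(\<phi> l x - \<phi> j x)\<^sup>2 \<le> 2 * (\<phi> l x)\<^sup>2 + 2 * (\<phi> j x)\<^sup>2"
          using zero_le_power2[of "\<phi> l x + \<phi> j x"] by (simp add: power2_eq_square algebra_simps)
        then have "ennreal ((\<phi> l x - \<phi> j x)\<^sup>2) \<le> ennreal (2 * (\<phi> l x)\<^sup>2 + 2 * (\<phi> j x)\<^sup>2)" by (rule ennreal_leI)
        then show "ennreal ((\<phi> l x - \<phi> j x)\<^sup>2) \<le> 2 * ennreal ((\<phi> l x)\<^sup>2) + 2 * ennreal ((\<phi> j x)\<^sup>2)"
          by (simp add: ennreal_mult)
      qed
      also have "\<dots> = 2 * ?F l + 2 * ?F j"
        using meas[of l] meas[of j] by (simp add: nn_integral_add nn_integral_cmult)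
      also have "\<dots> \<le> 2 * ennreal (enn2real (?F l)) + 2 * ennreal (1 / real (Suc l))"
        using elim l by (intro add_mono mult_left_mono) (auto intro: less_imp_le)
      also have "\<dots> = ennreal (2 * enn2real (?F l)) + ennreal (2 * (1 / real (Suc l)))"
        by (simp only: ennreal_mult enn2real_nonneg ennreal_numeral zero_le_numeral zero_le_divide_1_iff of_nat_0_le_iff)
      also have "\<dots> = ennreal (B l)"
        unfolding B_def by (subst ennreal_plus[symmetric]) auto
      finally show ?case .
    qed
  qed
  show "\<forall>\<^sub>F l in sequentially. L2 M (\<lambda>x. (\<phi> l x - u x)\<^sup>2)"
    using fin by eventually_elim (rule L2_square(1)[OF Ld bound Y0])
  have B0: "B \<longlonglongrightarrow> 0"
  proof -
    have "(\<lambda>l. enn2real (?F l)) \<longlonglongrightarrow> 0" using tendsto_enn2real[of ?F 0 sequentially] F by simp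
    then have "(\<lambda>l. 2 * enn2real (?F l) + 2 * (1 / real (Suc l))) \<longlonglongrightarrow> 2 * 0 + 2 * 0"
      by (rule tendsto_add[OF tendsto_mult[OF tendsto_const] tendsto_mult[OF tendsto_const LIMSEQ_Suc[OF lim_inverse_n']]])
    then show ?thesis by (simp add: B_def)
  qed
  have "?Y \<longlonglongrightarrow> C4 * (2 * (sqrt 0 * sqrt (\<Sum>i\<in>(UNIV::'n set). 0)) + 0)\<^sup>2"
    using A(2,3) by (intro tendsto_intros B0) (auto simp: L2_lim_def simp del: partials.simps)
  then have Y: "?Y \<longlonglongrightarrow> 0" by simp
  show "(\<lambda>l. \<integral>x. ((\<phi> l x - u x)\<^sup>2)\<^sup>2 \<partial>M) \<longlonglongrightarrow> 0"
  proof (rule Lim_null_comparison[OF _ Y])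
    show "\<forall>\<^sub>F l in sequentially. norm (\<integral>x. ((\<phi> l x - u x)\<^sup>2)\<^sup>2 \<partial>M) \<le> ?Y l"
      using fin
    proof eventually_elim
      case (elim l)
      have "0 \<le> (\<integral>x. ((\<phi> l x - u x)\<^sup>2)\<^sup>2 \<partial>M)" by (rule Bochner_Integration.integral_nonneg) simp
      then show ?case using L2_square(2)[OF Ld bound[OF elim] Y0] by simp
    qed
  qed
qed

text \<open>
  By \<open>zero_trace_square\<close> with \<open>\<psi> = \<phi> l\<close>, the integral of \<open>u\<^sup>2 \<partial>\<^sub>i(\<phi> l) + 2 u \<partial>\<^sub>iu (\<phi> l)\<close> vanishes. Convergence
  in \<open>L\<^sup>4(\<Omega>)\<close> makes it tend to three times the integral of \<open>u\<^sup>2 \<partial>\<^sub>iu\<close>.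
\<close>

lemma zero_trace_cubic:
  assumes dim: "CARD('n) \<le> 2" and a: "smooth_approx \<phi> u g (\<lambda>_. 0)"
  shows "(\<integral>x. (u x)\<^sup>2 * g i x \<partial>M) = 0"
proof -
  note A = smooth_approx_D[OF a]
  have u2: "L2 M (\<lambda>x. (u x)\<^sup>2)" by (rule ladyzhenskaya[OF dim a])
  have \<phi>u: "L2 M (\<lambda>x. \<phi> l x * u x)" for l
  proof -
    obtain C where C: "\<And>x. x \<in> closure \<Omega> \<Longrightarrow> \<bar>\<phi> l x\<bar> \<le> C"
      using bounded_continuous_on_bounded[OF bdd smooth_continuous[OF A(1)]] by metis
    show ?thesis
      by (rule L2_mult_bounded(1)[OF A(5), of _ C]) (use C closure_subset[of \<Omega>] in \<open>auto intro!: L2_measurable L2_smooth A\<close>)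
  qed
  have "L2_lim M (\<lambda>l x. \<phi> l x * u x) (\<lambda>x. (u x)\<^sup>2)"
    unfolding L2_lim_def
  proof (intro conjI allI \<phi>u u2)
    let ?d = "\<lambda>l. \<integral>x. ((\<phi> l x - u x)\<^sup>2)\<^sup>2 \<partial>M" and ?c = "\<integral>x. ((u x)\<^sup>2)\<^sup>2 \<partial>M"
    have "(\<lambda>l. sqrt (?d l) * sqrt ?c) \<longlonglongrightarrow> sqrt 0 * sqrt ?c"
      by (intro tendsto_intros L4_convergence[OF dim a])
    then have lim: "(\<lambda>l. sqrt (?d l) * sqrt ?c) \<longlonglongrightarrow> 0" by simp
    show "(\<lambda>l. \<integral>x. (\<phi> l x * u x - (u x)\<^sup>2)\<^sup>2 \<partial>M) \<longlonglongrightarrow> 0"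
    proof (rule Lim_null_comparison[OF _ lim])
      show "\<forall>\<^sub>F l in sequentially. norm (\<integral>x. (\<phi> l x * u x - (u x)\<^sup>2)\<^sup>2 \<partial>M) \<le> sqrt (?d l) * sqrt ?c"
        using L4_convergence(1)[OF dim a]
      proof eventually_elim
        case (elim l)
        have "(\<phi> l x * u x - (u x)\<^sup>2)\<^sup>2 = (\<phi> l x - u x)\<^sup>2 * (u x)\<^sup>2" for x
          by (simp add: power_mult_distrib[symmetric] power2_eq_square algebra_simps)
        then show ?case using L2_Cauchy_Schwarz[OF elim u2] by simp
      qed
    qed
  qed
  note lu = this
  let ?I = "\<lambda>l. (\<integral>x. partials [i] (\<phi> l) x * (u x)\<^sup>2 \<partial>M) + 2 * (\<integral>x. g i x * (\<phi> l x * u x) \<partial>M)"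
  have "?I \<longlonglongrightarrow> (\<integral>x. g i x * (u x)\<^sup>2 \<partial>M) + 2 * (\<integral>x. g i x * (u x)\<^sup>2 \<partial>M)"
    by (intro tendsto_intros L2_lim_integral_mult L2_lim_const u2 lu A)
  moreover have "?I l = 0" for l
  proof -
    have "(\<integral>x. u x * (partials [i] (\<phi> l) x * u x) \<partial>M) + 2 * (\<integral>x. g i x * (\<phi> l x * u x) \<partial>M) = 0"
      by (rule zero_trace_square[OF a smooth_directional[OF A(1)]]) (intro smooth_continuous smooth_partials A)+
    moreover have "u x * (partials [i] (\<phi> l) x * u x) = partials [i] (\<phi> l) x * (u x)\<^sup>2" for x
      by (simp only: power2_eq_square mult.left_commute mult.commute)
    ultimately show ?thesis by (simp only:)
  qed
  ultimately have "(\<integral>x. g i x * (u x)\<^sup>2 \<partial>M) = 0" by (simp add: LIMSEQ_const_iff)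
  then show ?thesis by (simp add: mult.commute)
qed

subsection \<open>Functions with vanishing trace and normal derivative\<close>

lemma wlap_L2: assumes "sobolev \<Omega> 2 u" shows "L2 M (wlap \<Omega> u)"
  unfolding wlap_def[abs_def] by (intro L2_sum sobolev_D[OF assms]) auto

lemma H02_approx:
  assumes "H02 \<Omega> u"
  obtains \<phi> where "smooth_approx \<phi> u (\<lambda>i. wderiv \<Omega> {#i#} u) (\<lambda>_. 0)"
  using assms has_trace_approx unfolding H02_def by metis

lemma H02_green:
  assumes u: "H02 \<Omega> u"
  shows "(\<Sum>i\<in>UNIV. \<integral>x. (wderiv \<Omega> {#i#} u x)\<^sup>2 \<partial>M) = - (\<integral>x. u x * wlap \<Omega> u x \<partial>M)"
proof -
  have s: "sobolev \<Omega> 2 u" using u by (simp add: H02_def)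
  obtain \<phi> where a: "smooth_approx \<phi> u (\<lambda>i. wderiv \<Omega> {#i#} u) (\<lambda>_. 0)" using H02_approx[OF u] .
  obtain w :: "real^'n \<Rightarrow> real^'n" where w: "\<And>i. has_trace \<Omega> (wderiv \<Omega> {#i#} u) (\<lambda>x. w x $ i)"
    using u unfolding H02_def by blast
  have d2: "L2 M (wderiv \<Omega> {#i, i#} u)" "weak_derivative \<Omega> {#i, i#} u (wderiv \<Omega> {#i, i#} u)" for i
    using sobolev_D[OF s, of "{#i, i#}"] by auto
  have d1: "weak_derivative \<Omega> {#i#} u (wderiv \<Omega> {#i#} u)" for i using sobolev_D[OF s, of "{#i#}"] by auto
  have "(\<integral>x. (wderiv \<Omega> {#i#} u x)\<^sup>2 \<partial>M) = - (\<integral>x. u x * wderiv \<Omega> {#i, i#} u x \<partial>M)" for i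
  proof -
    obtain \<psi> where b: "smooth_approx \<psi> (wderiv \<Omega> {#i#} u) (\<lambda>k. wderiv \<Omega> {#k#} (wderiv \<Omega> {#i#} u)) (\<lambda>x. w x $ i)"
      using has_trace_approx[OF w] .
    have "L2 (surface_measure \<Omega>) (\<lambda>x. w x $ i)" using w[of i] by (simp add: has_trace_def)
    note gradient_laplacian[OF a b this]
    also have "(\<integral>x. u x * wderiv \<Omega> {#i#} (wderiv \<Omega> {#i#} u) x \<partial>M) = (\<integral>x. u x * wderiv \<Omega> {#i, i#} u x \<partial>M)"
    proof (rule integral_cong_AE)
      note e = wderiv_eqI[OF d2(1) weak_derivative_iterate[OF d1 d2(2)], of i]
      show "AE x in M. u x * wderiv \<Omega> {#i#} (wderiv \<Omega> {#i#} u) x = u x * wderiv \<Omega> {#i, i#} u x"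
        using e(2) by eventually_elim simp
      show "(\<lambda>x. u x * wderiv \<Omega> {#i#} (wderiv \<Omega> {#i#} u) x) \<in> borel_measurable M"
        "(\<lambda>x. u x * wderiv \<Omega> {#i, i#} u x) \<in> borel_measurable M"
        by (intro borel_measurable_times L2_measurable e(1) d2 sobolev_L2[OF s])+
    qed
    finally show ?thesis .
  qed
  then have "(\<Sum>i\<in>UNIV. \<integral>x. (wderiv \<Omega> {#i#} u x)\<^sup>2 \<partial>M) = - (\<Sum>i\<in>UNIV. \<integral>x. u x * wderiv \<Omega> {#i, i#} u x \<partial>M)"
    by (simp add: sum_negf)
  also have "(\<Sum>i\<in>UNIV. \<integral>x. u x * wderiv \<Omega> {#i, i#} u x \<partial>M) = (\<integral>x. (\<Sum>i\<in>UNIV. u x * wderiv \<Omega> {#i, i#} u x) \<partial>M)"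
    by (rule Bochner_Integration.integral_sum[symmetric]) (intro L2_mult_integrable d2 sobolev_L2[OF s])
  finally show ?thesis by (simp add: wlap_def sum_distrib_left)
qed

end

section \<open>Zeros of outward pointing vector fields\<close>

text \<open>
  The \<open>p\<close>-dimensional unit sphere. Vectors are sequences vanishing from index \<open>p + 1\<close> on, so that the
  dimension may be an arbitrary number in a proof.
\<close>

definition coordinate_sphere :: "nat \<Rightarrow> (nat \<Rightarrow> real) set" where
  "coordinate_sphere p = {x. (\<Sum>i\<le>p. (x i)\<^sup>2) = 1 \<and> (\<forall>i>p. x i = 0)}"

lemma not_contractible_coordinate_sphere: "\<not> contractible (coordinate_sphere p)"
  using non_contractible_space_nsphere[of p]
  by (simp add: nsphere coordinate_sphere_def euclidean_product_topology)

text \<open>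
  The projection of the first \<open>p + 1\<close> coordinates to the sphere.
\<close>

definition normalize_upto :: "nat \<Rightarrow> (nat \<Rightarrow> real) \<Rightarrow> nat \<Rightarrow> real" where
  "normalize_upto p v i = (if i \<le> p then v i / sqrt (\<Sum>k\<le>p. (v k)\<^sup>2) else 0)"

lemma sum_squares_pos:
  fixes v :: "nat \<Rightarrow> real"
  assumes "\<exists>i\<le>p. v i \<noteq> 0" shows "0 < (\<Sum>k\<le>p. (v k)\<^sup>2)"
proof -
  obtain i where "i \<le> p" "v i \<noteq> 0" using assms by blast
  then show ?thesis by (intro sum_pos2[of "{..p}" i]) auto
qed

lemma normalize_upto_in_sphere:
  assumes "\<exists>i\<le>p. v i \<noteq> 0" shows "normalize_upto p v \<in> coordinate_sphere p"
proof -
  have pos: "0 < (\<Sum>k\<le>p. (v k)\<^sup>2)" by (rule sum_squares_pos[OF assms])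
  have "(\<Sum>i\<le>p. (normalize_upto p v i)\<^sup>2) = (\<Sum>i\<le>p. (v i)\<^sup>2 / (\<Sum>k\<le>p. (v k)\<^sup>2))"
    using pos by (intro sum.cong) (auto simp: normalize_upto_def power_divide)
  also have "\<dots> = 1" using pos by (simp add: sum_divide_distrib[symmetric])
  finally show ?thesis by (simp add: coordinate_sphere_def normalize_upto_def)
qed

lemma normalize_upto_sphere:
  assumes "x \<in> coordinate_sphere p" shows "normalize_upto p x = x"
  using assms by (auto simp: normalize_upto_def coordinate_sphere_def fun_eq_iff)

lemma homotopic_on_sphere:
  fixes K :: "real \<Rightarrow> (nat \<Rightarrow> real) \<Rightarrow> nat \<Rightarrow> real"
  assumes cont: "\<And>i. i \<le> p \<Longrightarrow> continuous_on ({0..1} \<times> coordinate_sphere p) (\<lambda>z. K (fst z) (snd z) i)"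
    and nz: "\<And>t x. t \<in> {0..1} \<Longrightarrow> x \<in> coordinate_sphere p \<Longrightarrow> \<exists>i\<le>p. K t x i \<noteq> 0"
  shows "homotopic_with_canon (\<lambda>_. True) (coordinate_sphere p) (coordinate_sphere p)
     (\<lambda>x. normalize_upto p (K 0 x)) (\<lambda>x. normalize_upto p (K 1 x))"
proof -
  let ?h = "\<lambda>z. normalize_upto p (K (fst z) (snd z))"
  have "continuous_on ({0..1} \<times> coordinate_sphere p) ?h"
  proof (rule continuous_on_coordinatewise_then_product)
    fix i
    show "continuous_on ({0..1} \<times> coordinate_sphere p) (\<lambda>z. ?h z i)"
    proof (cases "i \<le> p")
      case True
      have "sqrt (\<Sum>k\<le>p. (K (fst z) (snd z) k)\<^sup>2) \<noteq> 0" if "z \<in> {0..1} \<times> coordinate_sphere p" for z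
        using sum_squares_pos[OF nz[of "fst z" "snd z"]] that by auto
      then have "continuous_on ({0..1} \<times> coordinate_sphere p) (\<lambda>z. K (fst z) (snd z) i / sqrt (\<Sum>k\<le>p. (K (fst z) (snd z) k)\<^sup>2))"
        using True cont by (intro continuous_intros) auto
      then show ?thesis using True by (simp add: normalize_upto_def)
    qed (simp add: normalize_upto_def)
  qed
  moreover have "?h ` ({0..1} \<times> coordinate_sphere p) \<subseteq> coordinate_sphere p"
    using nz normalize_upto_in_sphere by force
  ultimately show ?thesis
    unfolding homotopic_with_def by (intro exI[of _ ?h]) (auto simp: image_subset_iff)
qed

text \<open>
  Without a zero, the normalized field would be homotopic on the sphere to the identity, by the segments
  from \<open>x\<close> to \<open>F (R x)\<close>, and to a constant, by shrinking the sphere to the origin.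
\<close>

theorem outward_field_has_zero:
  fixes F :: "(nat \<Rightarrow> real) \<Rightarrow> nat \<Rightarrow> real"
  assumes R: "0 < R" and cont: "\<And>i. i < N \<Longrightarrow> continuous_on UNIV (\<lambda>c. F c i)"
    and pos: "\<And>c. (\<Sum>i<N. (c i)\<^sup>2) = R\<^sup>2 \<Longrightarrow> (\<And>i. N \<le> i \<Longrightarrow> c i = 0) \<Longrightarrow> 0 < (\<Sum>i<N. F c i * c i)"
  shows "\<exists>c. \<forall>i<N. F c i = 0"
proof (cases N)
  case (Suc p)
  then have N: "{..<N} = {..p}" by (simp add: lessThan_Suc_atMost)
  let ?S = "coordinate_sphere p"
  show ?thesis
  proof (rule ccontr)
    assume no: "\<not> ?thesis"
    then have nz: "\<exists>i\<le>p. F c i \<noteq> 0" for c using Suc by (metis less_Suc_eq_le)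
    have comp: "continuous_on UNIV (\<lambda>x::nat \<Rightarrow> real. x i)" for i by simp
    have coord: "continuous_on (A :: (real \<times> (nat \<Rightarrow> real)) set) (\<lambda>z. snd z i)" for A i
      by (rule continuous_on_compose2[OF comp continuous_on_snd[OF continuous_on_id]]) simp
    have fst': "continuous_on (A :: (real \<times> (nat \<Rightarrow> real)) set) fst" for A
      by (rule continuous_on_fst[OF continuous_on_id])
    have scale: "continuous_on (A :: (real \<times> (nat \<Rightarrow> real)) set) (\<lambda>z i. fst z * R * snd z i)" for A
      by (rule continuous_on_coordinatewise_then_product)
         (intro continuous_on_mult continuous_on_const coord fst')
    have scale1: "continuous_on (A :: (real \<times> (nat \<Rightarrow> real)) set) (\<lambda>z i. R * snd z i)" for A
      by (rule continuous_on_coordinatewise_then_product)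
         (intro continuous_on_mult continuous_on_const coord)
    have Fs: "continuous_on A (\<lambda>z::real \<times> (nat \<Rightarrow> real). F (\<lambda>i. R * snd z i) i)" if "i \<le> p" for A i
      by (rule continuous_on_compose2[OF cont scale1]) (use that Suc in auto)
    let ?K1 = "\<lambda>t x i. (1 - t) * x i + t * F (\<lambda>i. R * x i) i" and ?K2 = "\<lambda>t x i. F (\<lambda>i. t * R * x i) i"
    have h1: "homotopic_with_canon (\<lambda>_. True) ?S ?S (\<lambda>x. normalize_upto p (?K1 0 x)) (\<lambda>x. normalize_upto p (?K1 1 x))"
    proof (rule homotopic_on_sphere)
      fix i assume "i \<le> p"
      then show "continuous_on ({0..1} \<times> ?S) (\<lambda>z. ?K1 (fst z) (snd z) i)"
        by (intro continuous_on_add continuous_on_mult continuous_on_diff continuous_on_const coord fst' Fs)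
    next
      fix t :: real and x assume t: "t \<in> {0..1}" and x: "x \<in> ?S"
      have "(\<Sum>i<N. (R * x i)\<^sup>2) = R\<^sup>2"
        unfolding N using x by (simp add: coordinate_sphere_def power_mult_distrib sum_distrib_left[symmetric])
      then have "0 < (\<Sum>i<N. F (\<lambda>i. R * x i) i * (R * x i))"
        using x Suc by (intro pos) (auto simp: coordinate_sphere_def)
      also have "\<dots> = R * (\<Sum>i\<le>p. F (\<lambda>i. R * x i) i * x i)"
        by (simp add: N sum_distrib_left mult_ac)
      finally have p: "0 < (\<Sum>i\<le>p. F (\<lambda>i. R * x i) i * x i)" using R by (simp add: zero_less_mult_iff)
      have "(\<Sum>i\<le>p. ?K1 t x i * x i) = (1 - t) * (\<Sum>i\<le>p. (x i)\<^sup>2) + t * (\<Sum>i\<le>p. F (\<lambda>i. R * x i) i * x i)"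
        by (simp add: sum_distrib_left sum.distrib distrib_right power2_eq_square mult.assoc)
      also have "\<dots> = (1 - t) + t * (\<Sum>i\<le>p. F (\<lambda>i. R * x i) i * x i)" using x by (simp add: coordinate_sphere_def)
      also have "\<dots> > 0"
        using t p by (cases "t = 1") (auto intro!: add_pos_nonneg mult_nonneg_nonneg)
      finally have "(\<Sum>i\<le>p. ?K1 t x i * x i) \<noteq> 0" by simp
      then show "\<exists>i\<le>p. ?K1 t x i \<noteq> 0" by (metis (no_types, lifting) atMost_iff mult_zero_left sum.neutral)
    qed
    have h2: "homotopic_with_canon (\<lambda>_. True) ?S ?S (\<lambda>x. normalize_upto p (?K2 0 x)) (\<lambda>x. normalize_upto p (?K2 1 x))"
    proof (rule homotopic_on_sphere)
      fix i assume "i \<le> p"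
      then show "continuous_on ({0..1} \<times> ?S) (\<lambda>z. ?K2 (fst z) (snd z) i)"
        by (intro continuous_on_compose2[OF cont scale]) (use Suc in auto)
    qed (use nz in auto)
    have eq: "(\<lambda>x. normalize_upto p (?K2 1 x)) = (\<lambda>x. normalize_upto p (?K1 1 x))" by simp
    have "homotopic_with_canon (\<lambda>_. True) ?S ?S (\<lambda>x. normalize_upto p (?K1 0 x)) (\<lambda>x. normalize_upto p (?K2 0 x))"
      by (rule homotopic_with_trans[OF h1 homotopic_with_symD[OF h2[unfolded eq]]])
    then have "homotopic_with_canon (\<lambda>_. True) ?S ?S id (\<lambda>x. normalize_upto p (F (\<lambda>i. 0)))"
      by (rule homotopic_with_eq) (auto simp: normalize_upto_sphere)
    then have "contractible ?S" unfolding contractible_def by blast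
    then show False using not_contractible_coordinate_sphere by blast
  qed
qed simp

section \<open>Spaces of functions with a semi-inner product\<close>

text \<open>
  Linearity of a functional on a set of functions closed under linear combinations.
\<close>

definition linear_on :: "('a \<Rightarrow> real) set \<Rightarrow> (('a \<Rightarrow> real) \<Rightarrow> real) \<Rightarrow> bool" where
  "linear_on V \<Phi> \<longleftrightarrow> (\<forall>u\<in>V. \<forall>v\<in>V. \<forall>a b. \<Phi> (\<lambda>x. a * u x + b * v x) = a * \<Phi> u + b * \<Phi> v)"

lemma linear_onD: "linear_on V \<Phi> \<Longrightarrow> u \<in> V \<Longrightarrow> v \<in> V \<Longrightarrow> \<Phi> (\<lambda>x. a * u x + b * v x) = a * \<Phi> u + b * \<Phi> v"
  by (simp add: linear_on_def)

text \<open>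
  A linear space of functions.
\<close>

locale function_space =
  fixes V :: "('a \<Rightarrow> real) set"
  assumes zero: "(\<lambda>_. 0) \<in> V"
    and comb: "\<And>u v a b. u \<in> V \<Longrightarrow> v \<in> V \<Longrightarrow> (\<lambda>x. a * u x + b * v x) \<in> V"
begin

lemma sum_in: "(\<And>l. l < n \<Longrightarrow> e l \<in> V) \<Longrightarrow> (\<lambda>x. \<Sum>l<n. c l * e l x) \<in> V" for n :: nat
proof (induction n)
  case (Suc n)
  then have "(\<lambda>x. 1 * (\<Sum>l<n. c l * e l x) + c n * e n x) \<in> V" by (intro comb) auto
  then show ?case by simp
qed (simp add: zero)

lemma linear_on_zero: assumes "linear_on V \<Phi>" shows "\<Phi> (\<lambda>_. 0) = 0"
  using linear_onD[OF assms zero zero, of 0 0] by simp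

lemma linear_on_sum:
  fixes n :: nat
  assumes "linear_on V \<Phi>"
  shows "(\<And>l. l < n \<Longrightarrow> e l \<in> V) \<Longrightarrow> \<Phi> (\<lambda>x. \<Sum>l<n. c l * e l x) = (\<Sum>l<n. c l * \<Phi> (e l))"
proof (induction n)
  case (Suc n)
  have "\<Phi> (\<lambda>x. 1 * (\<Sum>l<n. c l * e l x) + c n * e n x) = 1 * \<Phi> (\<lambda>x. \<Sum>l<n. c l * e l x) + c n * \<Phi> (e n)"
    using Suc.prems by (intro linear_onD[OF assms] sum_in) auto
  then show ?case using Suc by simp
qed (simp add: linear_on_zero[OF assms])

lemma diff_in: "u \<in> V \<Longrightarrow> v \<in> V \<Longrightarrow> (\<lambda>x. u x - v x) \<in> V"
  using comb[of u v 1 "-1"] by simp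

lemma add_in: "u \<in> V \<Longrightarrow> v \<in> V \<Longrightarrow> (\<lambda>x. u x + v x) \<in> V"
  using comb[of u v 1 1] by simp

lemma linear_on_diff: "linear_on V \<Phi> \<Longrightarrow> u \<in> V \<Longrightarrow> v \<in> V \<Longrightarrow> \<Phi> (\<lambda>x. u x - v x) = \<Phi> u - \<Phi> v"
  using linear_onD[of V \<Phi> u v 1 "-1"] by simp

lemma linear_on_add: "linear_on V \<Phi> \<Longrightarrow> u \<in> V \<Longrightarrow> v \<in> V \<Longrightarrow> \<Phi> (\<lambda>x. u x + v x) = \<Phi> u + \<Phi> v"
  using linear_onD[of V \<Phi> u v 1 1] by simp

end

text \<open>
  The form \<open>A\<close> is only semi-definite, since distinct functions may agree almost everywhere.
\<close>

locale semi_inner_space = function_space +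
  fixes A :: "('a \<Rightarrow> real) \<Rightarrow> ('a \<Rightarrow> real) \<Rightarrow> real"
  assumes lin: "\<And>w. w \<in> V \<Longrightarrow> linear_on V (\<lambda>u. A u w)"
    and sym: "\<And>u v. u \<in> V \<Longrightarrow> v \<in> V \<Longrightarrow> A u v = A v u"
    and nonneg: "\<And>u. u \<in> V \<Longrightarrow> 0 \<le> A u u"
begin

lemma lin2: assumes "w \<in> V" shows "linear_on V (A w)"
  unfolding linear_on_def
proof (intro ballI allI)
  fix u v a b assume uv: "u \<in> V" "v \<in> V"
  have "A w (\<lambda>x. a * u x + b * v x) = A (\<lambda>x. a * u x + b * v x) w" using assms uv by (intro sym comb)
  also have "\<dots> = a * A u w + b * A v w" by (rule linear_onD[OF lin[OF assms] uv])
  finally show "A w (\<lambda>x. a * u x + b * v x) = a * A w u + b * A w v" using sym assms uv by simp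
qed

lemma quadratic:
  assumes "u \<in> V" "v \<in> V"
  shows "A (\<lambda>x. a * u x + b * v x) (\<lambda>x. a * u x + b * v x) = a\<^sup>2 * A u u + 2 * a * b * A u v + b\<^sup>2 * A v v"
  using linear_onD[OF lin[OF comb[OF assms]] assms, of a b a b] linear_onD[OF lin2[OF assms(1)] assms, of a b]
    linear_onD[OF lin2[OF assms(2)] assms, of a b] sym[OF assms]
  by (simp add: algebra_simps power2_eq_square)

lemma Cauchy_Schwarz:
  assumes u: "u \<in> V" and v: "v \<in> V" shows "\<bar>A u v\<bar> \<le> sqrt (A u u) * sqrt (A v v)"
proof -
  have pos: "0 \<le> t\<^sup>2 * A u u + 2 * t * A u v + A v v" for t
    using quadratic[OF u v, of t 1] nonneg[OF comb[OF u v, of t 1]] by simp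
  have "(A u v)\<^sup>2 \<le> A u u * A v v"
  proof (cases "A u u = 0")
    case True
    have "A u v = 0"
    proof (rule ccontr)
      assume "A u v \<noteq> 0"
      then show False using pos[of "- (A v v + 1) / (2 * A u v)"] True by (simp add: field_simps)
    qed
    then show ?thesis using True by simp
  next
    case False
    have "(- A u v / A u u)\<^sup>2 * A u u + 2 * (- A u v / A u u) * A u v + A v v = A v v - (A u v)\<^sup>2 / A u u"
      using False by (simp add: power2_eq_square)
    then have "(A u v)\<^sup>2 / A u u \<le> A v v" using pos[of "- A u v / A u u"] by simp
    moreover have "0 < A u u" using False nonneg[OF u] by linarith
    ultimately show ?thesis by (simp only: pos_divide_le_eq mult.commute)
  qed
  then have "sqrt ((A u v)\<^sup>2) \<le> sqrt (A u u * A v v)" by (rule real_sqrt_le_mono)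
  then show ?thesis by (simp add: real_sqrt_mult)
qed

lemma null_orthogonal: "u \<in> V \<Longrightarrow> v \<in> V \<Longrightarrow> A u u = 0 \<Longrightarrow> A u v = 0"
  using Cauchy_Schwarz[of u v] by simp

lemma triangle:
  assumes u: "u \<in> V" and v: "v \<in> V"
  shows "sqrt (A (\<lambda>x. u x + v x) (\<lambda>x. u x + v x)) \<le> sqrt (A u u) + sqrt (A v v)"
proof (rule real_le_lsqrt)
  show "A (\<lambda>x. u x + v x) (\<lambda>x. u x + v x) \<le> (sqrt (A u u) + sqrt (A v v))\<^sup>2"
    using quadratic[OF u v, of 1 1] Cauchy_Schwarz[OF u v] nonneg[OF u] nonneg[OF v] by (simp add: power2_sum)
qed (use nonneg u v in auto)

text \<open>
  Gram-Schmidt orthogonalization, dropping the null vectors. The last conjunct says that each generator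
  \<open>b\<close> is its orthogonal expansion up to a null vector.
\<close>

lemma orthonormal_system:
  assumes "finite B" "B \<subseteq> V"
  shows "\<exists>(N::nat) e. (\<forall>l<N. e l \<in> V) \<and> (\<forall>l<N. \<forall>m<N. A (e l) (e m) = (if l = m then 1 else 0)) \<and>
     (\<forall>b\<in>B. \<forall>w\<in>V. A b w = (\<Sum>l<N. A b (e l) * A (e l) w))"
  using assms
proof (induction B rule: finite_induct)
  case empty
  show ?case by (intro exI[of _ 0]) auto
next
  case (insert b B)
  then obtain N :: nat and e where IH: "\<forall>l<N. e l \<in> V"
    "\<forall>l<N. \<forall>m<N. A (e l) (e m) = (if l = m then 1 else 0)"
    "\<forall>v\<in>B. \<forall>w\<in>V. A v w = (\<Sum>l<N. A v (e l) * A (e l) w)"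
    by blast
  have e: "\<And>l. l < N \<Longrightarrow> e l \<in> V"
    and orth: "\<And>l m. l < N \<Longrightarrow> m < N \<Longrightarrow> A (e l) (e m) = (if l = m then 1 else 0)"
    and rep: "\<And>v w. v \<in> B \<Longrightarrow> w \<in> V \<Longrightarrow> A v w = (\<Sum>l<N. A v (e l) * A (e l) w)"
    using IH by blast+
  have b: "b \<in> V" and B: "B \<subseteq> V" using insert.prems by auto
  let ?s = "\<lambda>x. \<Sum>l<N. A b (e l) * e l x"
  define r where "r = (\<lambda>x. b x - ?s x)"
  have s: "?s \<in> V" by (intro sum_in e)
  have r: "r \<in> V" unfolding r_def by (rule diff_in[OF b s])
  have Ar: "A r w = A b w - (\<Sum>l<N. A b (e l) * A (e l) w)" if "w \<in> V" for w
    unfolding r_def using linear_on_diff[OF lin[OF that] b s] linear_on_sum[OF lin[OF that], of N e "\<lambda>l. A b (e l)"] e by simp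
  have re: "A r (e m) = 0" if "m < N" for m
    using that orth by (simp add: Ar[OF e[OF that]] if_distrib[of "\<lambda>t. _ * t"] cong: if_cong)
  show ?case
  proof (cases "A r r = 0")
    case True
    then have "A b w = (\<Sum>l<N. A b (e l) * A (e l) w)" if "w \<in> V" for w
      using null_orthogonal[OF r that] Ar[OF that] by simp
    then show ?thesis using IH by blast
  next
    case False
    define \<sigma> where "\<sigma> = sqrt (A r r)"
    have \<sigma>: "\<sigma> > 0" "\<sigma> * \<sigma> = A r r" using False nonneg[OF r] by (auto simp: \<sigma>_def)
    define q where "q = (\<lambda>x. 1 / \<sigma> * r x + 0 * r x)"
    have q: "q \<in> V" unfolding q_def by (rule comb[OF r r])
    have Aq: "A q w = A r w / \<sigma>" if "w \<in> V" for w
      unfolding q_def using linear_onD[OF lin[OF that] r r, of "1 / \<sigma>" 0] by simp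
    have qe: "A q (e m) = 0" "A (e m) q = 0" if "m < N" for m
      using Aq[OF e[OF that]] re[OF that] sym[OF q e[OF that]] by auto
    have rq: "A r q = \<sigma>" using Aq[OF r] sym[OF r q] \<sigma>(1) unfolding \<sigma>(2)[symmetric] by simp
    have qq: "A q q = 1" using Aq[OF q] rq \<sigma> by simp
    have bq: "A b q = \<sigma>" using Ar[OF q] rq qe by simp
    let ?e = "e(N := q)"
    have "\<forall>l<Suc N. ?e l \<in> V" using e q by (auto simp: less_Suc_eq)
    moreover have "\<forall>l<Suc N. \<forall>m<Suc N. A (?e l) (?e m) = (if l = m then 1 else 0)"
      using orth qe qq by (auto simp: less_Suc_eq)
    moreover have "\<forall>v\<in>insert b B. \<forall>w\<in>V. A v w = (\<Sum>l<Suc N. A v (?e l) * A (?e l) w)"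
    proof (intro ballI)
      fix v w assume v: "v \<in> insert b B" and w: "w \<in> V"
      have sum: "(\<Sum>l<Suc N. A v (?e l) * A (?e l) w) = (\<Sum>l<N. A v (e l) * A (e l) w) + A v q * A q w" by simp
      show "A v w = (\<Sum>l<Suc N. A v (?e l) * A (?e l) w)"
      proof (cases "v = b")
        case True
        then show ?thesis unfolding sum using Ar[OF w] Aq[OF w] bq \<sigma> by simp
      next
        case False
        then have "v \<in> B" using v by simp
        then have "A v q = 0" using rep[OF _ q] qe by simp
        then show ?thesis unfolding sum using rep[OF \<open>v \<in> B\<close> w] by simp
      qed
    qed
    ultimately show ?thesis by blast
  qed
qed

end

section \<open>Weak derivatives of linear combinations\<close>

context bounded_open
begin

lemma wderiv_linear:
  assumes u: "sobolev \<Omega> 2 u" and v: "sobolev \<Omega> 2 v" and \<beta>: "size \<beta> \<le> 2"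
  shows "L2 M (wderiv \<Omega> \<beta> (\<lambda>x. a * u x + b * v x))"
    "AE x in M. wderiv \<Omega> \<beta> (\<lambda>x. a * u x + b * v x) x = a * wderiv \<Omega> \<beta> u x + b * wderiv \<Omega> \<beta> v x"
proof -
  have s: "int (size \<beta>) \<le> \<lfloor>2::real\<rfloor>" using \<beta> by simp
  note du = sobolev_D[OF u s] and dv = sobolev_D[OF v s]
  have L: "L2 M (\<lambda>x. a * wderiv \<Omega> \<beta> u x + b * wderiv \<Omega> \<beta> v x)" by (intro L2_add L2_cmult du dv)
  note wderiv_eqI[OF L weak_derivative_linear[OF sobolev_L2[OF u] sobolev_L2[OF v] du(1) dv(1) du(2) dv(2)]]
  then show "L2 M (wderiv \<Omega> \<beta> (\<lambda>x. a * u x + b * v x))"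
    "AE x in M. wderiv \<Omega> \<beta> (\<lambda>x. a * u x + b * v x) x = a * wderiv \<Omega> \<beta> u x + b * wderiv \<Omega> \<beta> v x" by auto
qed

lemma wlap_linear:
  assumes u: "sobolev \<Omega> 2 u" and v: "sobolev \<Omega> 2 v"
  shows "L2 M (wlap \<Omega> (\<lambda>x. a * u x + b * v x))"
    "AE x in M. wlap \<Omega> (\<lambda>x. a * u x + b * v x) x = a * wlap \<Omega> u x + b * wlap \<Omega> v x"
proof -
  have c: "size {#i, i#} \<le> 2" for i :: 'n by simp
  show "L2 M (wlap \<Omega> (\<lambda>x. a * u x + b * v x))"
    unfolding wlap_def[abs_def] by (intro L2_sum wderiv_linear[OF u v c])
  have "AE x in M. \<forall>i\<in>UNIV. wderiv \<Omega> {#i, i#} (\<lambda>x. a * u x + b * v x) x = a * wderiv \<Omega> {#i, i#} u x + b * wderiv \<Omega> {#i, i#} v x"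
    by (rule AE_finite_allI) (auto intro: wderiv_linear[OF u v c])
  then show "AE x in M. wlap \<Omega> (\<lambda>x. a * u x + b * v x) x = a * wlap \<Omega> u x + b * wlap \<Omega> v x"
    by eventually_elim (simp add: wlap_def sum.distrib sum_distrib_left)
qed

lemma integral_linear_AE:
  assumes "L2 M f" "L2 M g" "L2 M h" "L2 M k" "AE x in M. k x = a * f x + b * g x"
  shows "(\<integral>x. h x * k x \<partial>M) = a * (\<integral>x. h x * f x \<partial>M) + b * (\<integral>x. h x * g x \<partial>M)"
proof -
  have "(\<integral>x. h x * k x \<partial>M) = (\<integral>x. a * (h x * f x) + b * (h x * g x) \<partial>M)"
  proof (rule integral_cong_AE)
    show "AE x in M. h x * k x = a * (h x * f x) + b * (h x * g x)"
      using assms(5) by eventually_elim (simp add: algebra_simps)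
  qed (use L2_mult_integrable[OF assms(3,1)] L2_mult_integrable[OF assms(3,2)] L2_mult_integrable[OF assms(3,4)] in auto)
  also have "\<dots> = a * (\<integral>x. h x * f x \<partial>M) + b * (\<integral>x. h x * g x \<partial>M)"
    using L2_mult_integrable[OF assms(3,1)] L2_mult_integrable[OF assms(3,2)] by simp
  finally show ?thesis .
qed

end

text \<open>
  The constant of the trilinear estimate \<open>convection_bound\<close>.
\<close>

definition (in bounded_open) C_conv :: real where "C_conv = real CARD('n) * sqrt (4 * C4)"

lemma (in bounded_open) C_conv_pos: "0 < C_conv" using C4_ge_1 by (simp add: C_conv_def)

section \<open>The forms of the scheme on a Galerkin space\<close>

text \<open>
  The role of \<open>V\<close> is that of the finite element space; its dimension does not matter for the estimates.
\<close>

locale galerkin = bounded_open \<Omega> + function_space V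
  for \<Omega> :: "(real^'n) set" and V :: "(real^'n \<Rightarrow> real) set" +
  assumes dim: "CARD('n) \<le> 2" and H02: "\<And>v. v \<in> V \<Longrightarrow> H02 \<Omega> v"
begin

abbreviation D :: "'n \<Rightarrow> (real^'n \<Rightarrow> real) \<Rightarrow> real^'n \<Rightarrow> real" where
  "D i u \<equiv> wderiv \<Omega> {#i#} u"

text \<open>
  The form \<open>A(u, v) = (u, v) + (\<Delta>u, \<Delta>v)\<close>.
\<close>

definition energy :: "(real^'n \<Rightarrow> real) \<Rightarrow> (real^'n \<Rightarrow> real) \<Rightarrow> real" where
  "energy u v = ip \<Omega> u v + ip \<Omega> (wlap \<Omega> u) (wlap \<Omega> v)"

text \<open>
  The form \<open>(\<nabla>u, \<nabla>v)\<close>.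
\<close>

definition dirichlet :: "(real^'n \<Rightarrow> real) \<Rightarrow> (real^'n \<Rightarrow> real) \<Rightarrow> real" where
  "dirichlet u v = (\<Sum>i\<in>UNIV. \<integral>x. D i u x * D i v x \<partial>M)"

text \<open>
  The contribution \<open>\<Sum>\<^sub>i (u, \<partial>\<^sub>iz)\<close> of the linear part of the flux.
\<close>

definition transport :: "(real^'n \<Rightarrow> real) \<Rightarrow> (real^'n \<Rightarrow> real) \<Rightarrow> real" where
  "transport u z = (\<Sum>i\<in>UNIV. \<integral>x. u x * D i z x \<partial>M)"

text \<open>
  The form \<open>\<Sum>\<^sub>i (u v, \<partial>\<^sub>iz)\<close>; half of \<open>convection u u z\<close> is the contribution of the quadratic part of the flux.
\<close>

definition convection :: "(real^'n \<Rightarrow> real) \<Rightarrow> (real^'n \<Rightarrow> real) \<Rightarrow> (real^'n \<Rightarrow> real) \<Rightarrow> real" where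
  "convection u v z = (\<Sum>i\<in>UNIV. \<integral>x. (u x * v x) * D i z x \<partial>M)"

lemma sob: "v \<in> V \<Longrightarrow> sobolev \<Omega> 2 v" using H02 by (simp add: H02_def)

lemma V_L2: "v \<in> V \<Longrightarrow> L2 M v" "v \<in> V \<Longrightarrow> L2 M (D i v)" "v \<in> V \<Longrightarrow> L2 M (wlap \<Omega> v)"
  using sob sobolev_L2 wlap_L2 sobolev_D(1)[of 2 v "{#i#}"] by auto

lemma V_L2_square: assumes "v \<in> V" shows "L2 M (\<lambda>x. (v x)\<^sup>2)"
  using ladyzhenskaya(1)[OF dim] H02_approx[OF H02[OF assms]] by metis

lemma V_L2_mult: assumes "u \<in> V" "v \<in> V" shows "L2 M (\<lambda>x. u x * v x)"
proof -
  have "integrable M (\<lambda>x. (u x * v x)\<^sup>2)"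
    using L2_mult_integrable[OF V_L2_square[OF assms(1)] V_L2_square[OF assms(2)]] by (simp add: power_mult_distrib)
  moreover have "(\<lambda>x. u x * v x) \<in> borel_measurable M" using assms by (intro borel_measurable_times L2_measurable V_L2)
  ultimately show ?thesis by (simp add: L2_def)
qed

lemma D_linear: assumes "u \<in> V" "v \<in> V"
  shows "AE x in M. D i (\<lambda>x. a * u x + b * v x) x = a * D i u x + b * D i v x"
  by (rule wderiv_linear(2)) (use assms sob in auto)

lemma linear_energy: assumes "w \<in> V" shows "linear_on V (\<lambda>u. energy u w)"
  unfolding linear_on_def
proof (intro ballI allI)
  fix u v a b assume uv: "u \<in> V" "v \<in> V"
  note L = V_L2[OF uv(1)] V_L2[OF uv(2)] V_L2[OF assms] V_L2[OF comb[OF uv, of a b]]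
  have "(\<integral>x. w x * (a * u x + b * v x) \<partial>M) = a * (\<integral>x. w x * u x \<partial>M) + b * (\<integral>x. w x * v x \<partial>M)"
    by (rule integral_linear_AE) (use L in auto)
  moreover have "(\<integral>x. wlap \<Omega> w x * wlap \<Omega> (\<lambda>x. a * u x + b * v x) x \<partial>M)
     = a * (\<integral>x. wlap \<Omega> w x * wlap \<Omega> u x \<partial>M) + b * (\<integral>x. wlap \<Omega> w x * wlap \<Omega> v x \<partial>M)"
    by (rule integral_linear_AE) (use L wlap_linear(2)[OF sob[OF uv(1)] sob[OF uv(2)]] in auto)
  ultimately show "energy (\<lambda>x. a * u x + b * v x) w = a * energy u w + b * energy v w"
    by (simp add: energy_def ip_real mult.commute algebra_simps)
qed

lemma energy_sym: "energy u v = energy v u"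
  by (simp add: energy_def ip_real mult.commute)

lemma energy_eq: "energy u u = (\<integral>x. (u x)\<^sup>2 \<partial>M) + (\<integral>x. (wlap \<Omega> u x)\<^sup>2 \<partial>M)"
  by (simp add: energy_def ip_real power2_eq_square)

lemma integral_square_nonneg: "0 \<le> (\<integral>x. (f x :: real)\<^sup>2 \<partial>M)"
  by (rule Bochner_Integration.integral_nonneg) simp

sublocale semi_inner_space V energy
proof
  show "linear_on V (\<lambda>u. energy u w)" if "w \<in> V" for w by (rule linear_energy[OF that])
  show "energy u v = energy v u" for u v by (rule energy_sym)
  show "0 \<le> energy u u" for u unfolding energy_eq by (intro add_nonneg_nonneg integral_square_nonneg)
qed

lemma dirichlet_sym: "dirichlet u v = dirichlet v u"
  by (simp add: dirichlet_def mult.commute)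

lemma linear_dirichlet: assumes "w \<in> V" shows "linear_on V (dirichlet w)"
  unfolding linear_on_def
proof (intro ballI allI)
  fix u v a b assume uv: "u \<in> V" "v \<in> V"
  have "(\<integral>x. D i w x * D i (\<lambda>x. a * u x + b * v x) x \<partial>M) = a * (\<integral>x. D i w x * D i u x \<partial>M) + b * (\<integral>x. D i w x * D i v x \<partial>M)" for i
    by (rule integral_linear_AE[OF V_L2(2)[OF uv(1)] V_L2(2)[OF uv(2)] V_L2(2)[OF assms] V_L2(2)[OF comb[OF uv]] D_linear[OF uv]])
  then show "dirichlet w (\<lambda>x. a * u x + b * v x) = a * dirichlet w u + b * dirichlet w v"
    by (simp add: dirichlet_def sum.distrib sum_distrib_left)
qed

lemma linear_transport: assumes "w \<in> V" shows "linear_on V (transport w)" "linear_on V (\<lambda>u. transport u w)"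
proof -
  show "linear_on V (transport w)"
    unfolding linear_on_def
  proof (intro ballI allI)
    fix u v a b assume uv: "u \<in> V" "v \<in> V"
    have "(\<integral>x. w x * D i (\<lambda>x. a * u x + b * v x) x \<partial>M) = a * (\<integral>x. w x * D i u x \<partial>M) + b * (\<integral>x. w x * D i v x \<partial>M)" for i
      by (rule integral_linear_AE[OF V_L2(2)[OF uv(1)] V_L2(2)[OF uv(2)] V_L2(1)[OF assms] V_L2(2)[OF comb[OF uv]] D_linear[OF uv]])
    then show "transport w (\<lambda>x. a * u x + b * v x) = a * transport w u + b * transport w v"
      by (simp add: transport_def sum.distrib sum_distrib_left)
  qed
  show "linear_on V (\<lambda>u. transport u w)"
    unfolding linear_on_def
  proof (intro ballI allI)
    fix u v a b assume uv: "u \<in> V" "v \<in> V"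
    have "(\<integral>x. D i w x * (a * u x + b * v x) \<partial>M) = a * (\<integral>x. D i w x * u x \<partial>M) + b * (\<integral>x. D i w x * v x \<partial>M)" for i
      by (rule integral_linear_AE[OF V_L2(1)[OF uv(1)] V_L2(1)[OF uv(2)] V_L2(2)[OF assms] V_L2(1)[OF comb[OF uv]]]) simp
    then show "transport (\<lambda>x. a * u x + b * v x) w = a * transport u w + b * transport v w"
      by (simp add: transport_def sum.distrib sum_distrib_left mult.commute)
  qed
qed

lemma convection_sym: "convection u v z = convection v u z"
  by (simp add: convection_def mult.commute)

lemma linear_convection: assumes "w \<in> V" "z \<in> V" shows "linear_on V (convection w z)" "linear_on V (\<lambda>u. convection u w z)"
proof -
  show "linear_on V (convection w z)"
    unfolding linear_on_def
  proof (intro ballI allI)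
    fix u v a b assume uv: "u \<in> V" "v \<in> V"
    have "(\<integral>x. w x * z x * D i (\<lambda>x. a * u x + b * v x) x \<partial>M) = a * (\<integral>x. w x * z x * D i u x \<partial>M) + b * (\<integral>x. w x * z x * D i v x \<partial>M)" for i
      by (rule integral_linear_AE[OF V_L2(2)[OF uv(1)] V_L2(2)[OF uv(2)] V_L2_mult[OF assms] V_L2(2)[OF comb[OF uv]] D_linear[OF uv]])
    then show "convection w z (\<lambda>x. a * u x + b * v x) = a * convection w z u + b * convection w z v"
      by (simp add: convection_def sum.distrib sum_distrib_left)
  qed
  show "linear_on V (\<lambda>u. convection u w z)"
    unfolding linear_on_def
  proof (intro ballI allI)
    fix u v a b assume uv: "u \<in> V" "v \<in> V"
    have "(\<integral>x. D i z x * ((a * u x + b * v x) * w x) \<partial>M) = a * (\<integral>x. D i z x * (u x * w x) \<partial>M) + b * (\<integral>x. D i z x * (v x * w x) \<partial>M)" for i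
      by (rule integral_linear_AE[OF V_L2_mult[OF uv(1) assms(1)] V_L2_mult[OF uv(2) assms(1)] V_L2(2)[OF assms(2)] V_L2_mult[OF comb[OF uv] assms(1)]])
         (simp add: algebra_simps)
    then show "convection (\<lambda>x. a * u x + b * v x) w z = a * convection u w z + b * convection v w z"
      by (simp add: convection_def sum.distrib sum_distrib_left mult.commute)
  qed
qed

lemma transport_self: assumes "u \<in> V" shows "transport u u = 0"
proof -
  obtain \<phi> where a: "smooth_approx \<phi> u (\<lambda>i. D i u) (\<lambda>_. 0)" using H02_approx[OF H02[OF assms]] .
  show ?thesis unfolding transport_def by (intro sum.neutral ballI zero_trace_gradient[OF a])
qed

lemma convection_self: assumes "u \<in> V" shows "convection u u u = 0"
proof -
  obtain \<phi> where a: "smooth_approx \<phi> u (\<lambda>i. D i u) (\<lambda>_. 0)" using H02_approx[OF H02[OF assms]] .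
  show ?thesis unfolding convection_def power2_eq_square[symmetric]
    by (intro sum.neutral ballI zero_trace_cubic[OF dim a])
qed

lemma dirichlet_self: "dirichlet u u = (\<Sum>i\<in>UNIV. \<integral>x. (D i u x)\<^sup>2 \<partial>M)"
  by (simp add: dirichlet_def power2_eq_square)

lemma dirichlet_nonneg: "0 \<le> dirichlet u u"
  unfolding dirichlet_self by (intro sum_nonneg integral_square_nonneg)

lemma dirichlet_le:
  assumes "u \<in> V" shows "dirichlet u u \<le> sqrt (\<integral>x. (u x)\<^sup>2 \<partial>M) * sqrt (\<integral>x. (wlap \<Omega> u x)\<^sup>2 \<partial>M)"
  using H02_green[OF H02[OF assms]] L2_Cauchy_Schwarz[OF V_L2(1)[OF assms] V_L2(3)[OF assms]]
  by (simp add: dirichlet_self)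

lemma dirichlet_le_energy: assumes "u \<in> V" shows "dirichlet u u \<le> energy u u"
proof -
  let ?a = "sqrt (\<integral>x. (u x)\<^sup>2 \<partial>M)" and ?b = "sqrt (\<integral>x. (wlap \<Omega> u x)\<^sup>2 \<partial>M)"
  have "2 * (?a * ?b) \<le> ?a\<^sup>2 + ?b\<^sup>2" using zero_le_power2[of "?a - ?b"] by (simp add: power2_diff)
  moreover have "0 \<le> ?a * ?b" using integral_square_nonneg by simp
  moreover have "?a\<^sup>2 + ?b\<^sup>2 = energy u u" by (simp add: energy_eq integral_square_nonneg)
  ultimately show ?thesis using dirichlet_le[OF assms] by linarith
qed

lemma L4_le_energy: assumes "u \<in> V" shows "(\<integral>x. ((u x)\<^sup>2)\<^sup>2 \<partial>M) \<le> 4 * C4 * (energy u u)\<^sup>2"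
proof -
  obtain \<phi> where "smooth_approx \<phi> u (\<lambda>i. D i u) (\<lambda>_. 0)" using H02_approx[OF H02[OF assms]] .
  then have "(\<integral>x. ((u x)\<^sup>2)\<^sup>2 \<partial>M) \<le> 4 * C4 * (\<integral>x. (u x)\<^sup>2 \<partial>M) * dirichlet u u"
    using ladyzhenskaya(2)[OF dim] by (simp add: dirichlet_self)
  also have "\<dots> \<le> 4 * C4 * energy u u * energy u u"
    using dirichlet_le_energy[OF assms] dirichlet_nonneg[of u] C4_ge_1 nonneg[OF assms] integral_square_nonneg
    by (intro mult_mono mult_left_mono) (auto simp: energy_eq)
  finally show ?thesis by (simp add: power2_eq_square mult.assoc)
qed

abbreviation enorm :: "(real^'n \<Rightarrow> real) \<Rightarrow> real" where "enorm u \<equiv> sqrt (energy u u)"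

lemma convection_bound:
  assumes u: "u \<in> V" and v: "v \<in> V" and z: "z \<in> V"
  shows "\<bar>convection u v z\<bar> \<le> C_conv * enorm u * enorm v * enorm z"
proof -
  have uv: "(\<integral>x. (u x * v x)\<^sup>2 \<partial>M) \<le> 4 * C4 * (energy u u * energy v v)"
  proof -
    have "(\<integral>x. (u x * v x)\<^sup>2 \<partial>M) \<le> sqrt (\<integral>x. ((u x)\<^sup>2)\<^sup>2 \<partial>M) * sqrt (\<integral>x. ((v x)\<^sup>2)\<^sup>2 \<partial>M)"
      using L2_Cauchy_Schwarz[OF V_L2_square[OF u] V_L2_square[OF v]] by (simp add: power_mult_distrib)
    also have "\<dots> \<le> sqrt (4 * C4 * (energy u u)\<^sup>2) * sqrt (4 * C4 * (energy v v)\<^sup>2)"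
      using C4_ge_1
      by (intro mult_mono real_sqrt_le_mono L4_le_energy u v) (auto intro: integral_square_nonneg mult_nonneg_nonneg)
    also have "\<dots> = 4 * C4 * (energy u u * energy v v)"
      using nonneg[OF u] nonneg[OF v] C4_ge_1 by (simp add: real_sqrt_mult)
    finally show ?thesis .
  qed
  have "\<bar>\<integral>x. (u x * v x) * D i z x \<partial>M\<bar> \<le> sqrt (4 * C4) * enorm u * enorm v * enorm z" for i
  proof -
    have "(\<integral>x. (D i z x)\<^sup>2 \<partial>M) \<le> dirichlet z z"
      unfolding dirichlet_self by (rule member_le_sum) (auto intro: integral_square_nonneg)
    then have Dz: "(\<integral>x. (D i z x)\<^sup>2 \<partial>M) \<le> energy z z" using dirichlet_le_energy[OF z] by linarith
    have "\<bar>\<integral>x. (u x * v x) * D i z x \<partial>M\<bar> \<le> sqrt (\<integral>x. (u x * v x)\<^sup>2 \<partial>M) * sqrt (\<integral>x. (D i z x)\<^sup>2 \<partial>M)"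
      by (rule L2_Cauchy_Schwarz[OF V_L2_mult[OF u v] V_L2(2)[OF z]])
    also have "\<dots> \<le> sqrt (4 * C4 * (energy u u * energy v v)) * sqrt (energy z z)"
      using C4_ge_1 nonneg[OF u] nonneg[OF v]
      by (intro mult_mono real_sqrt_le_mono uv Dz real_sqrt_ge_zero mult_nonneg_nonneg integral_square_nonneg) auto
    finally show ?thesis by (simp add: real_sqrt_mult)
  qed
  then have "(\<Sum>i\<in>(UNIV::'n set). \<bar>\<integral>x. (u x * v x) * D i z x \<partial>M\<bar>) \<le> real CARD('n) * (sqrt (4 * C4) * enorm u * enorm v * enorm z)"
    by (rule sum_bounded_above[of UNIV, simplified])
  then show ?thesis
    unfolding convection_def C_conv_def by (intro order_trans[OF sum_abs]) (simp add: mult.assoc)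
qed

section \<open>One step of the scheme\<close>

lemma ip_wgrad: assumes "u \<in> V" "v \<in> V" shows "ip \<Omega> (wgrad \<Omega> u) (wgrad \<Omega> v) = dirichlet u v"
proof -
  have "ip \<Omega> (wgrad \<Omega> u) (wgrad \<Omega> v) = (\<integral>x. (\<Sum>i\<in>UNIV. D i u x * D i v x) \<partial>M)"
    by (simp add: ip_def wgrad_def inner_vec_def)
  also have "\<dots> = dirichlet u v"
    unfolding dirichlet_def by (rule Bochner_Integration.integral_sum) (intro L2_mult_integrable V_L2 assms)
  finally show ?thesis .
qed

lemma ip_flux: assumes "u \<in> V" "v \<in> V"
  shows "ip \<Omega> (\<lambda>x. flux (u x)) (wgrad \<Omega> v) = - (transport u v + convection u u v / 2)"
proof -
  have i: "integrable M (\<lambda>x. u x * D i v x)" "integrable M (\<lambda>x. (u x * u x) * D i v x)" for i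
    by (intro L2_mult_integrable V_L2 V_L2_mult assms)+
  have "ip \<Omega> (\<lambda>x. flux (u x)) (wgrad \<Omega> v) = (\<integral>x. (\<Sum>i\<in>UNIV. - (u x * D i v x) - (1 / 2) * ((u x * u x) * D i v x)) \<partial>M)"
    by (simp add: ip_def wgrad_def inner_vec_def flux_def power2_eq_square algebra_simps)
  also have "\<dots> = (\<Sum>i\<in>UNIV. \<integral>x. - (u x * D i v x) - (1 / 2) * ((u x * u x) * D i v x) \<partial>M)"
    using i by (intro Bochner_Integration.integral_sum Bochner_Integration.integrable_diff) auto
  also have "\<dots> = (\<Sum>i\<in>UNIV. - (\<integral>x. u x * D i v x \<partial>M) - (1 / 2) * (\<integral>x. (u x * u x) * D i v x \<partial>M))"
  proof (rule sum.cong[OF refl])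
    fix i
    show "(\<integral>x. - (u x * D i v x) - (1 / 2) * ((u x * u x) * D i v x) \<partial>M) =
      - (\<integral>x. u x * D i v x \<partial>M) - (1 / 2) * (\<integral>x. (u x * u x) * D i v x \<partial>M)"
      using i[of i] by (subst Bochner_Integration.integral_diff) auto
  qed
  also have "\<dots> = - (transport u v + convection u u v / 2)"
    by (simp add: transport_def convection_def sum_subtractf sum_negf sum_divide_distrib)
  finally show ?thesis .
qed

text \<open>
  The left-hand minus the right-hand side of one step from \<open>U0\<close> to \<open>U\<close>, tested with \<open>z\<close>.
\<close>

definition residual :: "real \<Rightarrow> real \<Rightarrow> (real^'n \<Rightarrow> real) \<Rightarrow> (real^'n \<Rightarrow> real) \<Rightarrow> (real^'n \<Rightarrow> real) \<Rightarrow> real" where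
  "residual \<alpha> k U0 U z = (energy U z - energy U0 z) / k + \<alpha> * dirichlet U z - transport U z - convection U U z / 2"

lemma scheme_step_iff:
  assumes "U0 \<in> V" "U \<in> V"
  shows "scheme_step \<Omega> V \<alpha> k U0 U \<longleftrightarrow> (\<forall>z\<in>V. residual \<alpha> k U0 U z = 0)"
proof -
  have dq: "diff_quot k U0 U = (\<lambda>x. 1 / k * U x + (- 1 / k) * U0 x)"
    by (simp add: diff_quot_def fun_eq_iff diff_divide_distrib)
  have dq': "ip \<Omega> (diff_quot k U0 U) z + ip \<Omega> (wlap \<Omega> (diff_quot k U0 U)) (wlap \<Omega> z) = (energy U z - energy U0 z) / k" if "z \<in> V" for z
    using linear_onD[OF linear_energy[OF that] assms(2,1), of "1 / k" "- 1 / k"]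
    unfolding dq energy_def[symmetric] by (simp add: diff_divide_distrib)
  have "ip \<Omega> (diff_quot k U0 U) z + ip \<Omega> (wlap \<Omega> (diff_quot k U0 U)) (wlap \<Omega> z)
      + \<alpha> * ip \<Omega> (wgrad \<Omega> U) (wgrad \<Omega> z) = - ip \<Omega> (\<lambda>x. flux (U x)) (wgrad \<Omega> z) \<longleftrightarrow> residual \<alpha> k U0 U z = 0"
    if "z \<in> V" for z
    unfolding residual_def ip_wgrad[OF assms(2) that] ip_flux[OF assms(2) that] dq'[OF that] by (rule iffI; linarith)
  then show ?thesis unfolding scheme_step_def by (intro ball_cong refl)
qed

lemma linear_residual:
  assumes "U0 \<in> V" "U \<in> V" shows "linear_on V (residual \<alpha> k U0 U)"
  unfolding linear_on_def
proof (intro ballI allI)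
  fix u v a b assume uv: "u \<in> V" "v \<in> V"
  show "residual \<alpha> k U0 U (\<lambda>x. a * u x + b * v x) = a * residual \<alpha> k U0 U u + b * residual \<alpha> k U0 U v"
    unfolding residual_def linear_onD[OF lin2[OF assms(1)] uv] linear_onD[OF lin2[OF assms(2)] uv]
      linear_onD[OF linear_dirichlet[OF assms(2)] uv] linear_onD[OF linear_transport(1)[OF assms(2)] uv]
      linear_onD[OF linear_convection(1)[OF assms(2,2)] uv]
    by (simp add: diff_divide_distrib add_divide_distrib algebra_simps)
qed

lemma residual_self:
  assumes "U \<in> V" shows "residual \<alpha> k U0 U U = (energy U U - energy U0 U) / k + \<alpha> * dirichlet U U"
  using transport_self[OF assms] convection_self[OF assms] by (simp add: residual_def)

lemma energy_decreasing:
  assumes "U0 \<in> V" "U \<in> V" "0 < k" "0 \<le> \<alpha>" "scheme_step \<Omega> V \<alpha> k U0 U"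
  shows "enorm U \<le> enorm U0"
proof -
  have "(energy U U - energy U0 U) / k + \<alpha> * dirichlet U U = 0"
    using assms scheme_step_iff[OF assms(1,2)] residual_self[OF assms(2)] by metis
  moreover have "0 \<le> \<alpha> * dirichlet U U" using assms(4) dirichlet_nonneg by simp
  ultimately have "(energy U U - energy U0 U) / k \<le> 0" by linarith
  then have "energy U U \<le> energy U0 U" using assms(3) by (simp add: divide_le_0_iff)
  also have "\<dots> \<le> enorm U0 * enorm U" using Cauchy_Schwarz[OF assms(1,2)] by linarith
  finally have "enorm U * enorm U \<le> enorm U0 * enorm U" using nonneg[OF assms(2)] by simp
  then show ?thesis
  proof (cases "energy U U = 0")
    case False
    then have "0 < enorm U" using nonneg[OF assms(2)] by (simp add: order_less_le)
    with \<open>enorm U * enorm U \<le> enorm U0 * enorm U\<close> show ?thesis by (rule mult_right_le_imp_le)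
  qed (use nonneg[OF assms(1)] in simp)
qed

lemma energy_zero_AE: assumes "u \<in> V" "energy u u = 0" shows "AE x in M. u x = 0"
proof -
  have "(\<integral>x. (u x)\<^sup>2 \<partial>M) = 0"
    using assms(2) integral_square_nonneg[of u] integral_square_nonneg[of "wlap \<Omega> u"] unfolding energy_eq by linarith
  then show ?thesis by (rule L2_integral_0[OF V_L2(1)[OF assms(1)]])
qed

theorem step_unique:
  assumes U0: "U0 \<in> V" and U: "U \<in> V" "U' \<in> V" and k: "0 < k" and \<alpha>: "0 \<le> \<alpha>"
    and s: "scheme_step \<Omega> V \<alpha> k U0 U" "scheme_step \<Omega> V \<alpha> k U0 U'"
    and small: "k * (C_conv * enorm U0) < 1"
  shows "AE x in M. U x = U' x"
proof -
  let ?e = "\<lambda>x. U x - U' x" and ?s = "\<lambda>x. U x + U' x"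
  have e: "?e \<in> V" and sV: "?s \<in> V" by (intro diff_in add_in U)+
  have r: "residual \<alpha> k U0 U ?e = 0" "residual \<alpha> k U0 U' ?e = 0"
    using s scheme_step_iff[OF U0] U e by auto
  have conv: "convection U U ?e - convection U' U' ?e = convection ?e ?s ?e"
  proof -
    have "convection ?e ?s ?e = convection U ?s ?e - convection U' ?s ?e"
      by (rule linear_on_diff[OF linear_convection(2)[OF sV e] U])
    also have "convection U ?s ?e = convection U U ?e + convection U' U ?e"
      unfolding convection_sym[of U ?s] by (rule linear_on_add[OF linear_convection(2)[OF U(1) e] U])
    also have "convection U' ?s ?e = convection U U' ?e + convection U' U' ?e"
      unfolding convection_sym[of U' ?s] by (rule linear_on_add[OF linear_convection(2)[OF U(2) e] U])
    finally show ?thesis using convection_sym[of U U' ?e] by linarith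
  qed
  have "energy ?e ?e / k + \<alpha> * dirichlet ?e ?e - transport ?e ?e - convection ?e ?s ?e / 2
      = residual \<alpha> k U0 U ?e - residual \<alpha> k U0 U' ?e"
    using linear_on_diff[OF lin[OF e] U] linear_on_diff[OF linear_transport(2)[OF e] U]
      linear_on_diff[OF linear_dirichlet[OF e] U] conv dirichlet_sym
    by (simp add: residual_def diff_divide_distrib right_diff_distrib)
  then have "energy ?e ?e / k + \<alpha> * dirichlet ?e ?e = convection ?e ?s ?e / 2"
    using r transport_self[OF e] by simp
  moreover have "0 \<le> \<alpha> * dirichlet ?e ?e" using \<alpha> dirichlet_nonneg by simp
  ultimately have "energy ?e ?e / k \<le> convection ?e ?s ?e / 2" by linarith
  also have "\<dots> \<le> (C_conv * enorm ?e * enorm ?s * enorm ?e) / 2"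
    using convection_bound[OF e sV e] by simp
  also have "\<dots> \<le> (C_conv * enorm ?e * (2 * enorm U0) * enorm ?e) / 2"
  proof -
    have "enorm ?s \<le> 2 * enorm U0"
      using triangle[OF U] energy_decreasing[OF U0 U(1) k \<alpha> s(1)] energy_decreasing[OF U0 U(2) k \<alpha> s(2)] by linarith
    then show ?thesis
      using C_conv_pos nonneg[OF e] by (intro divide_right_mono mult_right_mono mult_left_mono) auto
  qed
  also have "\<dots> = C_conv * enorm U0 * energy ?e ?e" using nonneg[OF e] by simp
  finally have "energy ?e ?e \<le> k * (C_conv * enorm U0) * energy ?e ?e" using k by (simp add: field_simps)
  then have "0 \<le> (k * (C_conv * enorm U0) - 1) * energy ?e ?e" by (simp add: algebra_simps)
  then have "energy ?e ?e \<le> 0" using small by (simp add: zero_le_mult_iff)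
  then have "energy ?e ?e = 0" using nonneg[OF e] by simp
  from energy_zero_AE[OF e this] show ?thesis by eventually_elim simp
qed

lemma wderiv_cong_AE:
  assumes "L2 M u" "L2 M v" "AE x in M. u x = v x" shows "wderiv \<Omega> \<beta> u = wderiv \<Omega> \<beta> v"
proof -
  have "ip \<Omega> u (partials js \<phi>) = ip \<Omega> v (partials js \<phi>)" if "test_function \<Omega> \<phi>" for \<phi> js
    unfolding ip_real
  proof (rule integral_cong_AE)
    have p: "L2 M (partials js \<phi>)" using that by (intro L2_partials test_smooth)
    show "(\<lambda>x. u x * partials js \<phi> x) \<in> borel_measurable M" "(\<lambda>x. v x * partials js \<phi> x) \<in> borel_measurable M"
      by (intro borel_measurable_times L2_measurable p assms)+
    show "AE x in M. u x * partials js \<phi> x = v x * partials js \<phi> x" using assms(3) by eventually_elim simp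
  qed
  then have "weak_derivative \<Omega> \<beta> u = weak_derivative \<Omega> \<beta> v"
    unfolding weak_derivative_def fun_eq_iff by metis
  then show ?thesis unfolding wderiv_def by simp
qed

lemma residual_cong_AE:
  assumes U: "U0 \<in> V" "U \<in> V" and z: "z \<in> V" "z' \<in> V" and ae: "AE x in M. z x = z' x"
  shows "residual \<alpha> k U0 U z = residual \<alpha> k U0 U z'"
proof -
  have D: "wderiv \<Omega> \<beta> z = wderiv \<Omega> \<beta> z'" for \<beta> by (rule wderiv_cong_AE[OF V_L2(1) V_L2(1)]) (use z ae in auto)
  have "energy w z = energy w z'" if w: "w \<in> V" for w
  proof -
    have "ip \<Omega> w z = ip \<Omega> w z'"
      unfolding ip_real
    proof (rule integral_cong_AE)
      show "(\<lambda>x. w x * z x) \<in> borel_measurable M" "(\<lambda>x. w x * z' x) \<in> borel_measurable M"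
        by (intro borel_measurable_times L2_measurable V_L2 z w)+
      show "AE x in M. w x * z x = w x * z' x" using ae by eventually_elim simp
    qed
    then show ?thesis by (simp add: energy_def wlap_def[abs_def] D)
  qed
  then show ?thesis using U by (simp add: residual_def dirichlet_def transport_def convection_def D)
qed

text \<open>
  The coordinates \<open>c\<close> refer to an orthonormal system with respect to \<open>energy\<close>, so that \<open>energy (W c) (W c)\<close> is
  the squared length of \<open>c\<close>. The radius exceeds the norm of \<open>U0\<close>, which makes the residual point outwards.
\<close>

theorem step_exists:
  assumes fin: "finite B" "B \<subseteq> V" and gen: "\<And>v. v \<in> V \<Longrightarrow> \<exists>c. v = (\<lambda>x. \<Sum>b\<in>B. c b * b x)"
    and U0: "U0 \<in> V" and k: "0 < k" and \<alpha>: "0 \<le> \<alpha>"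
  shows "\<exists>U\<in>V. scheme_step \<Omega> V \<alpha> k U0 U"
proof -
  obtain N :: nat and e where e: "\<forall>l<N. e l \<in> V"
    and orth: "\<forall>l<N. \<forall>m<N. energy (e l) (e m) = (if l = m then 1 else 0)"
    and repB: "\<forall>b\<in>B. \<forall>w\<in>V. energy b w = (\<Sum>l<N. energy b (e l) * energy (e l) w)"
    using orthonormal_system[OF fin] by blast
  have eV: "e l \<in> V" if "l < N" for l using e that by blast
  define W where "W = (\<lambda>c x. \<Sum>l<N. c l * e l x)"
  have W: "W c \<in> V" for c unfolding W_def by (intro sum_in eV)
  have W_lin: "\<Phi> (W c) = (\<Sum>l<N. c l * \<Phi> (e l))" if "linear_on V \<Phi>" for \<Phi> c
    unfolding W_def by (rule linear_on_sum[OF that eV])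
  have W_energy: "energy (W c) (W c) = (\<Sum>l<N. (c l)\<^sup>2)" for c
  proof -
    have "energy (W c) (W c) = (\<Sum>l<N. c l * energy (W c) (e l))" by (rule W_lin[OF lin2[OF W]])
    also have "\<dots> = (\<Sum>l<N. (c l)\<^sup>2)"
    proof (rule sum.cong[OF refl])
      fix l assume l: "l \<in> {..<N}"
      have "energy (W c) (e l) = (\<Sum>m<N. c m * energy (e m) (e l))" using l by (intro W_lin lin eV) auto
      also have "\<dots> = (\<Sum>m<N. c m * (if m = l then 1 else 0))" using orth l by (intro sum.cong) auto
      also have "\<dots> = c l" using l by (simp add: if_distrib[of "\<lambda>t. _ * t"] cong: if_cong)
      finally show "c l * energy (W c) (e l) = (c l)\<^sup>2" by (simp add: power2_eq_square)
    qed
    finally show ?thesis .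
  qed
  \<comment> \<open>every function in \<open>V\<close> agrees with its orthogonal expansion, but only almost everywhere\<close>
  have span: "\<exists>d. AE x in M. v x = W d x" if v: "v \<in> V" for v
  proof -
    obtain c where c: "v = (\<lambda>x. \<Sum>b\<in>B. c b * b x)" using gen[OF v] by blast
    obtain h where h: "bij_betw h {..<card B} B" using ex_bij_betw_nat_finite[OF fin(1)] by (auto simp: atLeast0LessThan)
    have hB: "h i \<in> B" if "i < card B" for i using h that by (auto simp: bij_betw_def)
    have vh: "v = (\<lambda>x. \<Sum>i<card B. c (h i) * h i x)"
      unfolding c by (simp add: sum.reindex_bij_betw[OF h, symmetric])
    let ?d = "\<lambda>l. energy v (e l)"
    have rep: "energy v w = (\<Sum>l<N. ?d l * energy (e l) w)" if w: "w \<in> V" for w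
    proof -
      have lv: "energy v z = (\<Sum>i<card B. c (h i) * energy (h i) z)" if "z \<in> V" for z
        by (subst vh, rule linear_on_sum[OF lin[OF that]]) (use hB fin in blast)
      have "energy v w = (\<Sum>i<card B. c (h i) * (\<Sum>l<N. energy (h i) (e l) * energy (e l) w))"
        unfolding lv[OF w] using repB hB w by (intro sum.cong) auto
      also have "\<dots> = (\<Sum>l<N. (\<Sum>i<card B. c (h i) * energy (h i) (e l)) * energy (e l) w)"
        by (simp add: sum_distrib_left sum_distrib_right mult.assoc sum.swap[of _ "{..<card B}"])
      also have "\<dots> = (\<Sum>l<N. ?d l * energy (e l) w)" using lv eV by (intro sum.cong) auto
      finally show ?thesis .
    qed
    let ?r = "\<lambda>x. v x - W ?d x"
    have r: "?r \<in> V" by (rule diff_in[OF v W])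
    have "energy ?r ?r = energy v ?r - energy (W ?d) ?r" by (rule linear_on_diff[OF lin[OF r] v W])
    also have "energy (W ?d) ?r = energy v ?r" unfolding rep[OF r] by (rule W_lin[OF lin[OF r]])
    finally have "AE x in M. ?r x = 0" using energy_zero_AE[OF r] by simp
    then have "AE x in M. v x = W ?d x" by eventually_elim simp
    then show ?thesis by blast
  qed
  define F where "F = (\<lambda>c l. residual \<alpha> k U0 (W c) (e l))"
  define R where "R = 1 + enorm U0"
  have R: "0 < R" using nonneg[OF U0] by (simp add: R_def add_pos_nonneg)
  have "\<exists>c. \<forall>l<N. F c l = 0"
  proof (rule outward_field_has_zero[OF R])
    fix l assume l: "l < N"
    have "F c l = ((\<Sum>m<N. c m * energy (e m) (e l)) - energy U0 (e l)) / k + \<alpha> * (\<Sum>m<N. c m * dirichlet (e l) (e m))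
        - (\<Sum>m<N. c m * transport (e m) (e l)) - (\<Sum>m<N. c m * (\<Sum>n<N. c n * convection (e n) (e m) (e l))) / 2" for c
    proof -
      have "convection (W c) (W c) (e l) = (\<Sum>m<N. c m * convection (e m) (W c) (e l))"
        by (rule W_lin[OF linear_convection(2)[OF W eV[OF l]]])
      also have "\<dots> = (\<Sum>m<N. c m * (\<Sum>n<N. c n * convection (e n) (e m) (e l)))"
      proof (rule sum.cong[OF refl])
        fix m assume "m \<in> {..<N}"
        then show "c m * convection (e m) (W c) (e l) = c m * (\<Sum>n<N. c n * convection (e n) (e m) (e l))"
          unfolding convection_sym[of "e m" "W c"] using W_lin[OF linear_convection(2)[OF eV eV[OF l]]] by simp
      qed
      finally show ?thesis
        unfolding F_def residual_def
        using W_lin[OF lin[OF eV[OF l]]] W_lin[OF linear_dirichlet[OF eV[OF l]]] W_lin[OF linear_transport(2)[OF eV[OF l]]]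
        by (simp add: dirichlet_sym[of "W c"])
    qed
    then show "continuous_on UNIV (\<lambda>c. F c l)"
      using k by (simp, intro continuous_intros) auto
  next
    fix c assume c: "(\<Sum>i<N. (c i)\<^sup>2) = R\<^sup>2"
    have Wn: "energy (W c) (W c) = R\<^sup>2" using W_energy c by simp
    have "(\<Sum>l<N. F c l * c l) = residual \<alpha> k U0 (W c) (W c)"
      unfolding F_def W_lin[OF linear_residual[OF U0 W]] by (simp add: mult.commute)
    also have "\<dots> = (R\<^sup>2 - energy U0 (W c)) / k + \<alpha> * dirichlet (W c) (W c)"
      by (simp add: residual_self[OF W] Wn)
    also have "\<dots> > 0"
    proof -
      have "energy U0 (W c) \<le> enorm U0 * R" using Cauchy_Schwarz[OF U0 W, of c] R Wn by simp
      also have "\<dots> < R * R" using R by (intro mult_strict_right_mono) (auto simp: R_def)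
      finally have "0 < (R\<^sup>2 - energy U0 (W c)) / k" using k by (simp add: power2_eq_square)
      moreover have "0 \<le> \<alpha> * dirichlet (W c) (W c)" using \<alpha> dirichlet_nonneg by simp
      ultimately show ?thesis by linarith
    qed
    finally show "0 < (\<Sum>l<N. F c l * c l)" .
  qed
  then obtain c where c: "\<And>l. l < N \<Longrightarrow> residual \<alpha> k U0 (W c) (e l) = 0" unfolding F_def by blast
  have "residual \<alpha> k U0 (W c) z = 0" if z: "z \<in> V" for z
  proof -
    obtain d where d: "AE x in M. z x = W d x" using span[OF z] by blast
    have "residual \<alpha> k U0 (W c) z = residual \<alpha> k U0 (W c) (W d)"
      by (rule residual_cong_AE[OF U0 W z W d])
    also have "\<dots> = 0" unfolding W_lin[OF linear_residual[OF U0 W]] using c by simp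
    finally show ?thesis .
  qed
  then show ?thesis using scheme_step_iff[OF U0 W] W by blast
qed

text \<open>
  The projection does not increase the norm of the Laplacian, which controls the function by Poincare's
  inequality and \<open>\<parallel>\<nabla>P\<parallel>\<^sup>2 \<le> \<parallel>P\<parallel> \<parallel>\<Delta>P\<parallel>\<close>.
\<close>

lemma projection_bound:
  assumes u: "sobolev \<Omega> 2 u" and P: "is_projection \<Omega> V u P" and R: "\<And>x. x \<in> \<Omega> \<Longrightarrow> norm x \<le> R" "0 \<le> R"
  shows "enorm P \<le> sqrt (16 * R ^ 4 + 1) * sqrt (\<integral>x. (wlap \<Omega> u x)\<^sup>2 \<partial>M)"
proof -
  have PV: "P \<in> V" using P by (simp add: is_projection_def)
  define a where "a = sqrt (\<integral>x. (wlap \<Omega> u x)\<^sup>2 \<partial>M)"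
  define b where "b = sqrt (\<integral>x. (wlap \<Omega> P x)\<^sup>2 \<partial>M)"
  define s where "s = sqrt (\<integral>x. (P x)\<^sup>2 \<partial>M)"
  have nn: "0 \<le> a" "0 \<le> b" "0 \<le> s" by (simp_all add: a_def b_def s_def integral_square_nonneg)
  have sq: "b\<^sup>2 = (\<integral>x. (wlap \<Omega> P x)\<^sup>2 \<partial>M)" "s\<^sup>2 = (\<integral>x. (P x)\<^sup>2 \<partial>M)"
    by (simp_all add: b_def s_def integral_square_nonneg)
  have cancel: "p \<le> q" if "p * p \<le> q * p" "0 \<le> p" "0 \<le> q" for p q :: real
    using that by (cases "p = 0") (auto simp: mult_le_cancel_right)
  have "b \<le> a"
  proof -
    note wl = wlap_linear[OF u sob[OF PV], of 1 "-1"]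
    have "(\<integral>x. wlap \<Omega> P x * wlap \<Omega> (\<lambda>x. 1 * u x + (-1) * P x) x \<partial>M)
       = 1 * (\<integral>x. wlap \<Omega> P x * wlap \<Omega> u x \<partial>M) + (-1) * (\<integral>x. wlap \<Omega> P x * wlap \<Omega> P x \<partial>M)"
      by (rule integral_linear_AE[OF wlap_L2[OF u] V_L2(3)[OF PV] V_L2(3)[OF PV] wl])
    moreover have "(\<integral>x. wlap \<Omega> P x * wlap \<Omega> (\<lambda>x. 1 * u x + (-1) * P x) x \<partial>M) = 0"
      using P PV by (simp add: is_projection_def ip_real mult.commute)
    ultimately have "b\<^sup>2 = (\<integral>x. wlap \<Omega> P x * wlap \<Omega> u x \<partial>M)"
      using sq(1) unfolding power2_eq_square by linarith
    also have "\<dots> \<le> b * a"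
      unfolding a_def b_def using L2_Cauchy_Schwarz[OF V_L2(3)[OF PV] wlap_L2[OF u]] by linarith
    finally have "b * b \<le> a * b" by (simp add: power2_eq_square mult.commute)
    then show ?thesis using nn cancel by blast
  qed
  have "s \<le> 4 * R\<^sup>2 * b"
  proof -
    obtain \<phi> where ap: "smooth_approx \<phi> P (\<lambda>i. D i P) (\<lambda>_. 0)" using H02_approx[OF H02[OF PV]] .
    \<comment> \<open>\<open>undefined\<close> stands for an arbitrary coordinate direction\<close>
    have "s\<^sup>2 \<le> 4 * R\<^sup>2 * (\<integral>x. (D undefined P x)\<^sup>2 \<partial>M)" unfolding sq by (rule poincare[OF ap R])
    also have "\<dots> \<le> 4 * R\<^sup>2 * dirichlet P P"
      unfolding dirichlet_self by (intro mult_left_mono member_le_sum) (auto intro: integral_square_nonneg)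
    also have "\<dots> \<le> 4 * R\<^sup>2 * (s * b)"
      using dirichlet_le[OF PV] unfolding s_def b_def by (intro mult_left_mono) auto
    finally have "s * s \<le> (4 * R\<^sup>2 * b) * s" by (simp add: power2_eq_square mult_ac)
    then show ?thesis using nn cancel[of s "4 * R\<^sup>2 * b"] by simp
  qed
  then have "s \<le> 4 * R\<^sup>2 * a" using \<open>b \<le> a\<close> by (meson mult_left_mono order_trans zero_le_mult_iff zero_le_numeral zero_le_power2)
  then have "s\<^sup>2 + b\<^sup>2 \<le> (4 * R\<^sup>2 * a)\<^sup>2 + a\<^sup>2" using nn \<open>b \<le> a\<close> by (intro add_mono power_mono) auto
  also have "\<dots> = (16 * R ^ 4 + 1) * a\<^sup>2" by (simp add: power_mult_distrib algebra_simps)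
  finally have "energy P P \<le> (16 * R ^ 4 + 1) * a\<^sup>2" by (simp add: energy_eq sq)
  then have "enorm P \<le> sqrt ((16 * R ^ 4 + 1) * a\<^sup>2)" by (rule real_sqrt_le_mono)
  then show ?thesis using nn by (simp add: real_sqrt_mult a_def integral_square_nonneg)
qed

end

lemma finite_dimensional_space_generators:
  assumes "finite_dimensional_space V"
  obtains B where "finite B" "B \<subseteq> V" "\<And>v. v \<in> V \<Longrightarrow> \<exists>c. v = (\<lambda>x. \<Sum>b\<in>B. c b * b x)" "function_space V"
proof -
  obtain B where B: "finite B" "V = {v. \<exists>c. v = (\<lambda>x. \<Sum>b\<in>B. c b * b x)}"
    using assms unfolding finite_dimensional_space_def by blast
  have "b \<in> V" if "b \<in> B" for b
    unfolding B(2) mem_Collect_eq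
    by (rule exI[of _ "\<lambda>b'. if b' = b then 1 else 0"]) (use B(1) that in \<open>simp add: if_distrib[of "\<lambda>t. t * _"] cong: if_cong\<close>)
  moreover have "function_space V"
  proof
    show "(\<lambda>_. 0) \<in> V" unfolding B(2) mem_Collect_eq by (rule exI[of _ "\<lambda>_. 0"]) simp
    fix u v and a b :: real assume "u \<in> V" "v \<in> V"
    then obtain c d where "u = (\<lambda>x. \<Sum>b\<in>B. c b * b x)" "v = (\<lambda>x. \<Sum>b\<in>B. d b * b x)" unfolding B(2) by blast
    then show "(\<lambda>x. a * u x + b * v x) \<in> V"
      unfolding B(2) mem_Collect_eq
      by (intro exI[of _ "\<lambda>w. a * c w + b * d w"]) (simp add: sum.distrib sum_distrib_left algebra_simps)
  qed
  ultimately show ?thesis using that B by blast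
qed

theorem theorem12:
  fixes \<Omega> :: "(real^'n) set"
    and T \<alpha> r K :: real
    and H :: "real set"
    and \<T> :: "real \<Rightarrow> (real^'n) set set"
    and S :: "real \<Rightarrow> (real^'n \<Rightarrow> real) set"
    and u0 :: "real^'n \<Rightarrow> real"
  assumes "CARD('n) \<le> 2"
    and "polyhedral_lipschitz_domain \<Omega>"
    and "0 < T"
    and "0 < \<alpha>"
    and "H \<subseteq> {0<..<1}"
    and "quasi_uniform_triangulations \<Omega> H \<T>"
    and "3 < r"
    and "fe_spaces \<Omega> H S r K"
    and "H02 \<Omega> u0"
    and "sobolev \<Omega> r u0"
  shows "\<exists>k0>0. \<forall>h\<in>H. \<forall>(N::nat) (m::nat) (U :: nat \<Rightarrow> real^'n \<Rightarrow> real).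
      1 < m \<and> m \<le> N \<and> (\<forall>j<m. U j \<in> S h) \<and> is_projection \<Omega> (S h) u0 (U 0) \<and>
      (\<forall>j\<in>{1..<m}. scheme_step \<Omega> (S h) \<alpha> (T / real N) (U (j - 1)) (U j))
      \<longrightarrow> (\<exists>V\<in>S h. scheme_step \<Omega> (S h) \<alpha> (T / real N) (U (m - 1)) V) \<and>
          (T / real N < k0 \<longrightarrow>
             (\<forall>V\<in>S h. \<forall>V'\<in>S h.
                scheme_step \<Omega> (S h) \<alpha> (T / real N) (U (m - 1)) V \<and>
                scheme_step \<Omega> (S h) \<alpha> (T / real N) (U (m - 1)) V'
                \<longrightarrow> (AE x in lebesgue_on \<Omega>. V x = V' x)))"
proof -
  interpret bounded_open \<Omega> using assms(2) by unfold_locales (auto simp: polyhedral_lipschitz_domain_def)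
  obtain R where R: "0 < R" "\<Omega> \<subseteq> ball 0 R" using bounded_subset_ballD[OF bdd] by blast
  have Rb: "norm x \<le> R" if "x \<in> \<Omega>" for x using R(2) that by force
  \<comment> \<open>\<open>E\<close> bounds the energy norm of all discrete solutions, for every mesh and every time step\<close>
  define E where "E = sqrt (16 * R ^ 4 + 1) * sqrt (\<integral>x. (wlap \<Omega> u0 x)\<^sup>2 \<partial>lebesgue_on \<Omega>)"
  have E: "0 \<le> E" unfolding E_def using R by (intro mult_nonneg_nonneg real_sqrt_ge_zero Bochner_Integration.integral_nonneg) auto
  define k0 where "k0 = 1 / (C_conv * E + 1)"
  have CE: "0 \<le> C_conv * E" using C_conv_pos E by simp
  then have k0: "0 < k0" by (simp add: k0_def)
  have main: "(\<exists>V\<in>S h. scheme_step \<Omega> (S h) \<alpha> (T / real N) (U (m - 1)) V) \<and>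
          (T / real N < k0 \<longrightarrow>
             (\<forall>V\<in>S h. \<forall>V'\<in>S h.
                scheme_step \<Omega> (S h) \<alpha> (T / real N) (U (m - 1)) V \<and>
                scheme_step \<Omega> (S h) \<alpha> (T / real N) (U (m - 1)) V'
                \<longrightarrow> (AE x in lebesgue_on \<Omega>. V x = V' x)))"
    if h: "h \<in> H" and m: "1 < m" "m \<le> N" and U: "\<forall>j<m. U j \<in> S h" and proj: "is_projection \<Omega> (S h) u0 (U 0)"
      and steps: "\<forall>j\<in>{1..<m}. scheme_step \<Omega> (S h) \<alpha> (T / real N) (U (j - 1)) (U j)"
    for h :: real and N m :: nat and U :: "nat \<Rightarrow> real^'n \<Rightarrow> real"
  proof -
    let ?k = "T / real N"
    have fd: "finite_dimensional_space (S h)" and H02: "\<And>v. v \<in> S h \<Longrightarrow> H02 \<Omega> v"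
      using assms(8) h by (auto simp: fe_spaces_def)
    obtain B where B: "finite B" "B \<subseteq> S h" "\<And>v. v \<in> S h \<Longrightarrow> \<exists>c. v = (\<lambda>x. \<Sum>b\<in>B. c b * b x)" and fs: "function_space (S h)"
      using finite_dimensional_space_generators[OF fd] by blast
    interpret galerkin \<Omega> "S h"
    proof (intro galerkin.intro galerkin_axioms.intro)
      show "bounded_open \<Omega>" by unfold_locales
    qed (use fs assms(1) H02 in auto)
    have k: "0 < ?k" using assms(3) m by simp
    have bound: "enorm (U j) \<le> E" if "j < m" for j
      using that
    proof (induction j)
      case 0
      show ?case unfolding E_def using projection_bound[OF _ proj Rb] assms(9) R(1) by (simp add: H02_def)
    next
      case (Suc j)
      have "scheme_step \<Omega> (S h) \<alpha> ?k (U j) (U (Suc j))" using steps Suc.prems by (metis Suc_le_mono atLeastLessThan_iff diff_Suc_1 le0 One_nat_def)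
      then have "enorm (U (Suc j)) \<le> enorm (U j)"
        using U Suc.prems k assms(4) by (intro energy_decreasing) auto
      moreover have "enorm (U j) \<le> E" using Suc by simp
      ultimately show ?case by (rule order_trans)
    qed
    have Um: "U (m - 1) \<in> S h" "enorm (U (m - 1)) \<le> E" using U m bound by auto
    show ?thesis
    proof (intro conjI impI ballI)
      show "\<exists>V\<in>S h. scheme_step \<Omega> (S h) \<alpha> ?k (U (m - 1)) V"
        using step_exists[OF B Um(1) k] assms(4) by simp
    next
      fix V V' assume small: "?k < k0" and V: "V \<in> S h" "V' \<in> S h"
        and s: "scheme_step \<Omega> (S h) \<alpha> ?k (U (m - 1)) V \<and> scheme_step \<Omega> (S h) \<alpha> ?k (U (m - 1)) V'"
      have "?k * (C_conv * enorm (U (m - 1))) \<le> ?k * (C_conv * E)"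
        using k C_conv_pos Um(2) by (intro mult_left_mono) auto
      also have "\<dots> \<le> k0 * (C_conv * E)" using small CE by (intro mult_right_mono) auto
      also have "\<dots> < 1" using CE by (simp add: k0_def)
      finally show "AE x in lebesgue_on \<Omega>. V x = V' x"
        by (rule step_unique[OF Um(1) V k less_imp_le[OF assms(4)] conjunct1[OF s] conjunct2[OF s]])
    qed
  qed
  show ?thesis using k0 main by blast
qed

end
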